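(* For every integer $p\geq 3$, \textsc{Even Cycle Transversal} is NP-complete on graphs of girth at least $p$.
   Context: \textsc{Even Cycle Transversal}: given a graph $G$ and an integer $k$, decide whether there is a set of at most $k$ vertices meeting every (not necessarily induced) cycle of even length in $G$. The girth of a graph is the length of its shortest cycle. *)

theory Defs
  imports
    "HOL-Library.Extended_Nat"
    "HOL-Computational_Algebra.Polynomial"
begin

text \<open>
  States and tape symbols are natural numbers from two finite sets. Symbol 0 is the blank, symbols 1
  and 2 represent the bits \<open>False\<close> and \<open>True\<close>; further symbols may be used as auxiliary ones.
  Tapes are infinite in both directions; a tape is its content together with its head position.
\<close>

datatype move = MoveLeft | Stay | MoveRight

record turing_machine =
  tape_count :: nat
  symbols :: "nat set"
  states :: "nat set"
  start :: nat
  halt :: nat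
  delta :: "nat \<Rightarrow> nat list \<Rightarrow> nat \<times> (nat \<times> move) list"

definition wf_tm :: "turing_machine \<Rightarrow> bool" where
  "wf_tm M \<longleftrightarrow>
     0 < tape_count M \<and>
     finite (symbols M) \<and> {0, 1, 2} \<subseteq> symbols M \<and>
     finite (states M) \<and> start M \<in> states M \<and> halt M \<in> states M \<and>
     (\<forall>q \<in> states M - {halt M}. \<forall>ss. length ss = tape_count M \<and> set ss \<subseteq> symbols M \<longrightarrow>
        (case delta M q ss of (q', acts) \<Rightarrow>
           q' \<in> states M \<and> length acts = tape_count M \<and> fst ` set acts \<subseteq> symbols M))"

type_synonym tape = "(int \<Rightarrow> nat) \<times> int"
type_synonym config = "nat \<times> tape list"

fun shift :: "move \<Rightarrow> int \<Rightarrow> int" where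
  "shift MoveLeft h = h - 1"
| "shift Stay h = h"
| "shift MoveRight h = h + 1"

fun read :: "tape \<Rightarrow> nat" where
  "read (c, h) = c h"

fun act :: "nat \<times> move \<Rightarrow> tape \<Rightarrow> tape" where
  "act (s, m) (c, h) = (c(h := s), shift m h)"

fun step :: "turing_machine \<Rightarrow> config \<Rightarrow> config" where
  "step M (q, ts) =
     (if q = halt M then (q, ts)
      else case delta M q (map read ts) of (q', acts) \<Rightarrow> (q', map2 act acts ts))"

fun bit_symbol :: "bool \<Rightarrow> nat" where
  "bit_symbol False = 1"
| "bit_symbol True = 2"

definition blank_tape :: tape where
  "blank_tape = (\<lambda>_. 0, 0)"

definition word_tape :: "bool list \<Rightarrow> tape" where
  "word_tape x = (\<lambda>i. if 0 \<le> i \<and> i < int (length x) then bit_symbol (x ! nat i) else 0, 0)"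

definition init :: "turing_machine \<Rightarrow> bool list \<Rightarrow> config" where
  "init M x = (start M, word_tape x # replicate (tape_count M - 1) blank_tape)"

text \<open>
  The output is read off the last tape, from cell 0 up to the first blank; the input is on the first
  tape (the same one if there is only one).
\<close>

definition holds_word :: "tape \<Rightarrow> bool list \<Rightarrow> bool" where
  "holds_word t y \<longleftrightarrow>
     (\<forall>i < length y. fst t (int i) = bit_symbol (y ! i)) \<and> fst t (int (length y)) = 0"

definition halts_with :: "turing_machine \<Rightarrow> bool list \<Rightarrow> bool list \<Rightarrow> nat \<Rightarrow> bool" where
  "halts_with M x y t \<longleftrightarrow>
     (case (step M ^^ t) (init M x) of (q, ts) \<Rightarrow> q = halt M \<and> holds_word (last ts) y)"

type_synonym language = "bool list set"

definition polytime_computable :: "(bool list \<Rightarrow> bool list) \<Rightarrow> bool" where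
  "polytime_computable f \<longleftrightarrow>
     (\<exists>M (b :: nat poly). wf_tm M \<and>
        (\<forall>x. \<exists>t \<le> poly b (length x). halts_with M x (f x) t))"

definition polytime_decidable :: "language \<Rightarrow> bool" where
  "polytime_decidable L \<longleftrightarrow> polytime_computable (\<lambda>x. [x \<in> L])"

text \<open>
  An injective coding of pairs of words: the bits of the first word are doubled, and the first
  unequal pair of bits marks its end.
\<close>

definition pair_code :: "bool list \<Rightarrow> bool list \<Rightarrow> bool list" where
  "pair_code x w = concat (map (\<lambda>b. [b, b]) x) @ [False, True] @ w"

definition NP :: "language set" where
  "NP = {L. \<exists>R (b :: nat poly). polytime_decidable R \<and>
           (\<forall>x. x \<in> L \<longleftrightarrow> (\<exists>w. length w \<le> poly b (length x) \<and> pair_code x w \<in> R))}"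

definition polytime_reducible :: "language \<Rightarrow> language \<Rightarrow> bool" where
  "polytime_reducible A B \<longleftrightarrow>
     (\<exists>f. polytime_computable f \<and> (\<forall>x. x \<in> A \<longleftrightarrow> f x \<in> B))"

definition NP_hard :: "language \<Rightarrow> bool" where
  "NP_hard L \<longleftrightarrow> (\<forall>A \<in> NP. polytime_reducible A L)"

definition NP_complete :: "language \<Rightarrow> bool" where
  "NP_complete L \<longleftrightarrow> L \<in> NP \<and> NP_hard L"

definition simple_graph :: "'a set \<Rightarrow> 'a set set \<Rightarrow> bool" where
  "simple_graph V E \<longleftrightarrow> finite V \<and> (\<forall>e \<in> E. \<exists>u \<in> V. \<exists>v \<in> V. u \<noteq> v \<and> e = {u, v})"

definition is_cycle :: "'a set set \<Rightarrow> 'a list \<Rightarrow> bool" where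
  "is_cycle E c \<longleftrightarrow>
     3 \<le> length c \<and> distinct c \<and>
     (\<forall>i < length c. {c ! i, c ! (Suc i mod length c)} \<in> E)"

text \<open>The infimum of the empty set is \<open>\<infinity>\<close>, so acyclic graphs have infinite girth.\<close>

definition girth :: "'a set set \<Rightarrow> enat" where
  "girth E = (INF c \<in> {c. is_cycle E c}. enat (length c))"

definition even_cycle_transversal :: "'a set \<Rightarrow> 'a set set \<Rightarrow> 'a set \<Rightarrow> bool" where
  "even_cycle_transversal V E S \<longleftrightarrow>
     S \<subseteq> V \<and> (\<forall>c. is_cycle E c \<and> even (length c) \<longrightarrow> set c \<inter> S \<noteq> {})"

fun binary :: "nat \<Rightarrow> bool list" where
  "binary n = (if n = 0 then [] else odd n # binary (n div 2))"

declare binary.simps [simp del]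

text \<open>
  A graph on the vertices \<open>0, \<dots>, n - 1\<close> is coded by its number of vertices in unary and its adjacency
  matrix of \<open>n\<^sup>2\<close> bits, row by row; the remaining bits are the number
  \<open>k\<close> in binary, least significant bit first.
\<close>

definition encode_instance :: "nat \<Rightarrow> nat set set \<Rightarrow> nat \<Rightarrow> bool list" where
  "encode_instance n E k =
     replicate n True @ [False] @ [{u, v} \<in> E. u \<leftarrow> [0..<n], v \<leftarrow> [0..<n]] @ binary k"

text \<open>
  The problem restricted to graphs of girth at least \<open>p\<close>. Words that do not code an instance with
  such a graph are outside the language.
\<close>

definition ECT_girth :: "nat \<Rightarrow> language" where
  "ECT_girth p =
     {encode_instance n E k | n E k.
        simple_graph {0..<n} E \<and> enat p \<le> girth E \<and>
        (\<exists>S. even_cycle_transversal {0..<n} E S \<and> card S \<le> k)}"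

end

theory Submission
  imports Defs "HOL-Library.Countable"
begin

text \<open>
  Polynomial time is handled through closure properties: a function that is built by nested loops over
  counters of polynomially bounded size is computed by a multi-tape machine on which a counter is the
  position of a head. This class contains the arithmetic operations and is closed under bounded
  quantification, so that both the reduction and the verifier are obtained from formulas.

  For hardness, the runs of a verifier on \<open>pair_code x w\<close> with unknown \<open>w\<close> are the solutions of a
  constraint satisfaction problem on the cells of a tableau, with constraints on pairs of cells only.
  Take the pairs of a cell and a value as vertices and join incompatible ones: independent sets with
  one vertex for each cell correspond to accepting runs. Replacing every edge of this graph by two
  parallel paths of even length at least \<open>p\<close> turns vertex covers into even cycle transversals and
  makes the girth large.

  For membership, the certificate consists of the transversal and of the reachability relations of the
  remaining graph with one vertex deleted. In a graph without even cycles a vertex \<open>u\<close> has at most two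
  neighbours in each component of the graph without \<open>u\<close>, because three would yield three paths with
  common ends, two of them of the same parity. Hence a cycle is determined by any of its arcs.
\<close>

section \<open>While programs on tapes\<close>

text \<open>A transversal alone is no usable certificate: the verifier must still see in polynomial
  time that the remaining graph has no even cycle, and the relations in the certificate replace a
  search for one. They are only checked to be closed under the edges, so they may be larger than
  reachability; closure together with uniqueness of turns already forces the walk to follow every
  cycle. In the hardness proof a tableau value that violates a constraint by itself becomes a loop
  of the conflict graph, which is why the path construction admits loops: a loop is replaced by a
  single even cycle. Counters hold numbers in unary, so every intermediate value must stay
  polynomially bounded. This shapes the recursion principle with its explicit bound, the girth test
  by \<open>n ^ p\<close> codes of short cycles with \<open>p\<close> constant, and the comparison
  with the budget, which is given in binary and may be exponentially large.\<close>

datatype com =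
    Move nat move
  | Write nat nat
  | Seq com com
  | Branch nat nat com com
  | Loop nat nat com

text \<open>Machine states have to be natural numbers; countability lets \<open>to_nat\<close>
  number the lists of commands that serve as control states.\<close>

instance move :: countable
  by countable_datatype

instance com :: countable
  by countable_datatype

fun tapes_of :: "com \<Rightarrow> nat set" where
  "tapes_of (Move j m) = {j}"
| "tapes_of (Write j s) = {j}"
| "tapes_of (Seq c d) = tapes_of c \<union> tapes_of d"
| "tapes_of (Branch j s c d) = insert j (tapes_of c \<union> tapes_of d)"
| "tapes_of (Loop j s c) = insert j (tapes_of c)"

fun symbols_of :: "com \<Rightarrow> nat set" where
  "symbols_of (Move j m) = {}"
| "symbols_of (Write j s) = {s}"
| "symbols_of (Seq c d) = symbols_of c \<union> symbols_of d"
| "symbols_of (Branch j s c d) = symbols_of c \<union> symbols_of d"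
| "symbols_of (Loop j s c) = symbols_of c"

lemma finite_tapes_of [simp]: "finite (tapes_of c)"
  by (induction c) auto

text \<open>The count is exactly that of the compiled machine: unfolding a \<open>Seq\<close> and
  each test of a \<open>Branch\<close> or \<open>Loop\<close> take one step of their own.\<close>

inductive exec :: "com \<Rightarrow> (nat \<Rightarrow> tape) \<Rightarrow> nat \<Rightarrow> (nat \<Rightarrow> tape) \<Rightarrow> bool" where
  exec_Move: "exec (Move j m) \<tau> 1 (\<tau>(j := act (read (\<tau> j), m) (\<tau> j)))"
| exec_Write: "exec (Write j s) \<tau> 1 (\<tau>(j := act (s, Stay) (\<tau> j)))"
| exec_Seq: "exec c \<tau> t \<tau>' \<Longrightarrow> exec d \<tau>' t' \<tau>'' \<Longrightarrow> exec (Seq c d) \<tau> (Suc (t + t')) \<tau>''"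
| exec_Branch1: "read (\<tau> j) = s \<Longrightarrow> exec c \<tau> t \<tau>' \<Longrightarrow> exec (Branch j s c d) \<tau> (Suc t) \<tau>'"
| exec_Branch2: "read (\<tau> j) \<noteq> s \<Longrightarrow> exec d \<tau> t \<tau>' \<Longrightarrow> exec (Branch j s c d) \<tau> (Suc t) \<tau>'"
| exec_Loop1: "read (\<tau> j) = s \<Longrightarrow> exec (Loop j s c) \<tau> 1 \<tau>"
| exec_Loop2: "read (\<tau> j) \<noteq> s \<Longrightarrow> exec c \<tau> t \<tau>' \<Longrightarrow> exec (Loop j s c) \<tau>' t' \<tau>'' \<Longrightarrow>
    exec (Loop j s c) \<tau> (Suc (t + t')) \<tau>''"

text \<open>A control state of the compiled machine is the list of commands still to be run.\<close>

definition idle :: "nat list \<Rightarrow> (nat \<times> move) list" where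
  "idle ss = map (\<lambda>s. (s, Stay)) ss"

fun advance :: "com list \<Rightarrow> nat list \<Rightarrow> com list \<times> (nat \<times> move) list" where
  "advance [] ss = ([], idle ss)"
| "advance (Move j m # ks) ss = (ks, (idle ss)[j := (ss ! j, m)])"
| "advance (Write j s # ks) ss = (ks, (idle ss)[j := (s, Stay)])"
| "advance (Seq c d # ks) ss = (c # d # ks, idle ss)"
| "advance (Branch j s c d # ks) ss = ((if ss ! j = s then c else d) # ks, idle ss)"
| "advance (Loop j s c # ks) ss = (if ss ! j = s then ks else c # Loop j s c # ks, idle ss)"

text \<open>The control stacks that occur while \<open>c\<close> runs on top of \<open>ks\<close>,
  before \<open>ks\<close> itself is reached. A loop body returns to the stack that starts with the
  same loop, which keeps the set finite.\<close>

fun continuations :: "com \<Rightarrow> com list \<Rightarrow> com list set" where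
  "continuations (Move j m) ks = {Move j m # ks}"
| "continuations (Write j s) ks = {Write j s # ks}"
| "continuations (Seq c d) ks =
     insert (Seq c d # ks) (continuations c (d # ks) \<union> continuations d ks)"
| "continuations (Branch j s c d) ks =
     insert (Branch j s c d # ks) (continuations c ks \<union> continuations d ks)"
| "continuations (Loop j s c) ks =
     insert (Loop j s c # ks) (continuations c (Loop j s c # ks))"

lemma finite_continuations: "finite (continuations c ks)"
  by (induction c arbitrary: ks) auto

lemma continuations_start: "c # ks \<in> continuations c ks"
  by (cases c) auto

lemma continuations_closed:
  "k \<in> continuations c ks \<Longrightarrow> fst (advance k ss) \<in> insert ks (continuations c ks)"
proof (induction c arbitrary: k ks)
  case (Seq c d)
  then show ?case
    using continuations_start[of c "d # ks"] continuations_start[of d ks] by fastforce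
next
  case (Branch j s c d)
  then show ?case
    using continuations_start[of c ks] continuations_start[of d ks] by (auto split: if_splits)
next
  case (Loop j s c)
  then show ?case
    using continuations_start[of c "Loop j s c # ks"] by (auto split: if_splits)
qed auto

lemma continuations_acts:
  assumes "k \<in> continuations c ks" and "set ss \<subseteq> A" and "symbols_of c \<subseteq> A"
    and "tapes_of c \<subseteq> {..<length ss}"
  shows "length (snd (advance k ss)) = length ss \<and> fst ` set (snd (advance k ss)) \<subseteq> A"
proof -
  have idle: "fst ` set (idle ss) \<subseteq> A" "length (idle ss) = length ss"
    using assms(2) by (auto simp: idle_def)
  have upd: "fst ` set ((idle ss)[j := (s, m)]) \<subseteq> A" if "s \<in> A" for j s m
    using that idle(1) set_update_subset_insert[of "idle ss" j "(s, m)"] by fastforce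
  have nth: "ss ! j \<in> A" if "j < length ss" for j
    using that assms(2) nth_mem by blast
  show ?thesis
    using assms(1,3,4)
  proof (induction c arbitrary: k ks)
    case (Move j m)
    then show ?case
      using upd[OF nth, of j j m] idle by simp
  next
    case (Write j s)
    then show ?case
      using upd[of s j Stay] idle by simp
  next
    case (Seq c d)
    from Seq.prems(1)[unfolded continuations.simps] Seq.prems(2,3) show ?case
      unfolding symbols_of.simps tapes_of.simps
      using idle Seq.IH(1)[of k "d # ks"] Seq.IH(2)[of k ks]
      by (elim insertE UnE) (simp_all only: advance.simps snd_conv Un_subset_iff simp_thms)
  next
    case (Branch j s c d)
    from Branch.prems(1)[unfolded continuations.simps] Branch.prems(2,3) show ?case
      unfolding symbols_of.simps tapes_of.simps
      using idle Branch.IH(1)[of k ks] Branch.IH(2)[of k ks]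
      by (elim insertE UnE) (simp_all only: advance.simps snd_conv Un_subset_iff insert_subset simp_thms)
  next
    case (Loop j s c)
    from Loop.prems(1)[unfolded continuations.simps] Loop.prems(2,3) show ?case
      unfolding symbols_of.simps tapes_of.simps
      using idle Loop.IH[of k "Loop j s c # ks"]
      by (elim insertE) (simp_all only: advance.simps snd_conv insert_subset simp_thms)
  qed
qed

text \<open>The empty stack is the halting state. Three symbols suffice because a counter keeps its
  value in the head position.\<close>

definition compile :: "com \<Rightarrow> nat \<Rightarrow> turing_machine" where
  "compile c K = \<lparr>tape_count = K, symbols = {0, 1, 2},
     states = to_nat ` insert [] (continuations c []),
     start = to_nat [c], halt = to_nat ([] :: com list),
     delta = (\<lambda>q ss. case advance (from_nat q) ss of (k, as) \<Rightarrow> (to_nat k, as))\<rparr>"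

lemma wf_compile:
  assumes "0 < K" and "tapes_of c \<subseteq> {..<K}" and "symbols_of c \<subseteq> {0, 1, 2}"
  shows "wf_tm (compile c K)"
  unfolding wf_tm_def
proof (intro conjI ballI allI impI)
  fix q ss
  assume q: "q \<in> states (compile c K) - {halt (compile c K)}"
    and ss: "length ss = tape_count (compile c K) \<and> set ss \<subseteq> symbols (compile c K)"
  from q obtain k where k: "k \<in> continuations c []" "q = to_nat k"
    by (auto simp: compile_def)
  obtain k' as where adv: "advance k ss = (k', as)"
    by fastforce
  have "k' \<in> insert [] (continuations c [])"
    using continuations_closed[OF k(1), of ss] adv by simp
  moreover have "length as = K \<and> fst ` set as \<subseteq> {0, 1, 2}"
    using continuations_acts[OF k(1), where A = "{0, 1, 2}" and ss = ss] adv ss assms by (simp add: compile_def)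
  ultimately show "case delta (compile c K) q ss of (q', acts) \<Rightarrow>
      q' \<in> states (compile c K) \<and> length acts = tape_count (compile c K) \<and>
      fst ` set acts \<subseteq> symbols (compile c K)"
    by (auto simp: compile_def k(2) adv)
qed (use assms finite_continuations continuations_start in \<open>auto simp: compile_def\<close>)

lemma act_read_Stay: "act (read \<theta>, Stay) \<theta> = \<theta>"
  by (cases \<theta>) simp

lemma map2_act_idle: "map2 act (idle (map read ts)) ts = ts"
  by (rule nth_equalityI) (simp_all add: idle_def act_read_Stay)

lemma map2_act_update:
  assumes "j < K"
  shows "map2 act ((idle (map read (map \<tau> [0..<K])))[j := a]) (map \<tau> [0..<K]) =
    map (\<tau>(j := act a (\<tau> j))) [0..<K]"
proof (rule nth_equalityI)
  fix i
  assume "i < length (map2 act ((idle (map read (map \<tau> [0..<K])))[j := a]) (map \<tau> [0..<K]))"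
  then show "map2 act ((idle (map read (map \<tau> [0..<K])))[j := a]) (map \<tau> [0..<K]) ! i =
      map (\<tau>(j := act a (\<tau> j))) [0..<K] ! i"
    using assms by (cases "i = j") (simp_all add: idle_def act_read_Stay)
qed (simp add: idle_def)

lemma step_compile:
  assumes "advance (c' # ks) (map read ts) = (k, as)"
  shows "step (compile c K) (to_nat (c' # ks), ts) = (to_nat k, map2 act as ts)"
  using assms by (simp add: compile_def)

lemma funpow_add_apply: "(f ^^ m) x = y \<Longrightarrow> (f ^^ n) y = z \<Longrightarrow> (f ^^ (n + m)) x = z"
  by (simp add: funpow_add)

text \<open>The induction leaves the waiting stack arbitrary: a run of \<open>c\<close> ends with
  precisely \<open>ks\<close> left over, so the runs of consecutive commands can be
  concatenated.\<close>

lemma compile_exec: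
  assumes "exec c \<tau> t \<tau>'" and "tapes_of c \<subseteq> {..<K}"
  shows "(step (compile c0 K) ^^ t) (to_nat (c # ks), map \<tau> [0..<K]) =
    (to_nat ks, map \<tau>' [0..<K])"
  using assms
proof (induction arbitrary: ks rule: exec.induct)
  case (exec_Move j m \<tau>)
  then show ?case
    using map2_act_update[of j K \<tau>]
    by (simp add: step_compile[OF advance.simps(2)] del: step.simps map_map)
next
  case (exec_Write j s \<tau>)
  then show ?case
    using map2_act_update[of j K \<tau>]
    by (simp add: step_compile[OF advance.simps(3)] del: step.simps map_map)
next
  case (exec_Seq c \<tau> t \<tau>' d t' \<tau>'')
  have "step (compile c0 K) (to_nat (Seq c d # ks), map \<tau> [0..<K]) =
      (to_nat (c # d # ks), map \<tau> [0..<K])"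
    by (simp only: step_compile[OF advance.simps(4)] map2_act_idle)
  with funpow_add_apply[OF exec_Seq.IH(1)[of "d # ks"] exec_Seq.IH(2)[of ks]] exec_Seq.prems
  show ?case
    by (simp add: funpow_Suc_right add.commute[of t] del: step.simps funpow.simps)
next
  case (exec_Branch1 \<tau> j s c t \<tau>' d)
  have "step (compile c0 K) (to_nat (Branch j s c d # ks), map \<tau> [0..<K]) =
      (to_nat (c # ks), map \<tau> [0..<K])"
    using exec_Branch1
    by (simp only: step_compile[OF advance.simps(5)] map2_act_idle) auto
  with exec_Branch1 show ?case
    by (simp add: funpow_Suc_right del: step.simps funpow.simps)
next
  case (exec_Branch2 \<tau> j s d t \<tau>' c)
  have "step (compile c0 K) (to_nat (Branch j s c d # ks), map \<tau> [0..<K]) =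
      (to_nat (d # ks), map \<tau> [0..<K])"
    using exec_Branch2
    by (simp only: step_compile[OF advance.simps(5)] map2_act_idle) auto
  with exec_Branch2 show ?case
    by (simp add: funpow_Suc_right del: step.simps funpow.simps)
next
  case (exec_Loop1 \<tau> j s c)
  have "step (compile c0 K) (to_nat (Loop j s c # ks), map \<tau> [0..<K]) =
      (to_nat ks, map \<tau> [0..<K])"
    using exec_Loop1
    by (simp only: step_compile[OF advance.simps(6)] map2_act_idle) auto
  then show ?case
    by (simp del: step.simps)
next
  case (exec_Loop2 \<tau> j s c t \<tau>' t' \<tau>'')
  have "step (compile c0 K) (to_nat (Loop j s c # ks), map \<tau> [0..<K]) =
      (to_nat (c # Loop j s c # ks), map \<tau> [0..<K])"
    using exec_Loop2
    by (simp only: step_compile[OF advance.simps(6)] map2_act_idle) auto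
  with funpow_add_apply[OF exec_Loop2.IH(1)[of "Loop j s c # ks"] exec_Loop2.IH(2)[of ks]] exec_Loop2.prems
  show ?case
    by (simp add: funpow_Suc_right add.commute[of t] del: step.simps funpow.simps)
qed

text \<open>Only an upper bound on the time is kept, so that all rounds of a loop can share one
  estimate.\<close>

definition runs :: "com \<Rightarrow> (nat \<Rightarrow> tape) \<Rightarrow> (nat \<Rightarrow> tape) \<Rightarrow> nat \<Rightarrow> bool" where
  "runs c \<tau> \<tau>' b \<longleftrightarrow> (\<exists>t\<le>b. exec c \<tau> t \<tau>')"

lemma runs_mono: "runs c \<tau> \<tau>' b \<Longrightarrow> b \<le> b' \<Longrightarrow> runs c \<tau> \<tau>' b'"
  unfolding runs_def using order_trans by blast

lemma runs_Move: "\<tau>' = \<tau>(j := act (read (\<tau> j), m) (\<tau> j)) \<Longrightarrow> runs (Move j m) \<tau> \<tau>' 1"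
  unfolding runs_def using exec_Move by blast

lemma runs_Write: "\<tau>' = \<tau>(j := act (s, Stay) (\<tau> j)) \<Longrightarrow> runs (Write j s) \<tau> \<tau>' 1"
  unfolding runs_def using exec_Write by blast

lemma runs_Seq: "runs c \<tau> \<tau>' b \<Longrightarrow> runs d \<tau>' \<tau>'' b' \<Longrightarrow> runs (Seq c d) \<tau> \<tau>'' (b + b' + 1)"
  unfolding runs_def by (metis Suc_eq_plus1 add_mono add_le_mono1 exec_Seq)

lemma runs_Branch:
  assumes "read (\<tau> j) = s \<Longrightarrow> runs c \<tau> \<tau>' b" and "read (\<tau> j) \<noteq> s \<Longrightarrow> runs d \<tau> \<tau>' b"
  shows "runs (Branch j s c d) \<tau> \<tau>' (b + 1)"
  using assms unfolding runs_def
  by (metis Suc_eq_plus1 Suc_le_mono exec_Branch1 exec_Branch2)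

text \<open>Here \<open>\<sigma> i\<close> describes the tapes after \<open>i\<close> rounds.\<close>

lemma runs_Loop:
  assumes "\<And>i. i < v \<Longrightarrow> read (\<sigma> i j) \<noteq> s" and "read (\<sigma> v j) = s"
    and "\<And>i. i < v \<Longrightarrow> runs c (\<sigma> i) (\<sigma> (Suc i)) b"
    and "\<sigma> 0 = \<tau>" and "\<sigma> v = \<tau>'"
  shows "runs (Loop j s c) \<tau> \<tau>' (v * (b + 1) + 1)"
  using assms
proof (induction v arbitrary: \<sigma> \<tau>)
  case 0
  then show ?case
    unfolding runs_def using exec_Loop1 by fastforce
next
  case (Suc v)
  have "runs (Loop j s c) (\<sigma> (Suc 0)) \<tau>' (v * (b + 1) + 1)"
    using Suc.prems by (intro Suc.IH[of "\<lambda>i. \<sigma> (Suc i)"]) auto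
  then obtain t' where t': "t' \<le> v * (b + 1) + 1" "exec (Loop j s c) (\<sigma> (Suc 0)) t' \<tau>'"
    unfolding runs_def by blast
  obtain t where t: "t \<le> b" "exec c \<tau> t (\<sigma> (Suc 0))"
    using Suc.prems(3)[of 0] Suc.prems(4) unfolding runs_def by blast
  have "exec (Loop j s c) \<tau> (Suc (t + t')) \<tau>'"
    using Suc.prems(1)[of 0] Suc.prems(4) t(2) t'(2) by (intro exec_Loop2) auto
  moreover have "Suc (t + t') \<le> Suc v * (b + 1) + 1"
    using t(1) t'(1) by (simp add: algebra_simps)
  ultimately show ?case
    unfolding runs_def by blast
qed

lemma compile_runs:
  assumes "runs c (\<lambda>j. if j = 0 then word_tape x else blank_tape) \<tau>' b"
    and "0 < K" and "tapes_of c \<subseteq> {..<K}"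
  shows "\<exists>t\<le>b. (step (compile c K) ^^ t) (init (compile c K) x) =
    (halt (compile c K), map \<tau>' [0..<K])"
proof -
  let ?\<tau> = "\<lambda>j. if j = (0 :: nat) then word_tape x else blank_tape"
  obtain t where t: "t \<le> b" "exec c ?\<tau> t \<tau>'"
    using assms(1) unfolding runs_def by blast
  have "word_tape x # replicate (K - 1) blank_tape = map ?\<tau> [0..<K]"
    using assms(2) by (intro nth_equalityI) (auto simp: nth_Cons split: nat.split)
  then have "init (compile c K) x = (to_nat [c], map ?\<tau> [0..<K])"
    by (simp add: init_def compile_def)
  moreover have "halt (compile c K) = to_nat ([] :: com list)"
    by (simp add: compile_def)
  ultimately show ?thesis
    using compile_exec[OF t(2) assms(3), of c "[]"] t(1) by auto
qed

section \<open>Counters\<close>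

text \<open>A counter is a tape whose cell 0 carries the symbol 1, all others being blank; its value is
  the position of the head.\<close>

definition counter :: "nat \<Rightarrow> tape" where
  "counter v = ((\<lambda>i. if i = 0 then 1 else 0), int v)"

lemma read_counter [simp]: "read (counter v) = (if v = 0 then 1 else 0)"
  by (simp add: counter_def)

definition inc :: "nat \<Rightarrow> com" where
  "inc j = Move j MoveRight"

definition dec :: "nat \<Rightarrow> com" where
  "dec j = Move j MoveLeft"

definition clear :: "nat \<Rightarrow> com" where
  "clear j = Loop j 1 (dec j)"

definition transfer :: "nat \<Rightarrow> nat \<Rightarrow> com" where
  "transfer j k = Loop j 1 (Seq (dec j) (inc k))"

text \<open>Counting a counter down destroys it, so the value goes to \<open>k\<close> and
  \<open>s\<close> simultaneously and is then moved back from \<open>s\<close>.\<close>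

definition copy :: "nat \<Rightarrow> nat \<Rightarrow> nat \<Rightarrow> com" where
  "copy j k s = Seq (Loop j 1 (Seq (dec j) (Seq (inc k) (inc s)))) (transfer s j)"

lemma tapes_of_counter_ops [simp]:
  "tapes_of (inc j) = {j}" "tapes_of (dec j) = {j}" "tapes_of (clear j) = {j}"
  "tapes_of (transfer j k) = {j, k}" "tapes_of (copy j k s) = {j, k, s}"
  by (auto simp: inc_def dec_def clear_def transfer_def copy_def)

lemma symbols_of_counter_ops [simp]:
  "symbols_of (inc j) = {}" "symbols_of (dec j) = {}" "symbols_of (clear j) = {}"
  "symbols_of (transfer j k) = {}" "symbols_of (copy j k s) = {}"
  by (auto simp: inc_def dec_def clear_def transfer_def copy_def)

lemma runs_inc: "\<tau> j = counter v \<Longrightarrow> runs (inc j) \<tau> (\<tau>(j := counter (Suc v))) 1"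
  unfolding inc_def by (rule runs_Move) (auto simp: counter_def fun_eq_iff)

lemma runs_dec: "\<tau> j = counter (Suc v) \<Longrightarrow> runs (dec j) \<tau> (\<tau>(j := counter v)) 1"
  unfolding dec_def by (rule runs_Move) (auto simp: counter_def fun_eq_iff)

lemma runs_clear:
  assumes "\<tau> j = counter v"
  shows "runs (clear j) \<tau> (\<tau>(j := counter 0)) (2 * v + 1)"
proof -
  have "runs (dec j) (\<tau>(j := counter (v - i))) (\<tau>(j := counter (v - Suc i))) 1" if "i < v" for i
    using runs_dec[of "\<tau>(j := counter (v - i))" j "v - Suc i"] that by (simp add: Suc_diff_Suc)
  then have "runs (clear j) \<tau> (\<tau>(j := counter 0)) (v * (1 + 1) + 1)"
    unfolding clear_def
    by (intro runs_Loop[where \<sigma> = "\<lambda>i. \<tau>(j := counter (v - i))"]) (use assms in auto)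
  then show ?thesis
    by (rule runs_mono) simp
qed

lemma runs_transfer:
  assumes "\<tau> j = counter v" and "\<tau> k = counter w" and "j \<noteq> k"
  shows "runs (transfer j k) \<tau> (\<tau>(j := counter 0, k := counter (w + v))) (4 * v + 1)"
proof -
  let ?\<sigma> = "\<lambda>i. \<tau>(j := counter (v - i), k := counter (w + i))"
  have "runs (Seq (dec j) (inc k)) (?\<sigma> i) (?\<sigma> (Suc i)) 3" if "i < v" for i
  proof -
    have "runs (dec j) (?\<sigma> i) ((?\<sigma> i)(j := counter (v - Suc i))) 1"
      using runs_dec[of "?\<sigma> i" j "v - Suc i"] that assms(3) by (simp add: Suc_diff_Suc)
    moreover have "runs (inc k) ((?\<sigma> i)(j := counter (v - Suc i)))
        ((?\<sigma> i)(j := counter (v - Suc i), k := counter (Suc (w + i)))) 1"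
      using assms(3) by (intro runs_inc) auto
    moreover have "(?\<sigma> i)(j := counter (v - Suc i), k := counter (Suc (w + i))) = ?\<sigma> (Suc i)"
      by auto
    ultimately have "runs (Seq (dec j) (inc k)) (?\<sigma> i) (?\<sigma> (Suc i)) (1 + 1 + 1)"
      by (metis runs_Seq)
    then show ?thesis
      by (rule runs_mono) simp
  qed
  then have "runs (transfer j k) \<tau> (\<tau>(j := counter 0, k := counter (w + v))) (v * (3 + 1) + 1)"
    unfolding transfer_def
    by (intro runs_Loop[where \<sigma> = ?\<sigma>]) (use assms in auto)
  then show ?thesis
    by (rule runs_mono) simp
qed

lemma runs_copy:
  assumes "\<tau> j = counter v" and "\<tau> k = counter 0" and "\<tau> s = counter 0"
    and "j \<noteq> k" and "j \<noteq> s" and "k \<noteq> s"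
  shows "runs (copy j k s) \<tau> (\<tau>(k := counter v)) (10 * v + 3)"
proof -
  let ?\<sigma> = "\<lambda>i. \<tau>(j := counter (v - i), k := counter i, s := counter i)"
  let ?c = "Loop j 1 (Seq (dec j) (Seq (inc k) (inc s)))"
  have "runs (Seq (dec j) (Seq (inc k) (inc s))) (?\<sigma> i) (?\<sigma> (Suc i)) 5" if "i < v" for i
  proof -
    let ?\<sigma>1 = "(?\<sigma> i)(j := counter (v - Suc i))"
    let ?\<sigma>2 = "?\<sigma>1(k := counter (Suc i))"
    have "runs (dec j) (?\<sigma> i) ?\<sigma>1 1"
      using runs_dec[of "?\<sigma> i" j "v - Suc i"] that assms by (simp add: Suc_diff_Suc)
    moreover have "runs (inc k) ?\<sigma>1 ?\<sigma>2 1"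
      using assms by (intro runs_inc) auto
    moreover have "runs (inc s) ?\<sigma>2 (?\<sigma>2(s := counter (Suc i))) 1"
      using assms by (intro runs_inc) auto
    moreover have "?\<sigma>2(s := counter (Suc i)) = ?\<sigma> (Suc i)"
      using assms by auto
    ultimately have "runs (Seq (dec j) (Seq (inc k) (inc s))) (?\<sigma> i) (?\<sigma> (Suc i)) (1 + (1 + 1 + 1) + 1)"
      by (metis runs_Seq)
    then show ?thesis
      by (rule runs_mono) simp
  qed
  then have "runs ?c \<tau> (\<tau>(j := counter 0, k := counter v, s := counter v)) (v * (5 + 1) + 1)"
    by (intro runs_Loop[where \<sigma> = ?\<sigma>]) (use assms in auto)
  moreover have "runs (transfer s j) (\<tau>(j := counter 0, k := counter v, s := counter v))
      ((\<tau>(j := counter 0, k := counter v, s := counter v))(s := counter 0, j := counter (0 + v)))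
      (4 * v + 1)"
    using assms by (intro runs_transfer) auto
  moreover have "(\<tau>(j := counter 0, k := counter v, s := counter v))
      (s := counter 0, j := counter (0 + v)) = \<tau>(k := counter v)"
    using assms by auto
  ultimately have "runs (copy j k s) \<tau> (\<tau>(k := counter v)) (v * (5 + 1) + 1 + (4 * v + 1) + 1)"
    unfolding copy_def by (metis runs_Seq)
  then show ?thesis
    by (rule runs_mono) simp
qed

section \<open>Functions computable in polynomial time on counters\<close>

definition input_size :: "nat \<Rightarrow> bool list \<Rightarrow> (nat \<Rightarrow> nat) \<Rightarrow> nat" where
  "input_size n x e = length x + (\<Sum>i<n. e i)"

text \<open>The base is at least 2, so constant factors and sums are absorbed by a larger exponent
  and one exponent \<open>a\<close> represents every polynomial bound.\<close>

definition poly_bounded :: "nat \<Rightarrow> (bool list \<Rightarrow> (nat \<Rightarrow> nat) \<Rightarrow> nat) \<Rightarrow> bool" where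
  "poly_bounded n f \<longleftrightarrow> (\<exists>a. \<forall>x e. f x e \<le> (input_size n x e + 2) ^ a)"

lemma poly_bounded_mono: "poly_bounded n g \<Longrightarrow> (\<And>x e. f x e \<le> g x e) \<Longrightarrow> poly_bounded n f"
  unfolding poly_bounded_def using order_trans by blast

lemma poly_bounded_const: "poly_bounded n (\<lambda>x e. c)"
  unfolding poly_bounded_def
proof (intro exI allI)
  fix x e
  have "c \<le> 2 ^ c"
    by (simp add: less_imp_le)
  also have "\<dots> \<le> (input_size n x e + 2) ^ c"
    by (intro power_mono) auto
  finally show "c \<le> (input_size n x e + 2) ^ c" .
qed

lemma poly_bounded_input_size: "poly_bounded n (\<lambda>x e. input_size n x e)"
  unfolding poly_bounded_def by (rule exI[of _ 1]) simp

lemma poly_bounded_length: "poly_bounded n (\<lambda>x e. length x)"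
  by (rule poly_bounded_mono[OF poly_bounded_input_size]) (simp add: input_size_def)

lemma poly_bounded_var: "i < n \<Longrightarrow> poly_bounded n (\<lambda>x e. e i)"
  by (rule poly_bounded_mono[OF poly_bounded_input_size])
    (auto simp: input_size_def intro!: trans_le_add2 member_le_sum[of i "{..<n}"])

lemma poly_bounded_add:
  assumes "poly_bounded n f" and "poly_bounded n g"
  shows "poly_bounded n (\<lambda>x e. f x e + g x e)"
proof -
  obtain a b where ab: "\<And>x e. f x e \<le> (input_size n x e + 2) ^ a"
      "\<And>x e. g x e \<le> (input_size n x e + 2) ^ b"
    using assms unfolding poly_bounded_def by blast
  have "f x e + g x e \<le> (input_size n x e + 2) ^ (a + b + 1)" for x e
  proof -
    let ?N = "input_size n x e + 2"
    have "f x e + g x e \<le> ?N ^ (a + b) + ?N ^ (a + b)"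
      using ab[of x e] power_increasing[of a "a + b" ?N] power_increasing[of b "a + b" ?N]
      by linarith
    also have "\<dots> \<le> ?N * ?N ^ (a + b)"
      by simp
    finally show ?thesis
      by simp
  qed
  then show ?thesis
    unfolding poly_bounded_def by blast
qed

lemma poly_bounded_mult:
  assumes "poly_bounded n f" and "poly_bounded n g"
  shows "poly_bounded n (\<lambda>x e. f x e * g x e)"
proof -
  obtain a b where "\<And>x e. f x e \<le> (input_size n x e + 2) ^ a"
      "\<And>x e. g x e \<le> (input_size n x e + 2) ^ b"
    using assms unfolding poly_bounded_def by blast
  then have "f x e * g x e \<le> (input_size n x e + 2) ^ (a + b)" for x e
    by (simp add: power_add mult_le_mono)
  then show ?thesis
    unfolding poly_bounded_def by blast
qed

lemma poly_bounded_power: "poly_bounded n f \<Longrightarrow> poly_bounded n (\<lambda>x e. f x e ^ k)"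
  by (induction k) (simp_all add: poly_bounded_const[of n "Suc 0"] poly_bounded_mult)

lemma poly_bounded_subst:
  assumes "poly_bounded m g" and "poly_bounded n h"
    and "\<And>x e. input_size m x (s x e) \<le> h x e"
  shows "poly_bounded n (\<lambda>x e. g x (s x e))"
proof -
  obtain a where a: "\<And>x e. g x e \<le> (input_size m x e + 2) ^ a"
    using assms(1) unfolding poly_bounded_def by blast
  have "poly_bounded n (\<lambda>x e. (h x e + 2) ^ a)"
    by (intro poly_bounded_power poly_bounded_add poly_bounded_const assms)
  moreover have "g x (s x e) \<le> (h x e + 2) ^ a" for x e
    using a[of x "s x e"] power_mono[of "input_size m x (s x e) + 2" "h x e + 2" a] assms(3)[of x e]
    by linarith
  ultimately show ?thesis
    by (rule poly_bounded_mono)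
qed

lemmas poly_bounded_intros = poly_bounded_const poly_bounded_length poly_bounded_var
  poly_bounded_input_size poly_bounded_add poly_bounded_mult poly_bounded_power

lemma input_size_case_nat [simp]:
  "input_size (Suc n) x (case_nat v e) = v + input_size n x e"
  unfolding input_size_def by (subst sum.lessThan_Suc_shift) simp

text \<open>The values of the variables are found in the counters \<open>\<rho> 0, \<dots>, \<rho> (n - 1)\<close>, the result is put
  into the counter \<open>d\<close>, and the tapes beyond \<open>d\<close> are scratch space.\<close>

definition implements ::
  "com \<Rightarrow> nat \<Rightarrow> (nat \<Rightarrow> nat) \<Rightarrow> nat \<Rightarrow> (bool list \<Rightarrow> (nat \<Rightarrow> nat) \<Rightarrow> nat) \<Rightarrow>
    (bool list \<Rightarrow> (nat \<Rightarrow> nat) \<Rightarrow> nat) \<Rightarrow> bool" where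
  "implements c n \<rho> d f b \<longleftrightarrow> symbols_of c \<subseteq> {0, 1, 2} \<and>
     (\<forall>x e \<tau>. \<tau> 0 = word_tape x \<longrightarrow> (\<forall>i<n. \<tau> (\<rho> i) = counter (e i)) \<longrightarrow>
        (\<forall>r \<in> insert d (tapes_of c). d \<le> r \<longrightarrow> \<tau> r = counter 0) \<longrightarrow>
        runs c \<tau> (\<tau>(d := counter (f x e))) (b x e))"

lemma implementsD:
  assumes "implements c n \<rho> d f b" and "\<tau> 0 = word_tape x" and "\<And>i. i < n \<Longrightarrow> \<tau> (\<rho> i) = counter (e i)"
    and "\<And>r. r \<in> insert d (tapes_of c) \<Longrightarrow> d \<le> r \<Longrightarrow> \<tau> r = counter 0"
  shows "runs c \<tau> (\<tau>(d := counter (f x e))) (b x e)"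
  using assms unfolding implements_def by blast

text \<open>One time bound serves for all placements \<open>\<rho>\<close> and targets
  \<open>d\<close>, so a subroutine can be put above the tapes that its caller occupies. Tape 0 is
  reserved for the input.\<close>

definition realizable ::
  "nat \<Rightarrow> (bool list \<Rightarrow> (nat \<Rightarrow> nat) \<Rightarrow> nat) \<Rightarrow> (bool list \<Rightarrow> (nat \<Rightarrow> nat) \<Rightarrow> nat) \<Rightarrow> bool" where
  "realizable n f b \<longleftrightarrow>
     (\<forall>\<rho> d. 0 < d \<longrightarrow> (\<forall>i<n. 0 < \<rho> i \<and> \<rho> i < d) \<longrightarrow> (\<exists>c. implements c n \<rho> d f b))"

lemma realizableD:
  "realizable n f b \<Longrightarrow> 0 < d \<Longrightarrow> (\<And>i. i < n \<Longrightarrow> 0 < \<rho> i \<and> \<rho> i < d) \<Longrightarrow> \<exists>c. implements c n \<rho> d f b"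
  unfolding realizable_def by blast

text \<open>In \<open>computable n f\<close> the function \<open>f\<close> gets the input word and an environment, of which it
  only uses the first \<open>n\<close> variables. Binders push onto the environment, as for de Bruijn indices.\<close>

definition computable :: "nat \<Rightarrow> (bool list \<Rightarrow> (nat \<Rightarrow> nat) \<Rightarrow> nat) \<Rightarrow> bool" where
  "computable n f \<longleftrightarrow> poly_bounded n f \<and> (\<exists>b. poly_bounded n b \<and> realizable n f b)"

lemma computableI:
  assumes "poly_bounded n f" and "poly_bounded n b"
    and "\<And>\<rho> d. 0 < d \<Longrightarrow> (\<And>i. i < n \<Longrightarrow> 0 < \<rho> i \<and> \<rho> i < d) \<Longrightarrow> \<exists>c. implements c n \<rho> d f b"
  shows "computable n f"
  using assms unfolding computable_def realizable_def by blast

lemma computableD: "computable n f \<Longrightarrow> poly_bounded n f"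
  unfolding computable_def by blast

lemma computableE:
  assumes "computable n f"
  obtains b where "poly_bounded n b" and "realizable n f b"
  using assms unfolding computable_def by blast

lemma computable_var:
  assumes "i < n"
  shows "computable n (\<lambda>x e. e i)"
proof (rule computableI)
  show "poly_bounded n (\<lambda>x e. e i)" "poly_bounded n (\<lambda>x e. 10 * e i + 3)"
    by (intro poly_bounded_intros assms)+
  fix \<rho> :: "nat \<Rightarrow> nat" and d :: nat
  assume "0 < d" and \<rho>: "\<And>i. i < n \<Longrightarrow> 0 < \<rho> i \<and> \<rho> i < d"
  have "implements (copy (\<rho> i) d (Suc d)) n \<rho> d (\<lambda>x e. e i) (\<lambda>x e. 10 * e i + 3)"
    unfolding implements_def
  proof (intro conjI allI impI)
    fix x e and \<tau> :: "nat \<Rightarrow> tape"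
    assume \<tau>: "\<forall>i<n. \<tau> (\<rho> i) = counter (e i)"
      "\<forall>r\<in>insert d (tapes_of (copy (\<rho> i) d (Suc d))). d \<le> r \<longrightarrow> \<tau> r = counter 0"
    show "runs (copy (\<rho> i) d (Suc d)) \<tau> (\<tau>(d := counter (e i))) (10 * e i + 3)"
      using \<tau> \<rho>[OF assms] assms by (intro runs_copy) auto
  qed simp
  then show "\<exists>c. implements c n \<rho> d (\<lambda>x e. e i) (\<lambda>x e. 10 * e i + 3)"
    by blast
qed

lemma computable_zero: "computable n (\<lambda>x e. 0)"
proof (rule computableI)
  show "poly_bounded n (\<lambda>x e. 0)" "poly_bounded n (\<lambda>x e. 1)"
    by (intro poly_bounded_intros)+
  fix \<rho> :: "nat \<Rightarrow> nat" and d :: nat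
  \<comment> \<open>The target counter is already 0; \<open>clear\<close> merely supplies a command
    that changes nothing.\<close>
  have "implements (clear d) n \<rho> d (\<lambda>x e. 0) (\<lambda>x e. 1)"
    unfolding implements_def
  proof (intro conjI allI impI)
    fix \<tau> :: "nat \<Rightarrow> tape"
    assume "\<forall>r\<in>insert d (tapes_of (clear d)). d \<le> r \<longrightarrow> \<tau> r = counter 0"
    then have "\<tau> d = counter 0"
      by auto
    from runs_clear[of \<tau> d 0, OF this] show "runs (clear d) \<tau> (\<tau>(d := counter 0)) 1"
      by simp
  qed simp
  then show "\<exists>c. implements c n \<rho> d (\<lambda>x e. 0) (\<lambda>x e. 1)"
    by blast
qed

lemma computable_Suc:
  assumes "computable n f"
  shows "computable n (\<lambda>x e. Suc (f x e))"
proof -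
  obtain b where b: "poly_bounded n b" "realizable n f b"
    using computableE[OF assms] by blast
  show ?thesis
  proof (rule computableI)
    have "poly_bounded n (\<lambda>x e. f x e + 1)"
      by (intro poly_bounded_intros computableD[OF assms])
    then show "poly_bounded n (\<lambda>x e. Suc (f x e))"
      by simp
    show "poly_bounded n (\<lambda>x e. b x e + 1 + 1)"
      by (intro poly_bounded_intros b)
    fix \<rho> :: "nat \<Rightarrow> nat" and d :: nat
    assume d: "0 < d" "\<And>i. i < n \<Longrightarrow> 0 < \<rho> i \<and> \<rho> i < d"
    obtain c where c: "implements c n \<rho> d f b"
      using realizableD[OF b(2), of d \<rho>] d by blast
    have "implements (Seq c (inc d)) n \<rho> d (\<lambda>x e. Suc (f x e)) (\<lambda>x e. b x e + 1 + 1)"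
      unfolding implements_def
    proof (intro conjI allI impI)
      show "symbols_of (Seq c (inc d)) \<subseteq> {0, 1, 2}"
        using c by (simp add: implements_def)
      fix x e and \<tau> :: "nat \<Rightarrow> tape"
      assume \<tau>: "\<tau> 0 = word_tape x" "\<forall>i<n. \<tau> (\<rho> i) = counter (e i)"
        "\<forall>r\<in>insert d (tapes_of (Seq c (inc d))). d \<le> r \<longrightarrow> \<tau> r = counter 0"
      have "runs c \<tau> (\<tau>(d := counter (f x e))) (b x e)"
        by (rule implementsD[OF c]) (use \<tau> in auto)
      moreover have "runs (inc d) (\<tau>(d := counter (f x e))) (\<tau>(d := counter (Suc (f x e)))) 1"
        using runs_inc[of "\<tau>(d := counter (f x e))" d] by simp
      ultimately show "runs (Seq c (inc d)) \<tau> (\<tau>(d := counter (Suc (f x e)))) (b x e + 1 + 1)"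
        by (rule runs_Seq)
    qed
    then show "\<exists>c. implements c n \<rho> d (\<lambda>x e. Suc (f x e)) (\<lambda>x e. b x e + 1 + 1)"
      by blast
  qed
qed

text \<open>The same command works, with variables placed by \<open>\<rho> \<circ> \<pi>\<close>.
  Each of the \<open>m\<close> renamed values occurs among the \<open>n\<close> given ones, whence
  the factor \<open>m + 1\<close> in the size.\<close>

lemma computable_rename:
  assumes "computable m f" and "\<And>i. i < m \<Longrightarrow> \<pi> i < n"
  shows "computable n (\<lambda>x e. f x (\<lambda>i. e (\<pi> i)))"
proof -
  obtain b where b: "poly_bounded m b" "realizable m f b"
    using computableE[OF assms(1)] by blast
  have size: "input_size m x (\<lambda>i. e (\<pi> i)) \<le> (m + 1) * input_size n x e" for x e
  proof -
    have "(\<Sum>i<m. e (\<pi> i)) \<le> (\<Sum>i<m. \<Sum>i<n. e i)"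
      using assms(2) by (intro sum_mono member_le_sum) auto
    then show ?thesis
      by (simp add: input_size_def distrib_left)
  qed
  have sub: "poly_bounded n (\<lambda>x e. g x (\<lambda>i. e (\<pi> i)))" if "poly_bounded m g" for g
    using that by (rule poly_bounded_subst[OF _ _ size]) (intro poly_bounded_intros)
  show ?thesis
  proof (rule computableI)
    show "poly_bounded n (\<lambda>x e. f x (\<lambda>i. e (\<pi> i)))" "poly_bounded n (\<lambda>x e. b x (\<lambda>i. e (\<pi> i)))"
      by (intro sub computableD[OF assms(1)] b)+
    fix \<rho> :: "nat \<Rightarrow> nat" and d :: nat
    assume d: "0 < d" "\<And>i. i < n \<Longrightarrow> 0 < \<rho> i \<and> \<rho> i < d"
    obtain c where "implements c m (\<lambda>i. \<rho> (\<pi> i)) d f b"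
      using realizableD[OF b(2), of d "\<lambda>i. \<rho> (\<pi> i)"] d assms(2) by blast
    then have "implements c n \<rho> d (\<lambda>x e. f x (\<lambda>i. e (\<pi> i))) (\<lambda>x e. b x (\<lambda>i. e (\<pi> i)))"
      using assms(2) unfolding implements_def by simp
    then show "\<exists>c. implements c n \<rho> d (\<lambda>x e. f x (\<lambda>i. e (\<pi> i))) (\<lambda>x e. b x (\<lambda>i. e (\<pi> i)))"
      by blast
  qed
qed

text \<open>The value of \<open>f\<close> stays in counter \<open>d\<close>, which acts as variable
  0 while \<open>g\<close> is computed into \<open>Suc d\<close>; afterwards \<open>d\<close> is
  overwritten by the result.\<close>

lemma computable_let:
  assumes f: "computable n f" and g: "computable (Suc n) (\<lambda>x e. g x (\<lambda>i. e (Suc i)) (e 0))"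
  shows "computable n (\<lambda>x e. g x e (f x e))"
proof -
  let ?g = "\<lambda>x e. g x (\<lambda>i. e (Suc i)) (e 0)"
  obtain b where b: "poly_bounded n b" "realizable n f b"
    using computableE[OF f] by blast
  obtain b' where b': "poly_bounded (Suc n) b'" "realizable (Suc n) ?g b'"
    using computableE[OF g] by blast
  have sub: "poly_bounded n (\<lambda>x e. h x (case_nat (f x e) e))" if "poly_bounded (Suc n) h" for h
    using that
    by (rule poly_bounded_subst[where h = "\<lambda>x e. f x e + input_size n x e"])
      (intro poly_bounded_intros computableD[OF f] | simp)+
  have bg: "poly_bounded n (\<lambda>x e. g x e (f x e))"
    using sub[OF computableD[OF g]] by simp
  let ?b = "\<lambda>x e. b x e + (b' x (case_nat (f x e) e) +
      ((2 * f x e + 1) + (4 * g x e (f x e) + 1) + 1) + 1) + 1"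
  show ?thesis
  proof (rule computableI[OF bg])
    show "poly_bounded n ?b"
      by (intro poly_bounded_intros computableD[OF f] b(1) bg sub b'(1))
    fix \<rho> :: "nat \<Rightarrow> nat" and d :: nat
    assume d: "0 < d" "\<And>i. i < n \<Longrightarrow> 0 < \<rho> i \<and> \<rho> i < d"
    obtain c where c: "implements c n \<rho> d f b"
      using realizableD[OF b(2), of d \<rho>] d by blast
    have "0 < case_nat d \<rho> i \<and> case_nat d \<rho> i < Suc d" if "i < Suc n" for i
      using that d by (auto split: nat.split intro: less_SucI)
    then obtain c' where c': "implements c' (Suc n) (case_nat d \<rho>) (Suc d) ?g b'"
      using realizableD[OF b'(2), of "Suc d" "case_nat d \<rho>"] by blast
    let ?c = "Seq c (Seq c' (Seq (clear d) (transfer (Suc d) d)))"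
    have "implements ?c n \<rho> d (\<lambda>x e. g x e (f x e)) ?b"
      unfolding implements_def
    proof (intro conjI allI impI)
      show "symbols_of ?c \<subseteq> {0, 1, 2}"
        using c c' by (simp add: implements_def)
      fix x e and \<tau> :: "nat \<Rightarrow> tape"
      assume \<tau>: "\<tau> 0 = word_tape x" "\<forall>i<n. \<tau> (\<rho> i) = counter (e i)"
        "\<forall>r\<in>insert d (tapes_of ?c). d \<le> r \<longrightarrow> \<tau> r = counter 0"
      let ?v = "f x e" and ?w = "g x e (f x e)"
      let ?\<tau>1 = "\<tau>(d := counter ?v)"
      let ?\<tau>2 = "?\<tau>1(Suc d := counter ?w)"
      let ?\<tau>3 = "?\<tau>2(d := counter 0)"
      have 1: "runs c \<tau> ?\<tau>1 (b x e)"
        by (rule implementsD[OF c]) (use \<tau> in auto)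
      have 2: "runs c' ?\<tau>1 (?\<tau>1(Suc d := counter (?g x (case_nat ?v e)))) (b' x (case_nat ?v e))"
      proof (rule implementsD[OF c'])
        show "?\<tau>1 0 = word_tape x"
          using \<tau>(1) d(1) by simp
        show "?\<tau>1 (case_nat d \<rho> i) = counter (case_nat ?v e i)" if "i < Suc n" for i
          using that \<tau>(2) d(2) by (cases i) (auto dest: less_imp_neq)
        show "?\<tau>1 r = counter 0" if "r \<in> insert (Suc d) (tapes_of c')" "Suc d \<le> r" for r
          using that \<tau>(3) by auto
      qed
      have 3: "runs (clear d) ?\<tau>2 ?\<tau>3 (2 * ?v + 1)"
        by (rule runs_clear) simp
      have 4: "runs (transfer (Suc d) d) ?\<tau>3 (?\<tau>3(Suc d := counter 0, d := counter (0 + ?w)))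
          (4 * ?w + 1)"
        by (rule runs_transfer) simp_all
      have 5: "?\<tau>3(Suc d := counter 0, d := counter (0 + ?w)) = \<tau>(d := counter ?w)"
        using \<tau>(3) by auto
      show "runs ?c \<tau> (\<tau>(d := counter ?w)) (?b x e)"
        using runs_Seq[OF 1 runs_Seq[OF 2[simplified] runs_Seq[OF 3 4[unfolded 5]]]] by simp
    qed
    then show "\<exists>c. implements c n \<rho> d (\<lambda>x e. g x e (f x e)) ?b"
      by blast
  qed
qed

text \<open>Iterating a polynomially bounded step may grow exponentially, so all intermediate values
  need a common bound \<open>B\<close>. Counter \<open>d\<close> counts the remaining rounds,
  \<open>d + 1\<close> holds the index, \<open>d + 2\<close> the accumulator and
  \<open>d + 3\<close> its next value.\<close>

lemma computable_rec:
  assumes F: "computable n F" and G: "computable n G"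
    and H: "computable (Suc (Suc n)) (\<lambda>x e. H x (\<lambda>i. e (Suc (Suc i))) (e 0) (e 1))"
    and B: "poly_bounded n B"
    and bound: "\<And>x e i. i \<le> F x e \<Longrightarrow> rec_nat (G x e) (H x e) i \<le> B x e"
  shows "computable n (\<lambda>x e. rec_nat (G x e) (H x e) (F x e))"
proof -
  let ?H = "\<lambda>x e. H x (\<lambda>i. e (Suc (Suc i))) (e 0) (e 1)"
  let ?R = "\<lambda>x e. rec_nat (G x e) (H x e)"
  obtain bF where bF: "poly_bounded n bF" "realizable n F bF"
    using computableE[OF F] by blast
  obtain bG where bG: "poly_bounded n bG" "realizable n G bG"
    using computableE[OF G] by blast
  obtain bH where bH: "poly_bounded (Suc (Suc n)) bH" "realizable (Suc (Suc n)) ?H bH"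
    using computableE[OF H] by blast
  obtain a where a: "\<And>x e. bH x e \<le> (input_size (Suc (Suc n)) x e + 2) ^ a"
    using bH(1) unfolding poly_bounded_def by blast
  \<comment> \<open>A bound on the time of \<open>cH\<close> that is valid in every round: the index
    is at most \<open>F x e\<close> and the accumulator at most \<open>B x e\<close>.\<close>
  let ?h = "\<lambda>x e. (F x e + (B x e + input_size n x e) + 2) ^ a"
  let ?body = "\<lambda>x e. ?h x e + ((2 * B x e + 1) + ((4 * B x e + 1) + (1 + 1 + 1) + 1) + 1) + 1"
  let ?b = "\<lambda>x e. bF x e + (bG x e + ((F x e * (?body x e + 1) + 1) +
      ((2 * F x e + 1) + (4 * B x e + 1) + 1) + 1) + 1) + 1"
  have bR: "poly_bounded n (\<lambda>x e. ?R x e (F x e))"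
    by (rule poly_bounded_mono[OF B]) (simp add: bound)
  show ?thesis
  proof (rule computableI[OF bR])
    show "poly_bounded n ?b"
      by (intro poly_bounded_intros computableD[OF F] bF(1) bG(1) B)
    fix \<rho> :: "nat \<Rightarrow> nat" and d :: nat
    assume d: "0 < d" "\<And>i. i < n \<Longrightarrow> 0 < \<rho> i \<and> \<rho> i < d"
    have d2: "0 < \<rho> i \<and> \<rho> i < d + 2" if "i < n" for i
      using d(2)[OF that] by simp
    obtain cF where cF: "implements cF n \<rho> d F bF"
      using realizableD[OF bF(2), of d \<rho>] d by blast
    obtain cG where cG: "implements cG n \<rho> (d + 2) G bG"
      using realizableD[OF bG(2), of "d + 2" \<rho>] d2 by auto
    let ?\<rho> = "case_nat (d + 1) (case_nat (d + 2) \<rho>)"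
    have "0 < ?\<rho> i \<and> ?\<rho> i < d + 3" if "i < Suc (Suc n)" for i
      using that d by (auto split: nat.split dest!: d(2))
    then obtain cH where cH: "implements cH (Suc (Suc n)) ?\<rho> (d + 3) ?H bH"
      using realizableD[OF bH(2), of "d + 3" ?\<rho>] by auto
    let ?c = "Seq cH (Seq (clear (d + 2)) (Seq (transfer (d + 3) (d + 2)) (Seq (inc (d + 1)) (dec d))))"
    let ?p = "Seq cF (Seq cG (Seq (Loop d 1 ?c) (Seq (clear (d + 1)) (transfer (d + 2) d))))"
    have "implements ?p n \<rho> d (\<lambda>x e. ?R x e (F x e)) ?b"
      unfolding implements_def
    proof (intro conjI allI impI)
      show "symbols_of ?p \<subseteq> {0, 1, 2}"
        using cF cG cH by (simp add: implements_def)
      fix x e and \<tau> :: "nat \<Rightarrow> tape"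
      assume \<tau>: "\<tau> 0 = word_tape x" "\<forall>i<n. \<tau> (\<rho> i) = counter (e i)"
        "\<forall>r\<in>insert d (tapes_of ?p). d \<le> r \<longrightarrow> \<tau> r = counter 0"
      let ?v = "F x e" and ?r = "?R x e"
      let ?\<sigma> = "\<lambda>i. \<tau>(d := counter (?v - i), d + 1 := counter i, d + 2 := counter (?r i))"
      have \<rho>d: "\<rho> i \<noteq> d" "\<rho> i \<noteq> Suc d" "\<rho> i \<noteq> Suc (Suc d)" if "i < n" for i
        using d(2)[OF that] by auto
      have zero: "\<tau> d = counter 0" "\<tau> (d + 1) = counter 0" "\<tau> (d + 2) = counter 0"
          "\<tau> (d + 3) = counter 0"
        using \<tau>(3) by auto
      have 1: "runs cF \<tau> (\<tau>(d := counter ?v)) (bF x e)"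
        by (rule implementsD[OF cF]) (use \<tau> in auto)
      have 2: "runs cG (\<tau>(d := counter ?v)) ((\<tau>(d := counter ?v))(d + 2 := counter (G x e))) (bG x e)"
        by (rule implementsD[OF cG]) (use \<tau> d(1) \<rho>d in auto)
      have start: "(\<tau>(d := counter ?v))(d + 2 := counter (G x e)) = ?\<sigma> 0"
        using zero by (auto simp: fun_eq_iff)
      have body: "runs ?c (?\<sigma> i) (?\<sigma> (Suc i)) (?body x e)" if i: "i < ?v" for i
      proof -
        let ?e = "case_nat i (case_nat (?r i) e)"
        let ?s = "?\<sigma> i"
        let ?s1 = "?s(d + 3 := counter (?r (Suc i)))"
        let ?s2 = "?s1(d + 2 := counter 0)"
        let ?s3 = "?s2(d + 3 := counter 0, d + 2 := counter (0 + ?r (Suc i)))"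
        let ?s4 = "?s3(d + 1 := counter (Suc i))"
        let ?s5 = "?s4(d := counter (?v - Suc i))"
        have r: "?r i \<le> B x e" "?r (Suc i) \<le> B x e"
          using bound[of i x e] bound[of "Suc i" x e] i by simp_all
        have "runs cH ?s (?s(d + 3 := counter (?H x ?e))) (bH x ?e)"
        proof (rule implementsD[OF cH])
          show "?s 0 = word_tape x"
            using \<tau>(1) d(1) by simp
          show "?s (?\<rho> k) = counter (?e k)" if "k < Suc (Suc n)" for k
            using that \<tau>(2) \<rho>d by (auto split: nat.split)
          show "?s k = counter 0" if "k \<in> insert (d + 3) (tapes_of cH)" "d + 3 \<le> k" for k
            using that \<tau>(3) by auto
        qed
        moreover have "bH x ?e \<le> ?h x e"
        proof -
          have "bH x ?e \<le> (i + (?r i + input_size n x e) + 2) ^ a"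
            using a[of x ?e] by simp
          also have "\<dots> \<le> ?h x e"
            using i r(1) by (intro power_mono) auto
          finally show ?thesis .
        qed
        ultimately have b1: "runs cH ?s ?s1 (?h x e)"
          using runs_mono by simp
        have b2: "runs (clear (d + 2)) ?s1 ?s2 (2 * B x e + 1)"
          by (rule runs_mono[OF runs_clear[where v = "?r i"]]) (use r in auto)
        have b3: "runs (transfer (d + 3) (d + 2)) ?s2 ?s3 (4 * B x e + 1)"
          by (rule runs_mono[OF runs_transfer[where v = "?r (Suc i)"]]) (use r in auto)
        have b4: "runs (inc (d + 1)) ?s3 ?s4 1"
          by (rule runs_inc) auto
        have b5: "runs (dec d) ?s4 ?s5 1"
          using i by (intro runs_dec) (auto simp: Suc_diff_Suc)
        have "?s5 = ?\<sigma> (Suc i)"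
          using zero by (auto simp: fun_eq_iff)
        then show ?thesis
          using runs_Seq[OF b1 runs_Seq[OF b2 runs_Seq[OF b3 runs_Seq[OF b4 b5]]]] by simp
      qed
      have 3: "runs (Loop d 1 ?c) (?\<sigma> 0) (?\<sigma> ?v) (?v * (?body x e + 1) + 1)"
      proof (rule runs_Loop[where \<sigma> = ?\<sigma>])
        show "runs ?c (?\<sigma> i) (?\<sigma> (Suc i)) (?body x e)" if "i < ?v" for i
          using body[OF that] .
      qed auto
      have 4: "runs (clear (d + 1)) (?\<sigma> ?v) ((?\<sigma> ?v)(d + 1 := counter 0)) (2 * ?v + 1)"
        by (rule runs_clear) auto
      have 5: "runs (transfer (d + 2) d) ((?\<sigma> ?v)(d + 1 := counter 0))
          ((?\<sigma> ?v)(d + 1 := counter 0, d + 2 := counter 0, d := counter (0 + ?r ?v))) (4 * B x e + 1)"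
        by (rule runs_mono[OF runs_transfer[where v = "?r ?v"]]) (use bound in auto)
      have 6: "(?\<sigma> ?v)(d + 1 := counter 0, d + 2 := counter 0, d := counter (0 + ?r ?v)) =
          \<tau>(d := counter (?r ?v))"
        using zero by (auto simp: fun_eq_iff)
      show "runs ?p \<tau> (\<tau>(d := counter (?r ?v))) (?b x e)"
        using runs_Seq[OF 1 runs_Seq[OF 2[unfolded start] runs_Seq[OF 3 runs_Seq[OF 4 5[unfolded 6]]]]] .
    qed
    then show "\<exists>c. implements c n \<rho> d (\<lambda>x e. ?R x e (F x e)) ?b"
      by blast
  qed
qed

subsection \<open>Access to the input\<close>

definition bit_at :: "bool list \<Rightarrow> nat \<Rightarrow> bool" where
  "bit_at x i \<longleftrightarrow> i < length x \<and> x ! i"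

definition scan_tape :: "bool list \<Rightarrow> nat \<Rightarrow> tape" where
  "scan_tape x k = (fst (word_tape x), int k)"

lemma word_tape_eq_scan_tape: "word_tape x = scan_tape x 0"
  by (simp add: scan_tape_def word_tape_def)

lemma read_scan_tape: "read (scan_tape x k) = (if k < length x then bit_symbol (x ! k) else 0)"
  by (simp add: scan_tape_def word_tape_def)

lemma bit_symbol_eq: "bit_symbol b = (if b then 2 else 1)"
  by (cases b) simp_all

lemma runs_scan_right:
  "\<tau> 0 = scan_tape x k \<Longrightarrow> runs (Move 0 MoveRight) \<tau> (\<tau>(0 := scan_tape x (Suc k))) 1"
  by (rule runs_Move) (auto simp: scan_tape_def fun_eq_iff)

lemma runs_scan_left:
  "\<tau> 0 = scan_tape x (Suc k) \<Longrightarrow> runs (Move 0 MoveLeft) \<tau> (\<tau>(0 := scan_tape x k)) 1"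
  by (rule runs_Move) (auto simp: scan_tape_def fun_eq_iff)

text \<open>The head may have run past the word into the blanks, so the way home is not found by
  looking at symbols but by a counter that recorded the distance.\<close>

lemma runs_scan_back:
  assumes "\<tau> 0 = scan_tape x v" and "\<tau> j = counter v" and "0 < j"
  shows "runs (Loop j 1 (Seq (dec j) (Move 0 MoveLeft))) \<tau> (\<tau>(0 := word_tape x, j := counter 0))
    (4 * v + 1)"
proof -
  let ?\<sigma> = "\<lambda>i. \<tau>(0 := scan_tape x (v - i), j := counter (v - i))"
  have "runs (Seq (dec j) (Move 0 MoveLeft)) (?\<sigma> i) (?\<sigma> (Suc i)) 3" if "i < v" for i
  proof -
    let ?\<sigma>1 = "(?\<sigma> i)(j := counter (v - Suc i))"
    have "runs (dec j) (?\<sigma> i) ?\<sigma>1 1"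
      using that by (intro runs_dec) (auto simp: Suc_diff_Suc)
    moreover have "runs (Move 0 MoveLeft) ?\<sigma>1 (?\<sigma>1(0 := scan_tape x (v - Suc i))) 1"
      using that assms(3) by (intro runs_scan_left) (auto simp: Suc_diff_Suc)
    moreover have "?\<sigma>1(0 := scan_tape x (v - Suc i)) = ?\<sigma> (Suc i)"
      using assms(3) by (auto simp: fun_eq_iff)
    ultimately have "runs (Seq (dec j) (Move 0 MoveLeft)) (?\<sigma> i) (?\<sigma> (Suc i)) (1 + 1 + 1)"
      by (metis runs_Seq)
    then show ?thesis
      by (rule runs_mono) simp
  qed
  then have "runs (Loop j 1 (Seq (dec j) (Move 0 MoveLeft))) \<tau>
      (\<tau>(0 := word_tape x, j := counter 0)) (v * (3 + 1) + 1)"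
    by (intro runs_Loop[where \<sigma> = ?\<sigma>])
      (use assms in \<open>auto simp: fun_eq_iff word_tape_eq_scan_tape\<close>)
  then show ?thesis
    by (rule runs_mono) simp
qed

lemma computable_length: "computable n (\<lambda>x e. length x)"
proof (rule computableI)
  let ?b = "\<lambda>x e. (length x * (5 + 1) + 1) + (4 * length x + 1) + 1"
  show "poly_bounded n (\<lambda>x e. length x)" "poly_bounded n ?b"
    by (intro poly_bounded_intros)+
  fix \<rho> :: "nat \<Rightarrow> nat" and d :: nat
  assume d: "0 < d"
  let ?c = "Seq (Move 0 MoveRight) (Seq (inc d) (inc (d + 1)))"
  let ?p = "Seq (Loop 0 0 ?c) (Loop (d + 1) 1 (Seq (dec (d + 1)) (Move 0 MoveLeft)))"
  have "implements ?p n \<rho> d (\<lambda>x e. length x) ?b"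
    unfolding implements_def
  proof (intro conjI allI impI)
    fix x and \<tau> :: "nat \<Rightarrow> tape"
    assume \<tau>: "\<tau> 0 = word_tape x" "\<forall>r\<in>insert d (tapes_of ?p). d \<le> r \<longrightarrow> \<tau> r = counter 0"
    then have zero: "\<tau> d = counter 0" "\<tau> (Suc d) = counter 0"
      by auto
    let ?v = "length x"
    let ?\<sigma> = "\<lambda>i. \<tau>(0 := scan_tape x i, d := counter i, d + 1 := counter i)"
    have "runs ?c (?\<sigma> i) (?\<sigma> (Suc i)) 5" for i
    proof -
      let ?\<sigma>1 = "(?\<sigma> i)(0 := scan_tape x (Suc i))"
      let ?\<sigma>2 = "?\<sigma>1(d := counter (Suc i))"
      let ?\<sigma>3 = "?\<sigma>2(d + 1 := counter (Suc i))"
      have 1: "runs (Move 0 MoveRight) (?\<sigma> i) ?\<sigma>1 1"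
        using d by (intro runs_scan_right) auto
      have 2: "runs (inc d) ?\<sigma>1 ?\<sigma>2 1"
        using d by (intro runs_inc) auto
      have 3: "runs (inc (d + 1)) ?\<sigma>2 ?\<sigma>3 1"
        by (intro runs_inc) auto
      have "?\<sigma>3 = ?\<sigma> (Suc i)"
        using d by (auto simp: fun_eq_iff)
      then show ?thesis
        using runs_mono[OF runs_Seq[OF 1 runs_Seq[OF 2 3]], of 5] by simp
    qed
    then have 1: "runs (Loop 0 0 ?c) \<tau> (?\<sigma> ?v) (?v * (5 + 1) + 1)"
      by (intro runs_Loop[where \<sigma> = ?\<sigma>])
        (use \<tau> zero d in \<open>auto simp: fun_eq_iff word_tape_eq_scan_tape read_scan_tape bit_symbol_eq\<close>)
    have 2: "runs (Loop (d + 1) 1 (Seq (dec (d + 1)) (Move 0 MoveLeft))) (?\<sigma> ?v)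
        ((?\<sigma> ?v)(0 := word_tape x, d + 1 := counter 0)) (4 * ?v + 1)"
      using d by (intro runs_scan_back) auto
    have "(?\<sigma> ?v)(0 := word_tape x, d + 1 := counter 0) = \<tau>(d := counter ?v)"
      using \<tau>(1) zero d by (auto simp: fun_eq_iff)
    then show "runs ?p \<tau> (\<tau>(d := counter ?v)) ((length x * (5 + 1) + 1) + (4 * length x + 1) + 1)"
      using runs_Seq[OF 1 2] by simp
  qed simp
  then show "\<exists>c. implements c n \<rho> d (\<lambda>x e. length x) ?b"
    by blast
qed

lemma computable_bit_at:
  assumes "computable n f"
  shows "computable n (\<lambda>x e. of_bool (bit_at x (f x e)))"
proof -
  obtain b where b: "poly_bounded n b" "realizable n f b"
    using computableE[OF assms] by blast
  let ?b = "\<lambda>x e. b x e + ((f x e * (5 + 1) + 1) + ((1 + 1) + (4 * f x e + 1) + 1) + 1) + 1"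
  show ?thesis
  proof (rule computableI)
    show "poly_bounded n (\<lambda>x e. of_bool (bit_at x (f x e)))"
      by (rule poly_bounded_mono[OF poly_bounded_const[of n 1]]) simp
    show "poly_bounded n ?b"
      by (intro poly_bounded_intros b(1) computableD[OF assms])
    fix \<rho> :: "nat \<Rightarrow> nat" and d :: nat
    assume d: "0 < d" "\<And>i. i < n \<Longrightarrow> 0 < \<rho> i \<and> \<rho> i < d"
    obtain c where c: "implements c n \<rho> d f b"
      using realizableD[OF b(2), of d \<rho>] d by blast
    let ?c = "Seq (dec d) (Seq (Move 0 MoveRight) (inc (d + 1)))"
    \<comment> \<open>Counter \<open>d\<close> is 0 at this point, and \<open>Move d Stay\<close> is
      an idle command. A position beyond the word shows a blank and counts as False, as in
      \<open>bit_at\<close>.\<close>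
    let ?t = "Branch 0 2 (inc d) (Move d Stay)"
    let ?l = "Loop (d + 1) 1 (Seq (dec (d + 1)) (Move 0 MoveLeft))"
    let ?p = "Seq c (Seq (Loop d 1 ?c) (Seq ?t ?l))"
    have "implements ?p n \<rho> d (\<lambda>x e. of_bool (bit_at x (f x e))) ?b"
      unfolding implements_def
    proof (intro conjI allI impI)
      show "symbols_of ?p \<subseteq> {0, 1, 2}"
        using c by (simp add: implements_def)
      fix x e and \<tau> :: "nat \<Rightarrow> tape"
      assume \<tau>: "\<tau> 0 = word_tape x" "\<forall>i<n. \<tau> (\<rho> i) = counter (e i)"
        "\<forall>r\<in>insert d (tapes_of ?p). d \<le> r \<longrightarrow> \<tau> r = counter 0"
      then have zero: "\<tau> d = counter 0" "\<tau> (Suc d) = counter 0"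
        by auto
      let ?v = "f x e" and ?w = "of_bool (bit_at x (f x e))"
      have 1: "runs c \<tau> (\<tau>(d := counter ?v)) (b x e)"
        by (rule implementsD[OF c]) (use \<tau> in auto)
      let ?\<sigma> = "\<lambda>i. \<tau>(0 := scan_tape x i, d := counter (?v - i), d + 1 := counter i)"
      have "runs ?c (?\<sigma> i) (?\<sigma> (Suc i)) 5" if "i < ?v" for i
      proof -
        let ?\<sigma>1 = "(?\<sigma> i)(d := counter (?v - Suc i))"
        let ?\<sigma>2 = "?\<sigma>1(0 := scan_tape x (Suc i))"
        let ?\<sigma>3 = "?\<sigma>2(d + 1 := counter (Suc i))"
        have 1: "runs (dec d) (?\<sigma> i) ?\<sigma>1 1"
          using that by (intro runs_dec) (auto simp: Suc_diff_Suc)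
        have 2: "runs (Move 0 MoveRight) ?\<sigma>1 ?\<sigma>2 1"
          using d by (intro runs_scan_right) auto
        have 3: "runs (inc (d + 1)) ?\<sigma>2 ?\<sigma>3 1"
          by (intro runs_inc) auto
        have "?\<sigma>3 = ?\<sigma> (Suc i)"
          using d by (auto simp: fun_eq_iff)
        then show ?thesis
          using runs_mono[OF runs_Seq[OF 1 runs_Seq[OF 2 3]], of 5] by simp
      qed
      then have 2: "runs (Loop d 1 ?c) (\<tau>(d := counter ?v)) (?\<sigma> ?v) (?v * (5 + 1) + 1)"
        by (intro runs_Loop[where \<sigma> = ?\<sigma>])
          (use \<tau>(1) zero d in \<open>auto simp: fun_eq_iff word_tape_eq_scan_tape\<close>)
      let ?\<sigma>' = "(?\<sigma> ?v)(d := counter ?w)"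
      have 3: "runs ?t (?\<sigma> ?v) ?\<sigma>' (1 + 1)"
      proof (rule runs_Branch)
        assume "read ((?\<sigma> ?v) 0) = 2"
        then have "?w = Suc 0"
          using d by (auto simp: read_scan_tape bit_symbol_eq bit_at_def split: if_splits)
        then show "runs (inc d) (?\<sigma> ?v) ?\<sigma>' 1"
          using runs_inc[of "?\<sigma> ?v" d 0] by simp
      next
        assume "read ((?\<sigma> ?v) 0) \<noteq> 2"
        then have "?w = (0 :: nat)"
          using d by (auto simp: read_scan_tape bit_symbol_eq bit_at_def split: if_splits)
        then show "runs (Move d Stay) (?\<sigma> ?v) ?\<sigma>' 1"
          by (intro runs_Move) (auto simp: fun_eq_iff counter_def)
      qed
      have 4: "runs ?l ?\<sigma>' (?\<sigma>'(0 := word_tape x, d + 1 := counter 0)) (4 * ?v + 1)"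
        by (rule runs_scan_back) (use d in simp_all)
      have 5: "?\<sigma>'(0 := word_tape x, d + 1 := counter 0) = \<tau>(d := counter ?w)"
        using \<tau>(1) zero d by (auto simp: fun_eq_iff simp del: of_bool_eq_iff)
      show "runs ?p \<tau> (\<tau>(d := counter ?w)) (?b x e)"
        using runs_Seq[OF 1 runs_Seq[OF 2 runs_Seq[OF 3 4[unfolded 5]]]] .
    qed
    then show "\<exists>c. implements c n \<rho> d (\<lambda>x e. of_bool (bit_at x (f x e))) ?b"
      by blast
  qed
qed

subsection \<open>Producing the output\<close>

text \<open>Initially all tapes but the first are blank; a 1 in cell 0 turns them into counters with
  value 0.\<close>

fun mark_counters :: "nat \<Rightarrow> com" where
  "mark_counters 0 = Move 0 Stay"
| "mark_counters (Suc m) = Seq (mark_counters m) (Write (Suc m) 1)"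

lemma tapes_of_mark_counters: "tapes_of (mark_counters m) = {..m}"
  by (induction m) (simp_all add: atMost_Suc)

lemma symbols_of_mark_counters: "symbols_of (mark_counters m) \<subseteq> {1}"
  by (induction m) auto

lemma runs_mark_counters:
  assumes "\<And>j. 0 < j \<Longrightarrow> j \<le> m \<Longrightarrow> \<tau> j = blank_tape"
  shows "runs (mark_counters m) \<tau> (\<lambda>j. if 0 < j \<and> j \<le> m then counter 0 else \<tau> j) (2 * m + 1)"
  using assms
proof (induction m)
  case 0
  have "(\<lambda>j. if 0 < j \<and> j \<le> 0 then counter 0 else \<tau> j) = \<tau>(0 := act (read (\<tau> 0), Stay) (\<tau> 0))"
    by (auto simp: act_read_Stay)
  from runs_Move[OF this] show ?case
    by simp
next
  case (Suc m)
  let ?\<tau> = "\<lambda>m j. if 0 < j \<and> j \<le> m then counter 0 else \<tau> j"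
  have "runs (mark_counters m) \<tau> (?\<tau> m) (2 * m + 1)"
    using Suc by simp
  moreover have "runs (Write (Suc m) 1) (?\<tau> m) (?\<tau> (Suc m)) 1"
    using Suc.prems[of "Suc m"] by (intro runs_Write) (auto simp: fun_eq_iff blank_tape_def counter_def)
  ultimately show ?case
    using runs_Seq by fastforce
qed

definition output_tape :: "bool list \<Rightarrow> nat \<Rightarrow> tape" where
  "output_tape y i = ((\<lambda>z. if 0 \<le> z \<and> z < int i then bit_symbol (y ! nat z) else 0), int i)"

lemma holds_word_output_tape: "holds_word (output_tape y (length y)) y"
  by (simp add: holds_word_def output_tape_def)

lemma runs_output:
  assumes "\<tau> j = output_tape y i"
  shows "runs (Seq (Write j (bit_symbol (y ! i))) (Move j MoveRight)) \<tau>
    (\<tau>(j := output_tape y (Suc i))) 3"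
proof -
  let ?\<tau> = "\<tau>(j := ((fst (output_tape y i))(int i := bit_symbol (y ! i)), int i))"
  have "runs (Write j (bit_symbol (y ! i))) \<tau> ?\<tau> 1"
    using assms by (intro runs_Write) (simp add: output_tape_def)
  moreover have "runs (Move j MoveRight) ?\<tau> (\<tau>(j := output_tape y (Suc i))) 1"
    by (rule runs_Move) (auto simp: output_tape_def fun_eq_iff)
  ultimately have "runs (Seq (Write j (bit_symbol (y ! i))) (Move j MoveRight)) \<tau>
      (\<tau>(j := output_tape y (Suc i))) (1 + 1 + 1)"
    by (rule runs_Seq)
  then show ?thesis
    by (rule runs_mono) simp
qed

text \<open>The output is written bit by bit: counter 1 holds the number of bits still to come,
  counter 2 the index and counter 3 the current bit.\<close>

theorem polytime_computable_map:
  assumes len: "computable 0 (\<lambda>x e. l x)" and bit: "computable 1 (\<lambda>x e. of_bool (B x (e 0)))"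
  shows "polytime_computable (\<lambda>x. map (B x) [0..<l x])"
proof -
  obtain bl where bl: "poly_bounded 0 bl" "realizable 0 (\<lambda>x e. l x) bl"
    using computableE[OF len] by blast
  obtain bb where bb: "poly_bounded 1 bb" "realizable 1 (\<lambda>x e. of_bool (B x (e 0))) bb"
    using computableE[OF bit] by blast
  obtain a where a: "\<And>x e. bb x e \<le> (input_size 1 x e + 2) ^ a"
    using bb(1) unfolding poly_bounded_def by blast
  obtain cl where cl: "implements cl 0 id 1 (\<lambda>x e. l x) bl"
    using realizableD[OF bl(2), of 1 id] by auto
  obtain cb where cb: "implements cb 1 (\<lambda>_. 2) 3 (\<lambda>x e. of_bool (B x (e 0))) bb"
    using realizableD[OF bb(2), of 3 "\<lambda>_. 2"] by auto
  define m where "m = Max (insert 3 (tapes_of cl \<union> tapes_of cb))"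
  have m: "3 \<le> m" "\<And>j. j \<in> tapes_of cl \<union> tapes_of cb \<Longrightarrow> j \<le> m"
    by (simp_all add: m_def)
  \<comment> \<open>Tapes 1 to \<open>m\<close> become counters. The tape beyond them stays blank
    and is the last one of the machine, from which the output is read.\<close>
  define out where "out = Suc m"
  \<comment> \<open>A counter shows symbol 1 iff its value is 0, so the first branch is the one for
    the bit False.\<close>
  let ?w = "Branch 3 1 (Seq (Write out 1) (Move out MoveRight)) (Seq (Write out 2) (Move out MoveRight))"
  let ?c = "Seq cb (Seq ?w (Seq (clear 3) (Seq (inc 2) (dec 1))))"
  let ?p = "Seq (mark_counters m) (Seq cl (Loop 1 1 ?c))"
  have "tapes_of ?p \<subseteq> insert out {..m}"
    using m by (auto simp: tapes_of_mark_counters)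
  also have "\<dots> \<subseteq> {..<Suc out}"
    by (auto simp: out_def)
  finally have tapes: "tapes_of ?p \<subseteq> {..<Suc out}" .
  define M where "M = compile ?p (Suc out)"
  let ?e = "\<lambda>_. 0 :: nat"
  let ?h = "\<lambda>x. (l x + input_size 0 x ?e + 2) ^ a"
  let ?t = "\<lambda>x e. 2 * m + 1 + (bl x e + (l x * ((((l x + input_size 0 x e + 2) ^ a) +
      ((3 + 1) + (3 + (1 + 1 + 1) + 1) + 1) + 1) + 1) + 1) + 1) + 1"
  have "poly_bounded 0 ?t"
    by (intro poly_bounded_intros bl(1) computableD[OF len])
  then obtain A where A: "\<And>x e. ?t x e \<le> (input_size 0 x e + 2) ^ A"
    unfolding poly_bounded_def by blast
  \<comment> \<open>\<open>[:2, 1:] ^ A\<close> is the polynomial with value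
    \<open>(n + 2) ^ A\<close> at \<open>n\<close>.\<close>
  have "\<exists>t\<le>poly ([:2, 1:] ^ A) (length x). halts_with M x (map (B x) [0..<l x]) t" for x
  proof -
    let ?y = "map (B x) [0..<l x]"
    let ?start = "\<lambda>j. if j = (0 :: nat) then word_tape x else blank_tape"
    let ?\<tau> = "\<lambda>j. if 0 < j \<and> j \<le> m then counter 0 else ?start j"
    have out: "out \<noteq> 0" "out \<noteq> 1" "out \<noteq> 2" "out \<noteq> 3" "out > m"
      using m(1) by (auto simp: out_def)
    have 1: "runs (mark_counters m) ?start ?\<tau> (2 * m + 1)"
      by (rule runs_mark_counters) simp
    have 2: "runs cl ?\<tau> (?\<tau>(1 := counter (l x))) (bl x ?e)"
      by (rule implementsD[OF cl]) (use m in auto)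
    let ?\<sigma> = "\<lambda>i. ?\<tau>(1 := counter (l x - i), 2 := counter i, out := output_tape ?y i)"
    have start: "?\<tau>(1 := counter (l x)) = ?\<sigma> 0"
      using out m(1) by (auto simp: fun_eq_iff output_tape_def blank_tape_def)
    have body: "runs ?c (?\<sigma> i) (?\<sigma> (Suc i)) (?h x + ((3 + 1) + (3 + (1 + 1 + 1) + 1) + 1) + 1)"
      if i: "i < l x" for i
    proof -
      let ?\<sigma>1 = "(?\<sigma> i)(3 := counter (of_bool (B x i)))"
      let ?\<sigma>2 = "?\<sigma>1(out := output_tape ?y (Suc i))"
      let ?\<sigma>3 = "?\<sigma>2(3 := counter 0)"
      let ?\<sigma>4 = "?\<sigma>3(2 := counter (Suc i))"
      let ?\<sigma>5 = "?\<sigma>4(1 := counter (l x - Suc i))"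
      have "runs cb (?\<sigma> i) ((?\<sigma> i)(3 := counter (of_bool (B x ((\<lambda>_. i) 0))))) (bb x (\<lambda>_. i))"
      proof (rule implementsD[OF cb])
        show "?\<sigma> i r = counter 0" if "r \<in> insert 3 (tapes_of cb)" "3 \<le> r" for r
        proof -
          have "r \<le> m"
            using that m by auto
          with that out show ?thesis
            by auto
        qed
      qed (use out in auto)
      moreover have "bb x (\<lambda>_. i) \<le> ?h x"
      proof -
        have "bb x (\<lambda>_. i) \<le> (i + input_size 0 x ?e + 2) ^ a"
          using a[of x "\<lambda>_. i"] by (simp add: input_size_def add.commute)
        also have "\<dots> \<le> ?h x"
          using i by (intro power_mono) auto
        finally show ?thesis .
      qed
      ultimately have b1: "runs cb (?\<sigma> i) ?\<sigma>1 (?h x)"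
        using runs_mono by simp
      have wr: "runs (Seq (Write out (bit_symbol (?y ! i))) (Move out MoveRight)) ?\<sigma>1 ?\<sigma>2 3"
        using out by (intro runs_output) simp
      have b2: "runs ?w ?\<sigma>1 ?\<sigma>2 (3 + 1)"
        using wr i by (intro runs_Branch) (cases "B x i"; simp)+
      have b3: "runs (clear 3) ?\<sigma>2 ?\<sigma>3 3"
        using out by (intro runs_mono[OF runs_clear[where v = "of_bool (B x i)"]]) auto
      have b4: "runs (inc 2) ?\<sigma>3 ?\<sigma>4 1"
        using out by (intro runs_inc) auto
      have b5: "runs (dec 1) ?\<sigma>4 ?\<sigma>5 1"
        using out i by (intro runs_dec) (auto simp: Suc_diff_Suc)
      have "?\<sigma>5 = ?\<sigma> (Suc i)"
        using out m(1) by (auto simp: fun_eq_iff)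
      then show ?thesis
        using runs_Seq[OF b1 runs_Seq[OF b2 runs_Seq[OF b3 runs_Seq[OF b4 b5]]]] by simp
    qed
    have 3: "runs (Loop 1 1 ?c) (?\<sigma> 0) (?\<sigma> (l x))
        (l x * ((?h x + ((3 + 1) + (3 + (1 + 1 + 1) + 1) + 1) + 1) + 1) + 1)"
    proof (rule runs_Loop[where \<sigma> = ?\<sigma>])
      show "runs ?c (?\<sigma> i) (?\<sigma> (Suc i)) (?h x + ((3 + 1) + (3 + (1 + 1 + 1) + 1) + 1) + 1)"
        if "i < l x" for i
        using body[OF that] .
    qed (use out in auto)
    have "runs ?p ?start (?\<sigma> (l x)) (?t x ?e)"
      using runs_Seq[OF 1 runs_Seq[OF 2[unfolded start] 3]] .
    then obtain t where t: "t \<le> ?t x ?e"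
      "(step M ^^ t) (init M x) = (halt M, map (?\<sigma> (l x)) [0..<Suc out])"
      using compile_runs[of ?p x, OF _ _ tapes] unfolding M_def by blast
    have "last (map (?\<sigma> (l x)) [0..<Suc out]) = output_tape ?y (length ?y)"
      by simp
    then have "halts_with M x ?y t"
      unfolding halts_with_def t(2) using holds_word_output_tape[of ?y] by (simp del: upt_Suc)
    moreover have "t \<le> poly ([:2, 1:] ^ A) (length x)"
      using order_trans[OF t(1) A] by (simp add: input_size_def add.commute)
    ultimately show ?thesis
      by blast
  qed
  moreover have "wf_tm M"
    unfolding M_def
  proof (rule wf_compile)
    show "tapes_of ?p \<subseteq> {..<Suc out}"
      by (rule tapes)
    show "symbols_of ?p \<subseteq> {0, 1, 2}"
      using cl cb symbols_of_mark_counters[of m] by (auto simp: implements_def)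
  qed simp
  ultimately show ?thesis
    unfolding polytime_computable_def by blast
qed

subsection \<open>Closure properties\<close>

named_theorems computable_intros

declare computable_var [computable_intros] computable_zero [computable_intros]
  computable_Suc [computable_intros] computable_length [computable_intros]
  computable_bit_at [computable_intros]

lemma computable_cong: "computable n f \<Longrightarrow> (\<And>x e. g x e = f x e) \<Longrightarrow> computable n g"
  by presburger

lemma computable_const [computable_intros]: "computable n (\<lambda>x e. c)"
  by (induction c) (auto intro: computable_intros)

lemma computable_shift: "computable n f \<Longrightarrow> computable (Suc n) (\<lambda>x e. f x (\<lambda>i. e (Suc i)))"
  by (rule computable_rename) auto

lemma computable_shift2:
  "computable n f \<Longrightarrow> computable (Suc (Suc n)) (\<lambda>x e. f x (\<lambda>i. e (Suc (Suc i))))"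
  by (rule computable_rename) auto

lemma rec_nat_add: "rec_nat a (\<lambda>_ r. r + c) k = a + k * (c :: nat)"
  by (induction k) auto

lemma computable_add [computable_intros]:
  assumes "computable n f" and "computable n g"
  shows "computable n (\<lambda>x e. f x e + g x e)"
proof (rule computable_cong)
  show "computable n (\<lambda>x e. rec_nat (f x e) (\<lambda>i r. Suc r) (g x e))"
  proof (rule computable_rec[where H = "\<lambda>x e i r. Suc r"])
    show "poly_bounded n (\<lambda>x e. f x e + g x e)"
      by (intro poly_bounded_intros computableD assms)
    show "rec_nat (f x e) (\<lambda>i r. Suc r) i \<le> f x e + g x e" if "i \<le> g x e" for x e i
      using that rec_nat_add[of "f x e" 1 i] by simp
  qed (intro assms computable_intros; simp)+
  show "f x e + g x e = rec_nat (f x e) (\<lambda>i r. Suc r) (g x e)" for x e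
    using rec_nat_add[of "f x e" 1 "g x e"] by simp
qed

lemma computable_mult [computable_intros]:
  assumes "computable n f" and "computable n g"
  shows "computable n (\<lambda>x e. f x e * g x e)"
proof (rule computable_cong)
  show "computable n (\<lambda>x e. rec_nat 0 (\<lambda>i r. r + g x e) (f x e))"
  proof (rule computable_rec[where H = "\<lambda>x e i r. r + g x e"])
    show "poly_bounded n (\<lambda>x e. f x e * g x e)"
      by (intro poly_bounded_intros computableD assms)
    show "rec_nat 0 (\<lambda>i r. r + g x e) i \<le> f x e * g x e" if "i \<le> f x e" for x e i
      using that by (simp add: rec_nat_add)
  qed (intro assms computable_intros computable_shift2; simp)+
qed (simp add: rec_nat_add)

lemma rec_nat_pred: "rec_nat 0 (\<lambda>i _. i) k = k - (1 :: nat)"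
  by (cases k) auto

lemma rec_nat_diff: "rec_nat a (\<lambda>_ r. r - 1) k = a - (k :: nat)"
  by (induction k) auto

text \<open>Truncated subtraction iterates the predecessor, and the predecessor is the recursion
  that returns the index of its last round.\<close>

lemma computable_diff [computable_intros]:
  assumes "computable n f" and "computable n g"
  shows "computable n (\<lambda>x e. f x e - g x e)"
proof -
  have pred: "computable m (\<lambda>x e. h x e - 1)" if "computable m h" for m h
  proof (rule computable_cong)
    show "computable m (\<lambda>x e. rec_nat 0 (\<lambda>i r. i) (h x e))"
    proof (rule computable_rec[where H = "\<lambda>x e i r. i"])
      show "poly_bounded m h"
        by (rule computableD) fact
      show "rec_nat 0 (\<lambda>i r. i) i \<le> h x e" if "i \<le> h x e" for x e i
        using that by (simp add: rec_nat_pred)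
    qed (intro that computable_intros; simp)+
  qed (simp add: rec_nat_pred)
  show ?thesis
  proof (rule computable_cong)
    show "computable n (\<lambda>x e. rec_nat (f x e) (\<lambda>i r. r - 1) (g x e))"
    proof (rule computable_rec[where H = "\<lambda>x e i r. r - 1"])
      show "poly_bounded n f"
        by (rule computableD) fact
      show "rec_nat (f x e) (\<lambda>i r. r - 1) i \<le> f x e" for x e i
        using rec_nat_diff[of "f x e" i] by (simp only: diff_le_self)
    qed (intro assms pred computable_intros; simp)+
  qed (rule rec_nat_diff[symmetric])
qed

text \<open>Predicates are treated through their values 0 and 1: negation is a subtraction,
  conjunction a product.\<close>

lemma computable_not [computable_intros]:
  "computable n (\<lambda>x e. of_bool (P x e)) \<Longrightarrow> computable n (\<lambda>x e. of_bool (\<not> P x e))"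
  by (rule computable_cong[of n "\<lambda>x e. 1 - of_bool (P x e)"]) (auto intro!: computable_intros)

lemma computable_conj [computable_intros]:
  "computable n (\<lambda>x e. of_bool (P x e)) \<Longrightarrow> computable n (\<lambda>x e. of_bool (Q x e)) \<Longrightarrow>
    computable n (\<lambda>x e. of_bool (P x e \<and> Q x e))"
  by (rule computable_cong[of n "\<lambda>x e. of_bool (P x e) * of_bool (Q x e)"])
    (auto intro!: computable_intros)

lemma computable_disj [computable_intros]:
  "computable n (\<lambda>x e. of_bool (P x e)) \<Longrightarrow> computable n (\<lambda>x e. of_bool (Q x e)) \<Longrightarrow>
    computable n (\<lambda>x e. of_bool (P x e \<or> Q x e))"
  by (rule computable_cong[of n "\<lambda>x e. of_bool (\<not> (\<not> P x e \<and> \<not> Q x e))"],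
      intro computable_intros) auto

lemma computable_imp [computable_intros]:
  "computable n (\<lambda>x e. of_bool (P x e)) \<Longrightarrow> computable n (\<lambda>x e. of_bool (Q x e)) \<Longrightarrow>
    computable n (\<lambda>x e. of_bool (P x e \<longrightarrow> Q x e))"
  by (rule computable_cong[of n "\<lambda>x e. of_bool (\<not> P x e \<or> Q x e)"],
      intro computable_intros) auto

lemma computable_le [computable_intros]:
  "computable n f \<Longrightarrow> computable n g \<Longrightarrow> computable n (\<lambda>x e. of_bool (f x e \<le> g x e))"
  by (rule computable_cong[of n "\<lambda>x e. 1 - (f x e - g x e)"]) (auto intro!: computable_intros)

lemma computable_less [computable_intros]:
  "computable n f \<Longrightarrow> computable n g \<Longrightarrow> computable n (\<lambda>x e. of_bool (f x e < g x e))"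
  by (rule computable_cong[of n "\<lambda>x e. of_bool (Suc (f x e) \<le> g x e)"],
      intro computable_intros) (auto simp: Suc_le_eq)

lemma computable_eq [computable_intros]:
  fixes f :: "bool list \<Rightarrow> (nat \<Rightarrow> nat) \<Rightarrow> nat"
  shows "computable n f \<Longrightarrow> computable n g \<Longrightarrow> computable n (\<lambda>x e. of_bool (f x e = g x e))"
  by (rule computable_cong[of n "\<lambda>x e. of_bool (f x e \<le> g x e \<and> g x e \<le> f x e)"],
      intro computable_intros) auto

lemma computable_iff [computable_intros]:
  "computable n (\<lambda>x e. of_bool (P x e)) \<Longrightarrow> computable n (\<lambda>x e. of_bool (Q x e)) \<Longrightarrow>
    computable n (\<lambda>x e. of_bool (P x e \<longleftrightarrow> Q x e))"
  by (rule computable_cong[of n "\<lambda>x e. of_bool ((P x e \<longrightarrow> Q x e) \<and> (Q x e \<longrightarrow> P x e))"],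
      intro computable_intros) auto

lemma computable_if [computable_intros]:
  assumes "computable n (\<lambda>x e. of_bool (P x e))" and "computable n f" and "computable n g"
  shows "computable n (\<lambda>x e. if P x e then f x e else g x e)"
  by (rule computable_cong[of n "\<lambda>x e. of_bool (P x e) * f x e + of_bool (\<not> P x e) * g x e"])
    (auto intro!: computable_intros assms)

lemma rec_nat_sum: "rec_nat 0 (\<lambda>i r. r + g i) k = (\<Sum>i<k. g i :: nat)"
  by (induction k) auto

text \<open>For sums the bound demanded by \<open>computable_rec\<close> comes for free, since one
  power of the input size dominates every summand. Bounded quantifiers then reduce to a sum being
  positive.\<close>

lemma computable_sum [computable_intros]:
  assumes f: "computable n f" and g: "computable (Suc n) (\<lambda>x e. g x (\<lambda>i. e (Suc i)) (e 0))"
  shows "computable n (\<lambda>x e. \<Sum>i<f x e. g x e i)"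
proof (rule computable_cong)
  let ?g = "\<lambda>x e. g x (\<lambda>i. e (Suc i)) (e 0)"
  obtain a where a: "\<And>x e. ?g x e \<le> (input_size (Suc n) x e + 2) ^ a"
    using computableD[OF g] unfolding poly_bounded_def by blast
  let ?h = "\<lambda>x e. (f x e + input_size n x e + 2) ^ a"
  show "computable n (\<lambda>x e. rec_nat 0 (\<lambda>i r. r + g x e i) (f x e))"
  proof (rule computable_rec[where H = "\<lambda>x e i r. r + g x e i"])
    show "poly_bounded n (\<lambda>x e. f x e * ?h x e)"
      by (intro poly_bounded_intros computableD f)
    show "rec_nat 0 (\<lambda>i r. r + g x e i) k \<le> f x e * ?h x e" if "k \<le> f x e" for x e k
    proof -
      have "(\<Sum>i<k. g x e i) \<le> (\<Sum>i<k. ?h x e)"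
      proof (rule sum_mono)
        fix i
        assume "i \<in> {..<k}"
        then have "(i + input_size n x e + 2) ^ a \<le> ?h x e"
          using that by (intro power_mono) auto
        then show "g x e i \<le> ?h x e"
          using a[of x "case_nat i e"] by simp
      qed
      also have "\<dots> \<le> f x e * ?h x e"
        using that by simp
      finally show ?thesis
        by (simp add: rec_nat_sum)
    qed
    \<comment> \<open>The renaming makes room for the accumulator, which is variable 1.\<close>
    show "computable (Suc (Suc n)) (\<lambda>x e. e 1 + g x (\<lambda>i. e (Suc (Suc i))) (e 0))"
      using computable_rename[OF g, of "case_nat 0 (\<lambda>i. Suc (Suc i))" "Suc (Suc n)"]
      by (intro computable_intros) (auto split: nat.split)
  qed (intro f computable_intros)+
qed (simp add: rec_nat_sum)

lemma computable_ex [computable_intros]: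
  assumes "computable n f"
    and "computable (Suc n) (\<lambda>x e. of_bool (P x (\<lambda>i. e (Suc i)) (e 0)))"
  shows "computable n (\<lambda>x e. of_bool (\<exists>i<f x e. P x e i))"
proof (rule computable_cong)
  show "computable n (\<lambda>x e. of_bool (0 < (\<Sum>i<f x e. of_bool (P x e i) :: nat)))"
    by (intro computable_intros assms)
qed auto

lemma computable_all [computable_intros]:
  assumes "computable n f"
    and "computable (Suc n) (\<lambda>x e. of_bool (P x (\<lambda>i. e (Suc i)) (e 0)))"
  shows "computable n (\<lambda>x e. of_bool (\<forall>i<f x e. P x e i))"
  by (rule computable_cong[of n "\<lambda>x e. of_bool (\<not> (\<exists>i<f x e. \<not> P x e i))"],
      intro computable_intros assms) auto

lemma computable_all_le [computable_intros]:
  assumes "computable n f"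
    and "computable (Suc n) (\<lambda>x e. of_bool (P x (\<lambda>i. e (Suc i)) (e 0)))"
  shows "computable n (\<lambda>x e. of_bool (\<forall>i\<le>f x e. P x e i))"
  using computable_all[OF computable_Suc[OF assms(1)] assms(2)] by (simp add: less_Suc_eq_le)

lemma sum_of_bool_less: "(\<Sum>i<a. of_bool (i < c)) = min a (c :: nat)"
  by (induction a) auto

text \<open>The quotient counts the positive multiples of \<open>b\<close> up to \<open>a\<close>;
  the conjunct \<open>0 < b\<close> reproduces \<open>a div 0 = 0\<close>.\<close>

lemma div_eq_sum: "(a :: nat) div b = (\<Sum>i<a. of_bool (0 < b \<and> b * Suc i \<le> a))"
proof (cases "b = 0")
  case False
  have "(0 < b \<and> b * Suc i \<le> a) = (i < a div b)" for i
    using less_eq_div_iff_mult_less_eq[of b "Suc i" a] False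
    by (simp add: Suc_le_eq mult.commute[of b])
  then have "(\<Sum>i<a. of_bool (0 < b \<and> b * Suc i \<le> a)) = min a (a div b)"
    by (simp only: sum_of_bool_less)
  then show ?thesis
    by (simp add: min_absorb2)
qed simp

lemma computable_div [computable_intros]:
  assumes "computable n f" and "computable n g"
  shows "computable n (\<lambda>x e. f x e div g x e)"
  unfolding div_eq_sum
  by (intro computable_intros computable_shift[of n f] computable_shift[of n g] assms) simp

lemma computable_mod [computable_intros]:
  assumes "computable n f" and "computable n g"
  shows "computable n (\<lambda>x e. f x e mod g x e)"
  unfolding minus_mult_div_eq_mod[symmetric] by (intro computable_intros assms)

lemma computable_odd [computable_intros]:
  "computable n f \<Longrightarrow> computable n (\<lambda>x e. of_bool (odd (f x e)))"
  unfolding odd_iff_mod_2_eq_one by (intro computable_intros)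

text \<open>The exponent is a constant; with a variable exponent the values would not stay
  polynomial.\<close>

lemma computable_power [computable_intros]:
  "computable n f \<Longrightarrow> computable n (\<lambda>x e. f x e ^ k)"
  by (induction k) (simp_all add: computable_intros)

lemma computable_poly [computable_intros]:
  "computable n f \<Longrightarrow> computable n (\<lambda>x e. poly p (f x e))"
  by (induction p) (simp_all add: computable_intros)

text \<open>Tables of constants are looked up modulo their length, so that nothing has to be said about
  arguments out of range.\<close>

lemma computable_table:
  assumes f: "computable n f" and A: "0 < A"
  shows "computable n (\<lambda>x e. g (f x e mod A))"
proof -
  have "computable n (\<lambda>x e. if f x e mod A < B then g (f x e mod A) else 0)" for B
  proof (induction B)
    case 0
    then show ?case
      by (simp add: computable_intros)
  next
    case (Suc B)
    show ?case
      by (rule computable_cong[of n "\<lambda>x e. if f x e mod A = B then g B else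
            if f x e mod A < B then g (f x e mod A) else 0"])
        (auto intro!: computable_intros f Suc.IH)
  qed
  from this[of A] show ?thesis
    using A by simp
qed

lemma computable_table2:
  assumes f: "computable n f" and A: "0 < A" and g: "computable n g" and B: "0 < B"
  shows "computable n (\<lambda>x e. h (f x e mod A) (g x e mod B))"
proof (rule computable_cong)
  have "0 < A * B"
    using A B by simp
  then show "computable n (\<lambda>x e. (\<lambda>c. h (c div B) (c mod B))
      (((f x e mod A) * B + g x e mod B) mod (A * B)))"
    by (intro computable_table computable_intros f g)
  fix x e
  have "(f x e mod A) * B + g x e mod B < A * B"
  proof -
    have "(f x e mod A) * B + g x e mod B < (f x e mod A + 1) * B"
      using B by simp
    also have "\<dots> \<le> A * B"
      using A by (intro mult_le_mono1) (simp add: Suc_le_eq)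
    finally show ?thesis .
  qed
  then show "h (f x e mod A) (g x e mod B) =
      (\<lambda>c. h (c div B) (c mod B)) (((f x e mod A) * B + g x e mod B) mod (A * B))"
    using B by simp
qed

text \<open>The arguments are bound one after the other by \<open>computable_let\<close>, so the
  last one gets index 0 and \<open>h\<close> is needed with its variables in reverse order.\<close>

lemma computable_subst2:
  assumes "computable 2 (\<lambda>x e. h x (e 0) (e 1))" and "computable n f" and "computable n g"
  shows "computable n (\<lambda>x e. h x (f x e) (g x e))"
proof -
  have "computable (Suc (Suc n)) (\<lambda>x e. h x (e (Suc 0)) (e 0))"
    using computable_rename[OF assms(1), of "\<lambda>i. 1 - i" "Suc (Suc n)"] by simp
  from computable_let[OF computable_shift[OF assms(3)], of "\<lambda>x e v. h x (e 0) v", OF this]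
  have "computable (Suc n) (\<lambda>x e. h x (e 0) (g x (\<lambda>i. e (Suc i))))" .
  from computable_let[OF assms(2), of "\<lambda>x e v. h x v (g x e)", OF this] show ?thesis .
qed

lemma computable_subst3:
  assumes "computable 3 (\<lambda>x e. h x (e 0) (e 1) (e 2))" and "computable n f" and "computable n g"
    and "computable n k"
  shows "computable n (\<lambda>x e. h x (f x e) (g x e) (k x e))"
proof -
  have "computable (Suc (Suc (Suc n))) (\<lambda>x e. h x (e 2) (e 1) (e 0))"
    using computable_rename[OF assms(1), of "\<lambda>i. 2 - i" "Suc (Suc (Suc n))"] by simp
  then have "computable (Suc (Suc (Suc n))) (\<lambda>x e. h x (e (Suc (Suc 0))) (e (Suc 0)) (e 0))"
    by (simp add: numeral_2_eq_2)
  from computable_let[OF computable_shift2[OF assms(4)], of "\<lambda>x e v. h x (e (Suc 0)) (e 0) v", OF this]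
  have "computable (Suc (Suc n)) (\<lambda>x e. h x (e (Suc 0)) (e 0) (k x (\<lambda>i. e (Suc (Suc i)))))" .
  from computable_let[OF computable_shift[OF assms(3)], of "\<lambda>x e v. h x (e 0) v (k x (\<lambda>i. e (Suc i)))", OF this]
  have "computable (Suc n) (\<lambda>x e. h x (e 0) (g x (\<lambda>i. e (Suc i))) (k x (\<lambda>i. e (Suc i))))" .
  from computable_let[OF assms(2), of "\<lambda>x e v. h x v (g x e) (k x e)", OF this] show ?thesis .
qed

lemma polytime_decidableI:
  assumes "computable 0 (\<lambda>x e. of_bool (P x))"
  shows "polytime_decidable {x. P x}"
proof -
  have "computable 1 (\<lambda>x e. of_bool (P x))"
    by (rule computable_rename[OF assms]) simp
  from polytime_computable_map[of "\<lambda>_. 1" "\<lambda>x _. P x", OF computable_const this] show ?thesis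
    by (simp add: polytime_decidable_def)
qed

section \<open>Computations as binary constraint satisfaction problems\<close>

text \<open>Halting is treated as idling, which lets one rule describe all rows of the tableau up to
  a fixed time.\<close>

definition next_action :: "turing_machine \<Rightarrow> nat \<Rightarrow> nat list \<Rightarrow> nat \<times> (nat \<times> move) list" where
  "next_action M q ss = (if q = halt M then (q, idle ss) else delta M q ss)"

lemma step_eq_next_action:
  "step M (q, ts) = (case next_action M q (map read ts) of (q', as) \<Rightarrow> (q', map2 act as ts))"
  by (simp add: next_action_def map2_act_idle)

lemma next_action_wf:
  assumes "wf_tm M" and "q \<in> states M" and "length ss = tape_count M" and "set ss \<subseteq> symbols M"
    and "next_action M q ss = (q', as)"
  shows "q' \<in> states M" and "length as = tape_count M" and "fst ` set as \<subseteq> symbols M"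
proof -
  have "q' \<in> states M \<and> length as = tape_count M \<and> fst ` set as \<subseteq> symbols M"
  proof (cases "q = halt M")
    case True
    then show ?thesis
      using assms by (auto simp: next_action_def idle_def)
  next
    case False
    have "\<forall>q \<in> states M - {halt M}. \<forall>ss. length ss = tape_count M \<and> set ss \<subseteq> symbols M \<longrightarrow>
        (case delta M q ss of (q', acts) \<Rightarrow>
           q' \<in> states M \<and> length acts = tape_count M \<and> fst ` set acts \<subseteq> symbols M)"
      using assms(1) unfolding wf_tm_def by (elim conjE)
    from this[rule_format, of q ss] False have "case delta M q ss of (q', acts) \<Rightarrow>
        q' \<in> states M \<and> length acts = tape_count M \<and> fst ` set acts \<subseteq> symbols M"
      using assms(2-4) by simp
    with False assms(5) show ?thesis
      by (simp add: next_action_def)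
  qed
  then show "q' \<in> states M" and "length as = tape_count M" and "fst ` set as \<subseteq> symbols M"
    by auto
qed

lemma read_eq: "read \<theta> = fst \<theta> (snd \<theta>)"
  by (cases \<theta>) simp

lemma set_map_read_subset:
  assumes "\<And>j p. j < length ts \<Longrightarrow> fst (ts ! j) p \<in> A"
  shows "set (map read ts) \<subseteq> A"
proof
  fix s
  assume "s \<in> set (map read ts)"
  then obtain j where "j < length ts" "s = read (ts ! j)"
    by (metis in_set_conv_nth length_map nth_map)
  then show "s \<in> A"
    using assms by (simp add: read_eq)
qed

lemma fst_word_tape:
  "fst (word_tape z) (int m) = (if m < length z then if z ! m then 2 else 1 else 0)"
  by (simp add: word_tape_def bit_symbol_eq)

definition config_at :: "turing_machine \<Rightarrow> bool list \<Rightarrow> nat \<Rightarrow> config" where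
  "config_at M z t = (step M ^^ t) (init M z)"

lemma config_at_0: "config_at M z 0 = init M z"
  by (simp add: config_at_def)

lemma config_at_Suc: "config_at M z (Suc t) = step M (config_at M z t)"
  by (simp add: config_at_def)

text \<open>A head moves at most one cell per step, so the cells from \<open>-T\<close> to
  \<open>T\<close> contain all that is read up to time \<open>T\<close>. This is the width of the
  tableau.\<close>

lemma config_at_wf:
  assumes wf: "wf_tm M" and "config_at M z t = (q, ts)"
  shows "q \<in> states M \<and> length ts = tape_count M \<and>
    (\<forall>j<tape_count M. (\<forall>p. fst (ts ! j) p \<in> symbols M) \<and> \<bar>snd (ts ! j)\<bar> \<le> int t)"
  using assms(2)
proof (induction t arbitrary: q ts)
  case 0
  have "{0, 1, 2} \<subseteq> symbols M"
    using wf by (auto simp: wf_tm_def)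
  then have "fst (word_tape z) p \<in> symbols M" "fst blank_tape p \<in> symbols M" for p
    by (auto simp: word_tape_def blank_tape_def bit_symbol_eq)
  moreover have "snd (word_tape z) = 0" "snd blank_tape = 0"
    by (auto simp: word_tape_def blank_tape_def)
  ultimately show ?case
    using 0 wf by (auto simp: config_at_0 init_def wf_tm_def nth_Cons split: nat.split)
next
  case (Suc t)
  obtain q0 ts0 where c: "config_at M z t = (q0, ts0)"
    by fastforce
  note IH = Suc.IH[OF c]
  obtain q' as where na: "next_action M q0 (map read ts0) = (q', as)"
    by fastforce
  have eq: "q = q'" "ts = map2 act as ts0"
    using Suc.prems unfolding config_at_Suc c step_eq_next_action na by auto
  have "set (map read ts0) \<subseteq> symbols M"
    using IH by (intro set_map_read_subset) simp
  note wf' = next_action_wf[OF wf _ _ this na]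
  have as: "q' \<in> states M" "length as = tape_count M" "fst ` set as \<subseteq> symbols M"
    using wf' IH by auto
  have "(\<forall>p. fst (ts ! j) p \<in> symbols M) \<and> \<bar>snd (ts ! j)\<bar> \<le> int (Suc t)" if j: "j < tape_count M" for j
  proof -
    obtain s m where sm: "as ! j = (s, m)"
      by fastforce
    obtain c h where ch: "ts0 ! j = (c, h)"
      by fastforce
    have "s \<in> symbols M"
      using as(2,3) j sm nth_mem[of j as] by force
    moreover have "\<bar>shift m h\<bar> \<le> int (Suc t)"
      using IH j ch by (cases m) force+
    ultimately show ?thesis
      using IH j as(2) by (auto simp: eq(2) sm ch)
  qed
  then show ?case
    using as IH by (simp add: eq)
qed

text \<open>A cell of the tableau shows a symbol and, under the head, also the state and the symbols read
  on all tapes. With these views the constraints of a run involve only two cells each.\<close>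

type_synonym cell = "nat \<times> (nat \<times> nat list) option"

definition cells :: "turing_machine \<Rightarrow> cell set" where
  "cells M = symbols M \<times>
     insert None (Some ` (states M \<times> {ss. set ss \<subseteq> symbols M \<and> length ss = tape_count M}))"

lemma finite_cells: "wf_tm M \<Longrightarrow> finite (cells M)"
  unfolding cells_def wf_tm_def by (intro finite_cartesian_product finite.insertI finite_imageI
    finite_lists_length_eq) auto

definition cell_of :: "config \<Rightarrow> nat \<Rightarrow> int \<Rightarrow> cell" where
  "cell_of C j p = (case C of (q, ts) \<Rightarrow>
     (fst (ts ! j) p, if snd (ts ! j) = p then Some (q, map read ts) else None))"

definition written :: "turing_machine \<Rightarrow> nat \<Rightarrow> cell \<Rightarrow> nat" where
  "written M j c = (case snd c of None \<Rightarrow> fst c | Some (q, ss) \<Rightarrow> fst (snd (next_action M q ss) ! j))"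

text \<open>The displacement plus 1, to remain in the natural numbers; this accounts for
  \<open>Suc i' = i + head_offset M j c\<close> in the constraints.\<close>

fun offset :: "move \<Rightarrow> nat" where
  "offset MoveLeft = 0"
| "offset Stay = 1"
| "offset MoveRight = 2"

lemma shift_offset: "shift m h = h + int (offset m) - 1"
  by (cases m) auto

definition head_offset :: "turing_machine \<Rightarrow> nat \<Rightarrow> cell \<Rightarrow> nat" where
  "head_offset M j c =
     (case snd c of None \<Rightarrow> 0 | Some (q, ss) \<Rightarrow> offset (snd (snd (next_action M q ss) ! j)))"

text \<open>Only the state is handed on. The symbols read next are guessed in the new view and
  controlled by \<open>agree\<close> and \<open>consistent\<close>.\<close>

definition succeeds :: "turing_machine \<Rightarrow> cell \<Rightarrow> cell \<Rightarrow> bool" where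
  "succeeds M c c' \<longleftrightarrow>
     (\<forall>q ss. snd c = Some (q, ss) \<longrightarrow> (\<exists>ss'. snd c' = Some (fst (next_action M q ss), ss')))"

text \<open>This couples the heads of different tapes: each cell under a head stores what all heads
  read, so comparing two cells at a time is enough.\<close>

definition agree :: "cell \<Rightarrow> cell \<Rightarrow> bool" where
  "agree c c' \<longleftrightarrow> snd c = None \<or> snd c' = None \<or> snd c = snd c'"

definition consistent :: "nat \<Rightarrow> cell \<Rightarrow> bool" where
  "consistent j c \<longleftrightarrow> (\<forall>q ss. snd c = Some (q, ss) \<longrightarrow> ss ! j = fst c)"

definition starting :: "turing_machine \<Rightarrow> cell \<Rightarrow> bool" where
  "starting M c \<longleftrightarrow> (\<exists>ss. snd c = Some (start M, ss))"

text \<open>Position \<open>i\<close> of the tableau is cell \<open>i - T\<close> of a tape. On tape 0 the run starts with the code of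
  \<open>x\<close> followed by an arbitrary word of length at most \<open>B\<close>.\<close>

definition input_ok :: "bool list \<Rightarrow> nat \<Rightarrow> nat \<Rightarrow> nat \<Rightarrow> nat \<Rightarrow> nat \<Rightarrow> bool" where
  "input_ok x B T j i s \<longleftrightarrow>
     (if j = 0 \<and> T \<le> i \<and> i < T + 2 * length x + 2
      then s = (if bit_at x ((i - T) div 2) \<or> i = T + 2 * length x + 1 then 2 else 1)
      else if j = 0 \<and> T \<le> i \<and> i < T + 2 * length x + 2 + B then s \<le> 2
      else s = 0)"

text \<open>Acceptance is the symbol 2, the bit True, in cell 0 of the last tape at time
  \<open>T\<close>.\<close>

definition unary_ok :: "turing_machine \<Rightarrow> bool list \<Rightarrow> nat \<Rightarrow> nat \<Rightarrow> nat \<Rightarrow> nat \<Rightarrow> nat \<Rightarrow> cell \<Rightarrow> bool" where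
  "unary_ok M x B T t j i c \<longleftrightarrow>
     consistent j c \<and>
     (t = 0 \<longrightarrow> (i = T \<longrightarrow> starting M c) \<and> (i \<noteq> T \<longrightarrow> snd c = None) \<and> input_ok x B T j i (fst c)) \<and>
     (t = T \<and> j = tape_count M - 1 \<and> i = T \<longrightarrow> fst c = 2)"

text \<open>The last conjunct forbids gaps in the guessed word: behind its first blank the input
  tape stays blank.\<close>

definition binary_ok :: "turing_machine \<Rightarrow> bool list \<Rightarrow> nat \<Rightarrow>
    nat \<Rightarrow> nat \<Rightarrow> nat \<Rightarrow> cell \<Rightarrow> nat \<Rightarrow> nat \<Rightarrow> nat \<Rightarrow> cell \<Rightarrow> bool" where
  "binary_ok M x T t j i c t' j' i' c' \<longleftrightarrow>
     (t' = t \<and> j' = j \<and> i' \<noteq> i \<longrightarrow> snd c = None \<or> snd c' = None) \<and>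
     (t' = t \<longrightarrow> agree c c') \<and>
     (t' = Suc t \<and> j' = j \<and> i' = i \<longrightarrow> fst c' = written M j c) \<and>
     (t' = Suc t \<and> j' = j \<and> Suc i' = i + head_offset M j c \<longrightarrow> succeeds M c c') \<and>
     (t = 0 \<and> t' = 0 \<and> j = 0 \<and> j' = 0 \<and> i' = Suc i \<and> T + 2 * length x + 2 \<le> i \<longrightarrow>
        fst c = 0 \<longrightarrow> fst c' = 0)"

definition tableau :: "turing_machine \<Rightarrow> bool list \<Rightarrow> nat \<Rightarrow> nat \<Rightarrow> (nat \<Rightarrow> nat \<Rightarrow> nat \<Rightarrow> cell) \<Rightarrow> bool" where
  "tableau M x B T \<sigma> \<longleftrightarrow>
     (\<forall>t\<le>T. \<forall>j<tape_count M. \<forall>i\<le>2 * T.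
        \<sigma> t j i \<in> cells M \<and> unary_ok M x B T t j i (\<sigma> t j i) \<and>
        (\<forall>t'\<le>T. \<forall>j'<tape_count M. \<forall>i'\<le>2 * T.
           binary_ok M x T t j i (\<sigma> t j i) t' j' i' (\<sigma> t' j' i')))"

lemma length_pair_code [simp]: "length (pair_code x w) = 2 * length x + 2 + length w"
  by (induction x) (auto simp: pair_code_def)

lemma pair_code_Nil: "pair_code [] w = False # True # w"
  by (simp add: pair_code_def)

lemma pair_code_Cons: "pair_code (b # x) w = b # b # pair_code x w"
  by (simp add: pair_code_def)

text \<open>Out of range \<open>bit_at\<close> is False, which already gives the False of the end
  mark at position \<open>2 * length x\<close>; only the True after it needs a disjunct.\<close>

lemma pair_code_nth:
  assumes "p < 2 * length x + 2"
  shows "pair_code x w ! p \<longleftrightarrow> bit_at x (p div 2) \<or> p = 2 * length x + 1"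
  using assms
proof (induction x arbitrary: p)
  case Nil
  then have "p = 0 \<or> p = 1"
    by auto
  then show ?case
    by (auto simp: pair_code_Nil bit_at_def)
next
  case (Cons b x)
  consider "p = 0" | "p = 1" | p' where "p = Suc (Suc p')"
    by (metis One_nat_def not0_implies_Suc)
  then show ?case
    using Cons by cases (auto simp: pair_code_Cons bit_at_def)
qed

lemma pair_code_nth_right: "pair_code x w ! (2 * length x + 2 + p) = w ! p"
  by (induction x) (auto simp: pair_code_Nil pair_code_Cons)

context
  fixes M :: turing_machine and x :: "bool list" and B T :: nat
  assumes wf: "wf_tm M" and T: "2 * length x + 2 + B \<le> T"
begin

lemma input_ok_word_tape:
  assumes "length w \<le> B" and "j < tape_count M"
    and "snd (init M (pair_code x w)) = ts"
  shows "input_ok x B T j i (fst (ts ! j) (int i - int T))"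
proof -
  have ts: "ts ! j = (if j = 0 then word_tape (pair_code x w) else blank_tape)"
    using assms by (auto simp: init_def nth_Cons split: nat.split)
  show ?thesis
  proof (cases "j = 0 \<and> T \<le> i")
    case True
    then obtain p where p: "i = T + p"
      using le_Suc_ex by blast
    have sym: "fst (ts ! j) (int i - int T) =
        (if p < length (pair_code x w) then if pair_code x w ! p then 2 else 1 else 0)"
      unfolding ts p using True by (simp add: fst_word_tape)
    show ?thesis
    proof (cases "p < 2 * length x + 2")
      case True
      then show ?thesis
        unfolding sym pair_code_nth[OF True]
        using \<open>j = 0 \<and> T \<le> i\<close> True by (simp add: input_ok_def p)
    next
      case False
      then show ?thesis
        unfolding sym using \<open>j = 0 \<and> T \<le> i\<close> assms(1) by (simp add: input_ok_def p)
    qed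
  next
    case False
    then have "fst (ts ! j) (int i - int T) = 0"
      by (auto simp: ts word_tape_def blank_tape_def)
    then show ?thesis
      using False by (auto simp: input_ok_def)
  qed
qed

lemma tableau_of_run:
  assumes w: "length w \<le> B"
    and acc: "fst (last (snd (config_at M (pair_code x w) T))) 0 = 2"
  shows "tableau M x B T (\<lambda>t j i. cell_of (config_at M (pair_code x w) t) j (int i - int T))"
    (is "tableau M x B T ?\<sigma>")
  unfolding tableau_def
proof (intro allI impI conjI)
  let ?C = "config_at M (pair_code x w)"
  have k: "0 < tape_count M"
    using wf by (simp add: wf_tm_def)
  fix t j i
  assume t: "t \<le> T" and j: "j < tape_count M" and i: "i \<le> 2 * T"
  obtain q ts where c: "?C t = (q, ts)"
    by fastforce
  note inv = config_at_wf[OF wf c]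
  have rd: "map read ts ! j' = read (ts ! j')" if "j' < tape_count M" for j'
    using inv that by simp
  have sub: "set (map read ts) \<subseteq> symbols M"
    using inv by (intro set_map_read_subset) simp
  show "?\<sigma> t j i \<in> cells M"
    using inv sub j by (auto simp: cells_def cell_of_def c)
  show "unary_ok M x B T t j i (?\<sigma> t j i)"
    unfolding unary_ok_def
  proof (intro conjI impI)
    show "consistent j (?\<sigma> t j i)"
      using rd[OF j] by (auto simp: consistent_def cell_of_def c read_eq)
  next
    assume 0: "t = 0"
    then have init: "init M (pair_code x w) = (q, ts)"
      using c by (simp add: config_at_0)
    have h: "snd (ts ! j) = 0" "q = start M"
      using init j by (auto simp: init_def word_tape_def blank_tape_def nth_Cons split: nat.split)
    show "starting M (?\<sigma> t j i)" if "i = T"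
      using that h by (simp add: starting_def cell_of_def c)
    show "snd (?\<sigma> t j i) = None" if "i \<noteq> T"
      using that h by (simp add: cell_of_def c)
    show "input_ok x B T j i (fst (?\<sigma> t j i))"
      using input_ok_word_tape[OF w j, of ts i] init by (simp add: cell_of_def c)
  next
    assume "t = T \<and> j = tape_count M - 1 \<and> i = T"
    then show "fst (?\<sigma> t j i) = 2"
      using acc c inv k last_conv_nth[of ts] by (force simp: cell_of_def)
  qed
  fix t' j' i'
  assume t': "t' \<le> T" and j': "j' < tape_count M" and i': "i' \<le> 2 * T"
  show "binary_ok M x T t j i (?\<sigma> t j i) t' j' i' (?\<sigma> t' j' i')"
    unfolding binary_ok_def
  proof (intro conjI impI)
    assume "t' = t \<and> j' = j \<and> i' \<noteq> i"
    then show "snd (?\<sigma> t j i) = None \<or> snd (?\<sigma> t' j' i') = None"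
      by (auto simp: cell_of_def c)
  next
    assume "t' = t"
    then show "agree (?\<sigma> t j i) (?\<sigma> t' j' i')"
      by (auto simp: agree_def cell_of_def c)
  next
    obtain q' as where na: "next_action M q (map read ts) = (q', as)"
      by fastforce
    have as: "length as = tape_count M"
      using next_action_wf(2)[OF wf _ _ sub na] inv by simp
    have step: "?C (Suc t) = (q', map2 act as ts)"
      unfolding config_at_Suc c step_eq_next_action na by simp
    obtain s m where sm: "as ! j = (s, m)"
      by fastforce
    obtain f h where fh: "ts ! j = (f, h)"
      by fastforce
    have nth: "map2 act as ts ! j = (f(h := s), shift m h)"
      using as inv j sm fh by simp
    {
      assume "t' = Suc t \<and> j' = j \<and> i' = i"
      then show "fst (?\<sigma> t' j' i') = written M j (?\<sigma> t j i)"
        using nth by (simp add: written_def cell_of_def c na sm fh step)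
    next
      assume "t' = Suc t \<and> j' = j \<and> Suc i' = i + head_offset M j (?\<sigma> t j i)"
      then show "succeeds M (?\<sigma> t j i) (?\<sigma> t' j' i')"
        using nth by (auto simp: succeeds_def head_offset_def cell_of_def c na sm fh step shift_offset
          split: if_splits)
    next
      assume "t = 0 \<and> t' = 0 \<and> j = 0 \<and> j' = 0 \<and> i' = Suc i \<and> T + 2 * length x + 2 \<le> i"
        and "fst (?\<sigma> t j i) = 0"
      then show "fst (?\<sigma> t' j' i') = 0"
        using c
        by (auto simp: config_at_0 init_def cell_of_def word_tape_def bit_symbol_eq split: if_splits)
    }
  qed
qed

text \<open>The word \<open>w\<close> is read from row 0, from behind the code of \<open>x\<close>
  up to the first blank. Induction on time then identifies the tableau with the run on
  \<open>pair_code x w\<close>.\<close>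

lemma run_of_tableau:
  assumes tab: "tableau M x B T \<sigma>"
  obtains w where "length w \<le> B" and "fst (last (snd (config_at M (pair_code x w) T))) 0 = 2"
proof -
  let ?k = "tape_count M"
  have k: "0 < ?k"
    using wf by (simp add: wf_tm_def)
  have cell: "\<sigma> t j i \<in> cells M" and un: "unary_ok M x B T t j i (\<sigma> t j i)"
    and bin: "\<And>t' j' i'. t' \<le> T \<Longrightarrow> j' < ?k \<Longrightarrow> i' \<le> 2 * T \<Longrightarrow>
      binary_ok M x T t j i (\<sigma> t j i) t' j' i' (\<sigma> t' j' i')"
    if "t \<le> T" "j < ?k" "i \<le> 2 * T" for t j i
    using tab that unfolding tableau_def by blast+
  let ?o = "T + 2 * length x + 2"
  let ?s = "\<lambda>p. fst (\<sigma> 0 0 (?o + p))"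
  have inp: "input_ok x B T j i (fst (\<sigma> 0 j i))" if "j < ?k" "i \<le> 2 * T" for j i
    using un[of 0 j i] that by (simp add: unary_ok_def)
  \<comment> \<open>The cell just behind the room for the guess lies within the window by the bound
    on \<open>T\<close> and is forced to be blank, so a first blank \<open>l \<le> B\<close>
    exists.\<close>
  have "?s B = 0"
    using inp[OF k, of "?o + B"] T by (simp add: input_ok_def)
  define l where "l = (LEAST p. ?s p = 0)"
  have l: "?s l = 0" "l \<le> B" "\<And>p. p < l \<Longrightarrow> ?s p \<noteq> 0"
    unfolding l_def using \<open>?s B = 0\<close> by (auto intro: LeastI Least_le dest: not_less_Least)
  have blank: "?s p = 0" if "l \<le> p" "?o + p \<le> 2 * T" for p
    using that
  proof (induction p rule: dec_induct)
    case (step p)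
    then show ?case
      using bin[of 0 0 "?o + p" 0 0 "Suc (?o + p)"] k by (simp add: binary_ok_def)
  qed (use l in auto)
  define w where "w = map (\<lambda>p. ?s p = 2) [0..<l]"
  let ?z = "pair_code x w"
  have wl: "length w = l"
    by (simp add: w_def)
  have tape0: "fst (\<sigma> 0 0 i) = fst (word_tape ?z) (int i - int T)" if i: "i \<le> 2 * T" for i
  proof (cases "T \<le> i")
    case False
    then show ?thesis
      using inp[OF k i] by (auto simp: input_ok_def word_tape_def)
  next
    case True
    then obtain m where m: "i = T + m"
      using le_Suc_ex by blast
    have e: "int i - int T = int m"
      by (simp add: m)
    consider "i < ?o" | p where "i = ?o + p" "p < l" | p where "i = ?o + p" "l \<le> p"
      by (metis le_Suc_ex not_less)
    then show ?thesis
    proof cases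
      case 1
      then have "m < 2 * length x + 2"
        by (simp add: m)
      then show ?thesis
        using inp[OF k i] by (simp add: input_ok_def fst_word_tape e m pair_code_nth)
    next
      case (2 p)
      then have "?s p \<le> 2" "?s p \<noteq> 0"
        using inp[OF k i] l by (auto simp: input_ok_def)
      then have "?s p = (if ?s p = 2 then 2 else 1)"
        by auto
      moreover have "m = 2 * length x + 2 + p"
        using 2 by (simp add: m)
      ultimately show ?thesis
        unfolding e fst_word_tape using 2 pair_code_nth_right[of x w p] by (simp add: wl w_def)
    next
      case (3 p)
      moreover have "m = 2 * length x + 2 + p"
        using 3 by (simp add: m)
      ultimately show ?thesis
        unfolding e fst_word_tape using blank[of p] i by (simp add: wl)
    qed
  qed
  text \<open>The symbols, the head positions and the state determine the views.\<close>
  have complete: "\<sigma> t j i = cell_of (q, ts) j (int i - int T)"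
    if t: "t \<le> T" and len: "length ts = ?k"
      and rng: "\<And>j. j < ?k \<Longrightarrow> \<bar>snd (ts ! j)\<bar> \<le> int T"
      and sym: "\<And>j i. j < ?k \<Longrightarrow> i \<le> 2 * T \<Longrightarrow> fst (\<sigma> t j i) = fst (ts ! j) (int i - int T)"
      and hd: "\<And>j i. j < ?k \<Longrightarrow> i \<le> 2 * T \<Longrightarrow> snd (ts ! j) = int i - int T \<Longrightarrow>
        \<exists>ss. snd (\<sigma> t j i) = Some (q, ss)"
      and j: "j < ?k" and i: "i \<le> 2 * T"
    for t j i q ts
  proof -
    define pos where "pos j = nat (snd (ts ! j) + int T)" for j
    have pos: "pos j \<le> 2 * T" "int (pos j) - int T = snd (ts ! j)" if "j < ?k" for j
      using rng[OF that] by (auto simp: pos_def)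
    have hd': "\<exists>ss. snd (\<sigma> t j (pos j)) = Some (q, ss)" if "j < ?k" for j
      using hd[OF that pos(1)] pos(2) that by simp
    obtain ss where ss: "snd (\<sigma> t j (pos j)) = Some (q, ss)"
      using hd' j by blast
    have "length ss = ?k"
      using cell[OF t j pos(1)[OF j]] ss unfolding cells_def by (cases "\<sigma> t j (pos j)") auto
    moreover have "ss ! j' = read (ts ! j')" if j': "j' < ?k" for j'
    proof -
      have "snd (\<sigma> t j' (pos j')) = Some (q, ss)"
        using bin[OF t j pos(1)[OF j] t j' pos(1)[OF j']] ss hd'[OF j']
        by (auto simp: binary_ok_def agree_def)
      then have "ss ! j' = fst (\<sigma> t j' (pos j'))"
        using un[OF t j' pos(1)[OF j']] by (auto simp: unary_ok_def consistent_def)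
      then show ?thesis
        using sym[OF j' pos(1)[OF j']] pos(2)[OF j'] by (simp add: read_eq)
    qed
    ultimately have view: "ss = map read ts"
      using len by (intro nth_equalityI) auto
    show ?thesis
    proof (cases "i = pos j")
      case True
      then show ?thesis
        using sym[OF j i] ss view pos(2)[OF j] by (auto simp: cell_of_def intro: prod_eqI)
    next
      case False
      then have "snd (\<sigma> t j i) = None"
        using bin[OF t j i t j pos(1)[OF j]] ss by (auto simp: binary_ok_def)
      moreover have "snd (ts ! j) \<noteq> int i - int T"
        using False pos(2)[OF j] by simp
      ultimately show ?thesis
        using sym[OF j i] by (auto simp: cell_of_def intro: prod_eqI)
    qed
  qed
  have run: "\<forall>j<?k. \<forall>i\<le>2 * T. \<sigma> t j i = cell_of (config_at M ?z t) j (int i - int T)" if "t \<le> T" for t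
    using that
  proof (induction t)
    case 0
    obtain q ts where c: "config_at M ?z 0 = (q, ts)"
      by fastforce
    note inv = config_at_wf[OF wf c]
    have q: "q = start M" and ts: "ts = word_tape ?z # replicate (?k - 1) blank_tape"
      using c by (auto simp: config_at_0 init_def)
    have nth: "ts ! j = (if j = 0 then word_tape ?z else blank_tape)" if "j < ?k" for j
      using that by (auto simp: ts nth_Cons split: nat.split)
    have sym: "fst (\<sigma> 0 j i) = fst (ts ! j) (int i - int T)" if "j < ?k" "i \<le> 2 * T" for j i
      using that tape0[of i] inp[of j i] by (auto simp: nth blank_tape_def input_ok_def)
    have hd: "\<exists>ss. snd (\<sigma> 0 j i) = Some (q, ss)"
      if "j < ?k" "i \<le> 2 * T" "snd (ts ! j) = int i - int T" for j i
    proof -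
      have "i = T"
        using that by (auto simp: nth blank_tape_def word_tape_def split: if_splits)
      then show ?thesis
        using un[of 0 j i] that by (auto simp: unary_ok_def starting_def q)
    qed
    show ?case
      unfolding c
      by (intro allI impI complete) (use inv sym hd in auto)
  next
    case (Suc t)
    then have IH: "\<sigma> t j i = cell_of (config_at M ?z t) j (int i - int T)"
      if "j < ?k" "i \<le> 2 * T" for j i
      using that by simp
    obtain q ts where c: "config_at M ?z t = (q, ts)"
      by fastforce
    note inv = config_at_wf[OF wf c]
    have sub: "set (map read ts) \<subseteq> symbols M"
      using inv by (intro set_map_read_subset) simp
    obtain q' as where na: "next_action M q (map read ts) = (q', as)"
      by fastforce
    have as: "length as = ?k"
      using next_action_wf(2)[OF wf _ _ sub na] inv by simp
    let ?ts' = "map2 act as ts"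
    have c': "config_at M ?z (Suc t) = (q', ?ts')"
      unfolding config_at_Suc c step_eq_next_action na by simp
    note inv' = config_at_wf[OF wf c']
    have t: "t \<le> T"
      using Suc.prems by simp
    have nth: "?ts' ! j = act (as ! j) (ts ! j)" if "j < ?k" for j
      using that as inv by simp
    have sym: "fst (\<sigma> (Suc t) j i) = fst (?ts' ! j) (int i - int T)" if j: "j < ?k" and i: "i \<le> 2 * T" for j i
    proof -
      have "fst (\<sigma> (Suc t) j i) = written M j (\<sigma> t j i)"
        using bin[OF t j i Suc.prems j i] by (simp add: binary_ok_def)
      also have "\<dots> = fst (?ts' ! j) (int i - int T)"
        unfolding IH[OF j i] nth[OF j] c
        by (cases "as ! j"; cases "ts ! j") (auto simp: written_def cell_of_def na)
      finally show ?thesis .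
    qed
    have hd: "\<exists>ss. snd (\<sigma> (Suc t) j i) = Some (q', ss)"
      if j: "j < ?k" and i: "i \<le> 2 * T" and eq: "snd (?ts' ! j) = int i - int T" for j i
    proof -
      obtain s m where sm: "as ! j = (s, m)"
        by fastforce
      obtain f h where fh: "ts ! j = (f, h)"
        by fastforce
      have "\<bar>h\<bar> \<le> int t"
        using inv j fh by force
      \<comment> \<open>The column of the head at time \<open>t\<close>; it is inside the window
        because \<open>\<bar>h\<bar> \<le> t \<le> T\<close>.\<close>
      define i0 where "i0 = nat (h + int T)"
      have h: "i0 \<le> 2 * T" "int i0 - int T = h"
        using \<open>\<bar>h\<bar> \<le> int t\<close> Suc.prems by (auto simp: i0_def)
      have "\<sigma> t j i0 = (f h, Some (q, map read ts))"
        using IH[OF j h(1)] h(2) by (simp add: c cell_of_def fh)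
      moreover have "Suc i = i0 + offset m"
        using eq[unfolded nth[OF j]] h(2) by (simp add: sm fh shift_offset)
      ultimately have "succeeds M (\<sigma> t j i0) (\<sigma> (Suc t) j i)"
        using bin[OF t j h(1) Suc.prems j i] by (simp add: binary_ok_def head_offset_def na sm)
      with \<open>\<sigma> t j i0 = (f h, Some (q, map read ts))\<close> show ?thesis
        by (simp add: succeeds_def na)
    qed
    show ?case
      unfolding c'
    proof (intro allI impI complete)
      show "\<bar>snd (?ts' ! j)\<bar> \<le> int T" if "j < ?k" for j
      proof -
        have "\<bar>snd (?ts' ! j)\<bar> \<le> int (Suc t)"
          using inv' that by blast
        then show ?thesis
          using Suc.prems by linarith
      qed
    qed (use Suc.prems inv' sym hd in auto)
  qed
  obtain q ts where c: "config_at M ?z T = (q, ts)"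
    by fastforce
  have "length ts = ?k"
    using config_at_wf[OF wf c] by simp
  moreover have "fst (\<sigma> T (?k - 1) T) = 2"
    using un[of T "?k - 1" T] k by (simp add: unary_ok_def)
  moreover have "\<sigma> T (?k - 1) T = cell_of (q, ts) (?k - 1) 0"
    using run[of T] k c by simp
  ultimately have "fst (last ts) 0 = 2"
    using k last_conv_nth[of ts] by (force simp: cell_of_def)
  then have "fst (last (snd (config_at M ?z T))) 0 = 2"
    by (simp add: c)
  then show thesis
    using that wl l(2) by blast
qed

end

text \<open>Tuples are packed into numbers in mixed radix throughout; this is the rule for unpacking
  one digit.\<close>

lemma digits:
  assumes "j < (k :: nat)"
  shows "(q * k + j) div k = q" and "(q * k + j) mod k = j" and "q < n \<Longrightarrow> q * k + j < n * k"
proof -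
  show "(q * k + j) div k = q" "(q * k + j) mod k = j"
    using assms by auto
  assume "q < n"
  have "q * k + j < (q + 1) * k"
    using assms by simp
  also have "\<dots> \<le> n * k"
    using \<open>q < n\<close> by (intro mult_le_mono1) simp
  finally show "q * k + j < n * k" .
qed

section \<open>Cycles\<close>

text \<open>The cycle continued periodically, which removes the case distinction at its closing
  edge.\<close>

definition cyc :: "'a list \<Rightarrow> nat \<Rightarrow> 'a" where
  "cyc c i = c ! (i mod length c)"

lemma is_cycle_length: "is_cycle E c \<Longrightarrow> 3 \<le> length c"
  by (simp add: is_cycle_def)

lemma cyc_edge:
  assumes "is_cycle E c"
  shows "{cyc c i, cyc c (Suc i)} \<in> E"
proof -
  have "i mod length c < length c"
    using is_cycle_length[OF assms] by (intro mod_less_divisor) linarith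
  then have "{c ! (i mod length c), c ! (Suc (i mod length c) mod length c)} \<in> E"
    using assms unfolding is_cycle_def by blast
  then show ?thesis
    by (simp add: cyc_def mod_Suc_eq)
qed

lemma cyc_eq_iff:
  assumes "is_cycle E c"
  shows "cyc c i = cyc c j \<longleftrightarrow> i mod length c = j mod length c"
proof -
  have "i mod length c < length c" "j mod length c < length c"
    using is_cycle_length[OF assms] by (intro mod_less_divisor; linarith)+
  then show ?thesis
    using assms by (simp add: cyc_def is_cycle_def nth_eq_iff_index_eq)
qed

lemma cyc_in_set: "is_cycle E c \<Longrightarrow> cyc c i \<in> set c"
  using is_cycle_length[of E c] by (auto simp: cyc_def intro!: nth_mem mod_less_divisor)

lemma cyc_neq:
  assumes "is_cycle E c" and "i < j" and "j < i + length c"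
  shows "cyc c i \<noteq> cyc c j"
proof
  assume "cyc c i = cyc c j"
  then have "j mod length c = i mod length c"
    using cyc_eq_iff[OF assms(1)] by metis
  then have "length c dvd j - i"
    using assms(2) by (simp add: mod_eq_dvd_iff_nat)
  then show False
    using assms(2,3) by (auto dest: dvd_imp_le)
qed

lemma cycle_neighbours:
  assumes c: "is_cycle E c" and v: "v \<in> set c"
  obtains x y where "x \<in> set c" "y \<in> set c" "x \<noteq> y" "{v, x} \<in> E" "{v, y} \<in> E"
proof -
  obtain i where i: "i < length c" "v = c ! i"
    using v by (auto simp: in_set_conv_nth)
  \<comment> \<open>The predecessor of position \<open>i\<close>, moved by one period so that
    \<open>i = 0\<close> causes no truncated subtraction.\<close>
  define j where "j = i + length c - 1"
  have "Suc j = i + length c"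
    using i(1) by (simp add: j_def)
  then have vj: "v = cyc c (Suc j)"
    using i by (simp add: cyc_def)
  show thesis
  proof (rule that)
    show "cyc c j \<in> set c" "cyc c (Suc (Suc j)) \<in> set c"
      using cyc_in_set[OF c] by blast+
    show "cyc c j \<noteq> cyc c (Suc (Suc j))"
      using is_cycle_length[OF c] by (intro cyc_neq[OF c]) auto
    show "{v, cyc c j} \<in> E" "{v, cyc c (Suc (Suc j))} \<in> E"
      using cyc_edge[OF c, of j] cyc_edge[OF c, of "Suc j"] by (auto simp: vj insert_commute)
  qed
qed

lemma le_girth_iff: "enat p \<le> girth E \<longleftrightarrow> (\<forall>c. is_cycle E c \<longrightarrow> p \<le> length c)"
  unfolding girth_def le_INF_iff by simp

section \<open>From independent sets to even cycle transversals\<close>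

text \<open>Every ordered pair \<open>(a, b)\<close> of adjacent vertices of a graph \<open>H\<close> on \<open>{..<m}\<close>, loops included,
  becomes a path from \<open>a\<close> to \<open>b\<close> of even length \<open>L\<close>. An edge thus yields two parallel paths, which
  form an even cycle, and every cycle contains one of these paths, so that even cycle transversals
  correspond to vertex covers.\<close>

definition path_vertex :: "nat \<Rightarrow> nat \<Rightarrow> nat \<Rightarrow> nat \<Rightarrow> nat \<Rightarrow> nat" where
  "path_vertex m L a b c =
     (if c = 0 then a else if c = L then b else m + ((a * m + b) * (L - 1) + (c - 1)))"

definition path_edges :: "nat \<Rightarrow> nat \<Rightarrow> (nat \<Rightarrow> nat \<Rightarrow> bool) \<Rightarrow> nat set set" where
  "path_edges m L H = {{path_vertex m L a b c, path_vertex m L a b (Suc c)} | a b c.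
     a < m \<and> b < m \<and> c < L \<and> H a b}"

definition path_graph_size :: "nat \<Rightarrow> nat \<Rightarrow> nat" where
  "path_graph_size m L = m + m * m * (L - 1)"

context
  fixes m L :: nat and H :: "nat \<Rightarrow> nat \<Rightarrow> bool"
  assumes L: "4 \<le> L" "even L" and H_sym: "\<And>a b. H a b \<Longrightarrow> H b a"
begin

abbreviation "pv \<equiv> path_vertex m L"
abbreviation "pe \<equiv> path_edges m L H"

lemma path_vertex_0 [simp]: "pv a b 0 = a" and path_vertex_L [simp]: "pv a b L = b"
  using L by (simp_all add: path_vertex_def)

lemma path_vertex_inner: "0 < c \<Longrightarrow> c < L \<Longrightarrow> pv a b c = m + ((a * m + b) * (L - 1) + (c - 1))"
  by (simp add: path_vertex_def)

lemma path_vertex_decode: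
  assumes "0 < c" and "c < L" and "b < m"
  shows "(pv a b c - m) div (L - 1) div m = a" and "(pv a b c - m) div (L - 1) mod m = b"
    and "(pv a b c - m) mod (L - 1) = c - 1"
proof -
  have c: "c - 1 < L - 1"
    using assms by simp
  have "pv a b c - m = (a * m + b) * (L - 1) + (c - 1)"
    by (simp only: path_vertex_inner[OF assms(1,2)] diff_add_inverse)
  then show "(pv a b c - m) div (L - 1) div m = a" and "(pv a b c - m) div (L - 1) mod m = b"
    and "(pv a b c - m) mod (L - 1) = c - 1"
    by (simp_all only: digits[OF c] digits[OF assms(3)])
qed

lemma path_vertex_less_iff:
  assumes "a < m" and "b < m" and "c \<le> L"
  shows "pv a b c < m \<longleftrightarrow> c = 0 \<or> c = L"
  using assms by (auto simp: path_vertex_def)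

text \<open>Inner vertices determine their path, whereas end vertices are shared; hence
  \<open>0 < c\<close> and \<open>c < L\<close>.\<close>

lemma path_vertex_inj:
  assumes "pv a b c = pv a' b' c'" and "0 < c" and "c < L" and "a < m" and "b < m"
    and "a' < m" and "b' < m" and "c' \<le> L"
  shows "a' = a \<and> b' = b \<and> c' = c"
proof -
  have c': "0 < c'" "c' < L"
    using path_vertex_less_iff[of a b c] path_vertex_less_iff[of a' b' c'] assms by auto
  then have "c' - 1 = c - 1"
    using path_vertex_decode(3)[of c b a] path_vertex_decode(3)[of c' b' a'] assms by simp
  then have "c' = c"
    using c' assms by linarith
  moreover have "a' = a" "b' = b"
    using path_vertex_decode(1,2)[of c b a] path_vertex_decode(1,2)[of c' b' a'] assms c' by simp_all
  ultimately show ?thesis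
    by simp
qed

lemma path_vertex_less:
  assumes "a < m" and "b < m" and "c \<le> L"
  shows "pv a b c < path_graph_size m L"
proof (cases "c = 0 \<or> c = L")
  case True
  then show ?thesis
    using assms by (auto simp: path_graph_size_def)
next
  case False
  then have c: "0 < c" "c < L" "c - 1 < L - 1"
    using assms by auto
  have "(a * m + b) * (L - 1) + (c - 1) < m * m * (L - 1)"
    using assms c by (intro digits(3))
  then show ?thesis
    unfolding path_vertex_inner[OF c(1,2)] path_graph_size_def by (rule add_strict_left_mono)
qed

lemma path_vertex_Suc_neq:
  assumes "a < m" and "b < m" and "c < L"
  shows "pv a b c \<noteq> pv a b (Suc c)"
proof
  assume eq: "pv a b c = pv a b (Suc c)"
  show False
  proof (cases "c = 0")
    case True
    then show False
      using path_vertex_less_iff[of a b 0] path_vertex_less_iff[of a b 1] eq assms L by simp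
  next
    case False
    then show False
      using path_vertex_inj[OF eq] assms by simp
  qed
qed

lemma inj_on_path_vertex:
  assumes "a < m" and "b < m"
  shows "inj_on (pv a b) {0..<L}"
proof (rule inj_onI)
  fix i j
  assume ij: "i \<in> {0..<L}" "j \<in> {0..<L}" and eq: "pv a b i = pv a b j"
  show "i = j"
  proof (cases "i = 0")
    case True
    then show ?thesis
      using path_vertex_less_iff[of a b i] path_vertex_less_iff[of a b j] eq ij assms by auto
  next
    case False
    then show ?thesis
      using path_vertex_inj[OF eq] ij assms by auto
  qed
qed

lemma simple_path_graph: "simple_graph {0..<path_graph_size m L} pe"
  unfolding simple_graph_def
proof (intro conjI ballI)
  fix e
  assume "e \<in> pe"
  then obtain a b c where "a < m" "b < m" "c < L" "e = {pv a b c, pv a b (Suc c)}"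
    unfolding path_edges_def by blast
  then show "\<exists>u\<in>{0..<path_graph_size m L}. \<exists>v\<in>{0..<path_graph_size m L}. u \<noteq> v \<and> e = {u, v}"
    using path_vertex_less[of a b c] path_vertex_less[of a b "Suc c"] path_vertex_Suc_neq[of a b c]
    by (intro bexI[of _ "pv a b c"] bexI[of _ "pv a b (Suc c)"]) auto
qed simp

lemma inner_neighbours:
  assumes e: "{pv a b c, y} \<in> pe" and c: "0 < c" "c < L" and ab: "a < m" "b < m"
  shows "y = pv a b (c - 1) \<or> y = pv a b (Suc c)"
proof -
  obtain a' b' c' where abc: "a' < m" "b' < m" "c' < L"
      and eq: "{pv a b c, y} = {pv a' b' c', pv a' b' (Suc c')}"
    using e unfolding path_edges_def by blast
  from eq consider "pv a b c = pv a' b' c'" "y = pv a' b' (Suc c')"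
    | "pv a b c = pv a' b' (Suc c')" "y = pv a' b' c'"
    by (auto simp: doubleton_eq_iff)
  then show ?thesis
  proof cases
    case 1
    then show ?thesis
      using path_vertex_inj[OF 1(1) c ab] abc by auto
  next
    case 2
    then show ?thesis
      using path_vertex_inj[OF 2(1) c ab] abc by auto
  qed
qed

text \<open>Inner vertices have only the two neighbours on their path, so a cycle cannot turn off
  there and must follow the path to both ends.\<close>

lemma cycle_contains_path:
  assumes cyc: "is_cycle pe c"
  obtains a b where "a < m" "b < m" "H a b" "\<And>i. i \<le> L \<Longrightarrow> pv a b i \<in> set c"
proof -
  obtain a b i where ab: "a < m" "b < m" "H a b" and i: "i < L"
      and e: "{cyc c 0, cyc c (Suc 0)} = {pv a b i, pv a b (Suc i)}"
    using cyc_edge[OF cyc, of 0] unfolding path_edges_def by blast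
  have in_c: "pv a b i \<in> set c" "pv a b (Suc i) \<in> set c"
    using e cyc_in_set[OF cyc] by (metis doubleton_eq_iff)+
  have nb: "pv a b (j - 1) \<in> set c \<and> pv a b (Suc j) \<in> set c"
    if j: "pv a b j \<in> set c" "0 < j" "j < L" for j
  proof -
    obtain x y where xy: "x \<in> set c" "y \<in> set c" "x \<noteq> y" "{pv a b j, x} \<in> pe" "{pv a b j, y} \<in> pe"
      using cycle_neighbours[OF cyc j(1)] by blast
    then show ?thesis
      using inner_neighbours[OF xy(4) j(2,3) ab(1,2)] inner_neighbours[OF xy(5) j(2,3) ab(1,2)]
      by metis
  qed
  \<comment> \<open>Since \<open>L\<close> exceeds 1, at least one end of the chosen edge is an
    inner vertex.\<close>
  obtain k where k: "0 < k" "k < L" "pv a b k \<in> set c"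
  proof (cases "i = 0")
    case True
    with in_c L show ?thesis
      by (intro that[of 1]) auto
  next
    case False
    with in_c i show ?thesis
      by (intro that[of i]) auto
  qed
  have up: "pv a b j \<in> set c" if "k \<le> j" "j \<le> L" for j
    using that
  proof (induction j rule: dec_induct)
    case (step j)
    then show ?case
      using nb[of j] k by simp
  qed (use k in simp)
  have down: "pv a b (k - j) \<in> set c" if "j \<le> k" for j
    using that
  proof (induction j)
    case (Suc j)
    then show ?case
      using nb[of "k - j"] k by simp
  qed (use k in simp)
  show thesis
  proof (rule that[OF ab])
    fix j
    assume "j \<le> L"
    then show "pv a b j \<in> set c"
      using up[of j] down[of "k - j"] by (cases "k \<le> j") auto
  qed
qed

lemma girth_path_graph: "enat L \<le> girth pe"
  unfolding le_girth_iff
proof (intro allI impI)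
  fix c
  assume "is_cycle pe c"
  then obtain a b where ab: "a < m" "b < m" and sub: "\<And>i. i \<le> L \<Longrightarrow> pv a b i \<in> set c"
    using cycle_contains_path by blast
  have "L = card (pv a b ` {0..<L})"
    using inj_on_path_vertex[OF ab] by (simp add: card_image)
  also have "\<dots> \<le> card (set c)"
    using sub by (intro card_mono) auto
  also have "\<dots> \<le> length c"
    by (rule card_length)
  finally show "L \<le> length c" .
qed

text \<open>This cycle has length \<open>L\<close> and is even only because \<open>L\<close> is; the
  two paths of a proper edge have the even total length \<open>2 * L\<close> in any case.\<close>

lemma loop_cycle:
  assumes "a < m" and "H a a"
  shows "is_cycle pe (map (pv a a) [0..<L])"
  unfolding is_cycle_def
proof (intro conjI allI impI)
  show "3 \<le> length (map (pv a a) [0..<L])"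
    using L by simp
  show "distinct (map (pv a a) [0..<L])"
    using inj_on_path_vertex[OF assms(1,1)] by (simp add: distinct_map)
  fix i
  assume "i < length (map (pv a a) [0..<L])"
  then have i: "i < L"
    by simp
  have "map (pv a a) [0..<L] ! (Suc i mod L) = pv a a (Suc i)"
    using i by (cases "Suc i = L") auto
  moreover have "{pv a a i, pv a a (Suc i)} \<in> pe"
    unfolding path_edges_def using assms i by blast
  ultimately show "{map (pv a a) [0..<L] ! i,
      map (pv a a) [0..<L] ! (Suc i mod length (map (pv a a) [0..<L]))} \<in> pe"
    using i by simp
qed

lemma edge_cycle:
  assumes ab: "a < m" "b < m" "a \<noteq> b" and H: "H a b"
  shows "is_cycle pe (map (pv a b) [0..<L] @ map (pv b a) [0..<L])" (is "is_cycle pe ?c")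
  unfolding is_cycle_def
proof (intro conjI allI impI)
  show "3 \<le> length ?c"
    using L by simp
  have "pv a b i \<noteq> pv b a j" if "i < L" "j < L" for i j
  proof (cases "i = 0")
    case True
    then show ?thesis
      using path_vertex_less_iff[of b a j] that ab by auto
  next
    case False
    then show ?thesis
      using path_vertex_inj[of a b i b a j] that ab by auto
  qed
  then have "pv a b ` {0..<L} \<inter> pv b a ` {0..<L} = {}"
    by auto
  moreover note inj_on_path_vertex[OF ab(1,2)] inj_on_path_vertex[OF ab(2,1)]
  ultimately show "distinct ?c"
    by (simp add: distinct_map)
  fix i
  assume "i < length ?c"
  then have i: "i < 2 * L"
    by simp
  show "{?c ! i, ?c ! (Suc i mod length ?c)} \<in> pe"
  proof (cases "i < L")
    case True
    then have "Suc i < 2 * L"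
      using L by simp
    then have "?c ! (Suc i mod length ?c) = pv a b (Suc i)"
      using True by (cases "Suc i = L") (auto simp: nth_append)
    moreover have "{pv a b i, pv a b (Suc i)} \<in> pe"
      unfolding path_edges_def using ab H True by blast
    ultimately show ?thesis
      using True by (simp add: nth_append)
  next
    case False
    define j where "j = i - L"
    have j: "i = L + j" "j < L"
      using False i by (auto simp: j_def)
    have "?c ! (Suc i mod length ?c) = pv b a (Suc j)"
    proof (cases "Suc j = L")
      case True
      then have "Suc i = length ?c"
        using j by simp
      then show ?thesis
        using True L by (simp add: nth_append)
    qed (use j in \<open>simp add: nth_append\<close>)
    moreover have "{pv b a j, pv b a (Suc j)} \<in> pe"
      unfolding path_edges_def using ab H_sym[OF H] j(2) by blast
    ultimately show ?thesis
      using j by (simp add: nth_append)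
  qed
qed

text \<open>A transversal can be pushed onto the vertices of \<open>H\<close> without growing; it
  then meets every edge and loop of \<open>H\<close>, so the other vertices are independent.
  Conversely, every cycle contains both ends of some edge or loop of \<open>H\<close>, and one of
  them is outside a given independent set.\<close>

lemma transversal_iff_independent:
  assumes N: "N \<le> m"
  shows "(\<exists>S. even_cycle_transversal {0..<path_graph_size m L} pe S \<and> card S \<le> m - N) \<longleftrightarrow>
    (\<exists>I \<subseteq> {..<m}. N \<le> card I \<and> (\<forall>u\<in>I. \<forall>v\<in>I. \<not> H u v))"
proof (intro iffI; elim exE conjE)
  fix S
  assume S: "even_cycle_transversal {0..<path_graph_size m L} pe S" "card S \<le> m - N"
  then have fin: "finite S"
    unfolding even_cycle_transversal_def using finite_subset by blast
  have hit: "\<exists>v \<in> set c. v \<in> S" if "is_cycle pe c" "even (length c)" for c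
    using S(1) that unfolding even_cycle_transversal_def by blast
  \<comment> \<open>An inner vertex of the path from \<open>a\<close> to \<open>b\<close> is charged
    to \<open>a\<close>. The cycle of an edge consists of both orientations, so it is charged to one
    of its ends either way.\<close>
  define origin where "origin v = (if v < m then v else (v - m) div (L - 1) div m)" for v
  have origin: "origin (pv a b c) = a" if "a < m" "b < m" "c < L" for a b c
    using that path_vertex_less_iff[of a b c] path_vertex_decode(1)[of c b a]
    by (cases "c = 0") (auto simp: origin_def)
  let ?I = "{..<m} - origin ` S"
  have "card {..<m} - card (origin ` S) \<le> card ?I"
    using fin by (intro diff_card_le_card_Diff) simp
  moreover have "card (origin ` S) \<le> m - N"
    using card_image_le[OF fin, of origin] S(2) by simp
  ultimately have "N \<le> card ?I"
    using N by simp
  moreover have "\<not> H u v" if u: "u \<in> ?I" and v: "v \<in> ?I" for u v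
  proof
    assume H: "H u v"
    have *: "\<exists>w\<in>S. origin w = u \<or> origin w = v"
    proof (cases "u = v")
      case True
      then obtain w where "w \<in> set (map (pv u u) [0..<L])" "w \<in> S"
        using hit[OF loop_cycle[of u]] H u L by auto
      then have "origin w = u"
        using origin[of u u] u by auto
      with \<open>w \<in> S\<close> show ?thesis
        by blast
    next
      case False
      then obtain w where "w \<in> set (map (pv u v) [0..<L] @ map (pv v u) [0..<L])" "w \<in> S"
        using hit[OF edge_cycle[of u v]] H u v by auto
      then have "origin w = u \<or> origin w = v"
        using origin[of u v] origin[of v u] u v by auto
      with \<open>w \<in> S\<close> show ?thesis
        by blast
    qed
    then show False
      using u v by auto
  qed
  ultimately show "\<exists>I \<subseteq> {..<m}. N \<le> card I \<and> (\<forall>u\<in>I. \<forall>v\<in>I. \<not> H u v)"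
    by (intro exI[of _ ?I]) auto
next
  fix I
  assume I: "I \<subseteq> {..<m}" "N \<le> card I" "\<forall>u\<in>I. \<forall>v\<in>I. \<not> H u v"
  let ?S = "{..<m} - I"
  have "even_cycle_transversal {0..<path_graph_size m L} pe ?S"
    unfolding even_cycle_transversal_def
  proof (intro conjI allI impI)
    show "?S \<subseteq> {0..<path_graph_size m L}"
      by (auto simp: path_graph_size_def)
    fix c
    assume "is_cycle pe c \<and> even (length c)"
    then obtain a b where ab: "a < m" "b < m" "H a b" and sub: "\<And>i. i \<le> L \<Longrightarrow> pv a b i \<in> set c"
      using cycle_contains_path by blast
    have "a \<in> set c" "b \<in> set c"
      using sub[of 0] sub[of L] by simp_all
    moreover have "a \<in> ?S \<or> b \<in> ?S"
      using I(3) ab by auto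
    ultimately show "set c \<inter> ?S \<noteq> {}"
      by blast
  qed
  moreover have "card ?S \<le> m - N"
    using I by (simp add: card_Diff_subset finite_subset[OF I(1)])
  ultimately show "\<exists>S. even_cycle_transversal {0..<path_graph_size m L} pe S \<and> card S \<le> m - N"
    by blast
qed

end

text \<open>The \<open>N\<close> classes of equal quotient by \<open>D\<close> are cliques, so an
  independent set has at most one element in each. Having \<open>N\<close> elements, it picks
  exactly one from every class.\<close>

lemma independent_iff_assignment:
  fixes H :: "nat \<Rightarrow> nat \<Rightarrow> bool"
  assumes H: "\<And>u v. u div D = v div D \<Longrightarrow> u \<noteq> v \<Longrightarrow> H u v"
  shows "(\<exists>I \<subseteq> {..<N * D}. N \<le> card I \<and> (\<forall>u\<in>I. \<forall>v\<in>I. \<not> H u v)) \<longleftrightarrow>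
    (\<exists>f. (\<forall>a<N. f a < D) \<and> (\<forall>a<N. \<forall>b<N. \<not> H (a * D + f a) (b * D + f b)))"
proof (intro iffI; elim exE conjE)
  fix I
  assume I: "I \<subseteq> {..<N * D}" "N \<le> card I" and ind: "\<forall>u\<in>I. \<forall>v\<in>I. \<not> H u v"
  have inj: "inj_on (\<lambda>u. u div D) I"
    using H ind by (auto simp: inj_on_def)
  have sub: "(\<lambda>u. u div D) ` I \<subseteq> {..<N}"
    using I(1) by (auto simp: less_mult_imp_div_less)
  have "(\<lambda>u. u div D) ` I = {..<N}"
    using card_image[OF inj] I(2) sub by (intro card_subset_eq) (auto intro: antisym dest: card_mono[rotated])
  then have "\<forall>a<N. \<exists>u\<in>I. u div D = a"
    by (metis imageE lessThan_iff)
  then obtain g where g: "\<And>a. a < N \<Longrightarrow> g a \<in> I \<and> g a div D = a"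
    by metis
  have "g a mod D < D" "a * D + g a mod D = g a" if "a < N" for a
  proof -
    have "0 < D"
      using g[OF that] I(1) by (cases D) auto
    then show "g a mod D < D"
      by simp
    show "a * D + g a mod D = g a"
      using g[OF that] div_mult_mod_eq[of "g a" D] by simp
  qed
  then show "\<exists>f. (\<forall>a<N. f a < D) \<and> (\<forall>a<N. \<forall>b<N. \<not> H (a * D + f a) (b * D + f b))"
    using g ind by (intro exI[of _ "\<lambda>a. g a mod D"]) auto
next
  fix f
  assume f: "\<forall>a<N. f a < D" and ind: "\<forall>a<N. \<forall>b<N. \<not> H (a * D + f a) (b * D + f b)"
  let ?g = "\<lambda>a. a * D + f a"
  have div: "?g a div D = a" if "a < N" for a
    using f that digits(1)[of "f a" D a] by blast
  have "inj_on ?g {..<N}"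
  proof (rule inj_onI)
    fix a b
    assume ab: "a \<in> {..<N}" "b \<in> {..<N}" and eq: "?g a = ?g b"
    have "?g a div D = a" "?g b div D = b"
      using div ab by blast+
    then show "a = b"
      unfolding eq by (rule trans[OF sym])
  qed
  then have "card (?g ` {..<N}) = N"
    by (simp add: card_image)
  moreover have "?g ` {..<N} \<subseteq> {..<N * D}"
  proof safe
    fix a
    assume a: "a < N"
    then show "?g a < N * D"
      using f digits(3)[of "f a" D a N] by blast
  qed
  ultimately show "\<exists>I \<subseteq> {..<N * D}. N \<le> card I \<and> (\<forall>u\<in>I. \<forall>v\<in>I. \<not> H u v)"
    using ind by (intro exI[of _ "?g ` {..<N}"]) auto
qed

section \<open>The code of an instance\<close>

text \<open>The power may be exponentially large although the quotient is not, so division is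
  iterated instead.\<close>

lemma computable_div_power [computable_intros]:
  assumes "computable n f" and "computable n g" and "computable n h"
  shows "computable n (\<lambda>x e. f x e div g x e ^ h x e)"
proof -
  have rec: "rec_nat a (\<lambda>_ r. r div b) k = a div b ^ k" for a b k :: nat
    by (induction k) (simp_all add: div_mult2_eq[symmetric] mult.commute)
  show ?thesis
  proof (rule computable_cong)
    show "computable n (\<lambda>x e. rec_nat (f x e) (\<lambda>i r. r div g x e) (h x e))"
    proof (rule computable_rec[where H = "\<lambda>x e i r. r div g x e"])
      show "poly_bounded n f"
        by (rule computableD) fact
      show "rec_nat (f x e) (\<lambda>i r. r div g x e) i \<le> f x e" for x e i
        by (simp add: rec)
    qed (intro assms computable_intros computable_shift2; simp)+
  qed (simp add: rec)
qed

lemma computable_if_bool [computable_intros]: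
  assumes "computable n (\<lambda>x e. of_bool (P x e))" and "computable n (\<lambda>x e. of_bool (Q x e))"
    and "computable n (\<lambda>x e. of_bool (R x e))"
  shows "computable n (\<lambda>x e. of_bool (if P x e then Q x e else R x e))"
  by (rule computable_cong[of n "\<lambda>x e. if P x e then of_bool (Q x e) else of_bool (R x e)"],
      intro computable_intros assms) auto

section \<open>Binary numerals\<close>

fun bits_value :: "bool list \<Rightarrow> nat" where
  "bits_value [] = 0"
| "bits_value (b # bs) = of_bool b + 2 * bits_value bs"

lemma bits_value_binary: "bits_value (binary k) = k"
proof (induction k rule: binary.induct)
  case (1 k)
  then show ?case
    by (subst binary.simps) auto
qed

lemma binary_eq_Nil_iff [simp]: "binary k = [] \<longleftrightarrow> k = 0"
  by (subst binary.simps) simp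

lemma last_binary: "binary k \<noteq> [] \<Longrightarrow> last (binary k)"
proof (induction k rule: binary.induct)
  case (1 k)
  have "k = 1" if "k \<noteq> 0" "k div 2 = 0"
    using that by presburger
  with 1 show ?case
    by (subst binary.simps) auto
qed

text \<open>The least significant bit comes first, so \<open>last bs\<close> excludes leading
  zeros.\<close>

lemma binary_bits_value: "bs = [] \<or> last bs \<Longrightarrow> binary (bits_value bs) = bs"
proof (induction bs)
  case (Cons b bs)
  have "bits_value (b # bs) \<noteq> 0"
    using Cons.prems
  proof (induction bs arbitrary: b)
    case (Cons b' bs)
    then show ?case
      by (cases bs) auto
  qed auto
  moreover have "binary (bits_value bs) = bs"
    using Cons by (cases bs) auto
  moreover have "odd (bits_value (b # bs)) = b" "bits_value (b # bs) div 2 = bits_value bs"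
    by auto
  ultimately show ?case
    by (subst binary.simps) (simp only: if_False)
qed simp

lemma less_length_binary_iff: "i < length (binary k) \<longleftrightarrow> 0 < k div 2 ^ i"
proof (induction k arbitrary: i rule: binary.induct)
  case (1 k)
  show ?case
  proof (cases "k = 0")
    case False
    then have "binary k = odd k # binary (k div 2)"
      by (subst binary.simps) simp
    then show ?thesis
      using 1[OF False] False by (cases i) (simp_all add: div_mult2_eq)
  qed (simp add: binary.simps)
qed

lemma nth_binary: "i < length (binary k) \<Longrightarrow> binary k ! i = odd (k div 2 ^ i)"
proof (induction k arbitrary: i rule: binary.induct)
  case (1 k)
  then have k: "k \<noteq> 0"
    by (metis binary_eq_Nil_iff list.size(3) not_less_zero)
  then have "binary k = odd k # binary (k div 2)"
    by (subst binary.simps) simp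
  then show ?case
    using 1 k by (cases i) (simp_all add: div_mult2_eq)
qed

text \<open>In the form of a bounded sum, the length falls under the closure rules.\<close>

lemma length_binary: "length (binary k) = (\<Sum>i<k. of_bool (0 < k div 2 ^ i))"
proof -
  have "length (binary k) \<le> k"
  proof (rule ccontr)
    assume "\<not> length (binary k) \<le> k"
    then have "0 < k div 2 ^ k"
      using less_length_binary_iff[of k k] by simp
    then show False
      by simp
  qed
  then show ?thesis
    using sum_of_bool_less[of "length (binary k)" k] by (simp add: less_length_binary_iff min_absorb2)
qed

section \<open>Positions in the code of an instance\<close>

lemma concat_map_upt:
  "concat (map (\<lambda>u. map (g u) [0..<n]) [0..<m]) = map (\<lambda>i. g (i div n) (i mod n)) [0..<m * n]"
proof (cases "n = 0")
  case False
  show ?thesis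
  proof (induction m)
    case (Suc m)
    have "map (\<lambda>i. g (i div n) (i mod n)) [m * n..<m * n + n] = map (g m) [0..<n]"
      by (rule nth_equalityI) (auto simp: digits)
    then show ?case
      using Suc.IH upt_add_eq_append[of 0 "m * n" n] by (simp add: add.commute)
  qed simp
qed simp

definition matrix_code :: "nat \<Rightarrow> nat set set \<Rightarrow> bool list" where
  "matrix_code n E = map (\<lambda>i. {i div n, i mod n} \<in> E) [0..<n * n]"

lemma encode_instance_eq:
  "encode_instance n E k = replicate n True @ False # matrix_code n E @ binary k"
  using concat_map_upt[of "\<lambda>u v. {u, v} \<in> E" n n] by (simp add: encode_instance_def matrix_code_def)

lemma length_matrix_code [simp]: "length (matrix_code n E) = n * n"
  by (simp add: matrix_code_def)

lemma nth_matrix_code: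
  assumes "u < n" and "v < n"
  shows "matrix_code n E ! (u * n + v) \<longleftrightarrow> {u, v} \<in> E"
  using digits(1,2)[OF assms(2), of u] digits(3)[OF assms(2,1)] by (simp add: matrix_code_def)

lemma length_encode_instance:
  "length (encode_instance n E k) = n + 1 + n * n + length (binary k)"
  by (simp add: encode_instance_eq)

lemma nth_encode_instance:
  shows "i < n \<Longrightarrow> encode_instance n E k ! i" and "\<not> encode_instance n E k ! n"
    and "j < n * n \<Longrightarrow> encode_instance n E k ! Suc (n + j) \<longleftrightarrow> {j div n, j mod n} \<in> E"
    and "j < length (binary k) \<Longrightarrow> encode_instance n E k ! Suc (n + n * n + j) = binary k ! j"
  by (simp_all add: encode_instance_eq nth_append matrix_code_def)

lemma four_part_index:
  fixes i :: nat
  assumes "i < n + 1 + q + r"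
  obtains "i < n" | "i = n" | j where "i = Suc (n + j)" "j < q"
    | j where "i = Suc (n + q + j)" "j < r"
proof -
  have "\<exists>j. i = Suc (n + j) \<and> j < q" if "n < i" "i < n + 1 + q"
    using that by (intro exI[of _ "i - (n + 1)"]) auto
  moreover have "\<exists>j. i = Suc (n + q + j) \<and> j < r" if "n + 1 + q \<le> i"
    using that assms by (intro exI[of _ "i - (n + 1 + q)"]) auto
  ultimately show thesis
    using that by (metis not_less linorder_neqE_nat)
qed

lemma replicate_True_inject:
  "replicate n True @ False # a = replicate m True @ False # b \<Longrightarrow> n = m \<and> a = b"
proof (induction n arbitrary: m)
  case 0
  then show ?case
    by (cases m) auto
next
  case (Suc n)
  then show ?case
    by (cases m) auto
qed

lemma simple_graph_eqI:
  fixes E E' :: "nat set set"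
  assumes "simple_graph {0..<n} E" and "simple_graph {0..<n} E'"
    and "\<And>u v. u < n \<Longrightarrow> v < n \<Longrightarrow> {u, v} \<in> E \<longleftrightarrow> {u, v} \<in> E'"
  shows "E = E'"
proof -
  have "F \<subseteq> F'" if "simple_graph {0..<n} F" "\<And>u v. u < n \<Longrightarrow> v < n \<Longrightarrow> {u, v} \<in> F \<longleftrightarrow> {u, v} \<in> F'"
    for F F' :: "nat set set"
    using that unfolding simple_graph_def by (metis atLeastLessThan_iff subsetI)
  from this[of E E'] this[of E' E] show ?thesis
    using assms by blast
qed

text \<open>\<open>ECT_girth\<close> only says that some instance has the given code. The code shows
  edges inside \<open>{0..<n}\<close> alone, so uniqueness of that instance rests on simplicity of
  both graphs.\<close>

lemma encode_instance_inject:
  assumes "encode_instance n E k = encode_instance n' E' k'"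
    and "simple_graph {0..<n} E" and "simple_graph {0..<n'} E'"
  shows "n' = n \<and> E' = E \<and> k' = k"
proof -
  have n: "n' = n" and eq: "matrix_code n E @ binary k = matrix_code n' E' @ binary k'"
    using assms(1) replicate_True_inject unfolding encode_instance_eq by blast+
  then have m: "matrix_code n E = matrix_code n E'" and b: "binary k = binary k'"
    by (simp_all add: append_eq_append_conv)
  have "E = E'"
    using assms(2,3) unfolding n
    by (rule simple_graph_eqI) (metis m nth_matrix_code)
  moreover have "k = k'"
    using b bits_value_binary by metis
  ultimately show ?thesis
    using n by simp
qed

lemma encode_instance_in_ECT_girth_iff:
  assumes "simple_graph {0..<n} E" and "enat p \<le> girth E"
  shows "encode_instance n E k \<in> ECT_girth p \<longleftrightarrow>
    (\<exists>S. even_cycle_transversal {0..<n} E S \<and> card S \<le> k)"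
proof
  assume "encode_instance n E k \<in> ECT_girth p"
  then obtain n' E' k' where "encode_instance n E k = encode_instance n' E' k'"
    and "simple_graph {0..<n'} E'" and "\<exists>S. even_cycle_transversal {0..<n'} E' S \<and> card S \<le> k'"
    unfolding ECT_girth_def by blast
  with encode_instance_inject[of n E k n' E' k'] assms(1)
  show "\<exists>S. even_cycle_transversal {0..<n} E S \<and> card S \<le> k"
    by blast
qed (use assms in \<open>unfold ECT_girth_def, blast\<close>)

lemma polytime_computable_encode_instance:
  assumes n: "computable 0 (\<lambda>x e. n x)" and k: "computable 0 (\<lambda>x e. k x)"
    and E: "computable 2 (\<lambda>x e. of_bool ({e 0, e 1} \<in> E x))"
  shows "polytime_computable (\<lambda>x. encode_instance (n x) (E x) (k x))"
proof -
  define B where "B x i \<longleftrightarrow> i < n x \<or> n x < i \<and>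
    (if i < n x + 1 + n x * n x then {(i - (n x + 1)) div n x, (i - (n x + 1)) mod n x} \<in> E x
     else odd (k x div 2 ^ (i - (n x + 1 + n x * n x))))" for x i
  define l where "l x = n x + 1 + n x * n x + length (binary (k x))" for x
  have "encode_instance (n x) (E x) (k x) = map (B x) [0..<l x]" for x
  proof (rule nth_equalityI)
    fix i
    assume "i < length (encode_instance (n x) (E x) (k x))"
    then have i: "i < l x"
      by (simp add: encode_instance_eq l_def)
    then have "i < n x + 1 + n x * n x + length (binary (k x))"
      by (simp add: l_def)
    then show "encode_instance (n x) (E x) (k x) ! i = map (B x) [0..<l x] ! i"
      by (cases rule: four_part_index)
        (use i in \<open>simp_all add: nth_encode_instance B_def nth_binary\<close>)
  qed (simp add: encode_instance_eq l_def)
  moreover have "polytime_computable (\<lambda>x. map (B x) [0..<l x])"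
  proof (rule polytime_computable_map)
    have n': "computable m (\<lambda>x e. n x)" and k': "computable m (\<lambda>x e. k x)" for m
      using computable_rename[OF n, of id m] computable_rename[OF k, of id m] by simp_all
    show "computable 0 (\<lambda>x e. l x)"
      unfolding l_def length_binary by (intro computable_intros n' k') simp
    have E': "computable m (\<lambda>x e. of_bool ({f x e, g x e} \<in> E x))"
      if "computable m f" "computable m g" for m f g
      using computable_subst2[of "\<lambda>x a b. of_bool ({a, b} \<in> E x)", OF E] that by blast
    show "computable 1 (\<lambda>x e. of_bool (B x (e 0)))"
      unfolding B_def by (intro computable_intros n' k' E') simp_all
  qed
  ultimately show ?thesis
    by simp
qed

section \<open>NP-hardness\<close>

lemma poly_mono_nat: "m \<le> n \<Longrightarrow> poly p m \<le> poly p (n :: nat)"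
  by (induction p) (auto intro: add_mono mult_mono)

text \<open>A halted configuration is a fixed point of \<open>step\<close>; hence one time
  \<open>T\<close> can serve for all certificates.\<close>

lemma halts_with_mono:
  assumes "halts_with M x y t" and "t \<le> t'"
  shows "halts_with M x y t'"
proof -
  obtain q ts where c: "(step M ^^ t) (init M x) = (q, ts)"
    by fastforce
  then have q: "q = halt M"
    using assms(1) by (simp add: halts_with_def)
  have "(step M ^^ d) (q, ts) = (q, ts)" for d
    by (induction d) (simp_all add: q)
  from funpow_add_apply[OF c this, of "t' - t"] have "(step M ^^ t') (init M x) = (q, ts)"
    using assms(2) by simp
  then show ?thesis
    using assms(1) by (simp add: halts_with_def c)
qed

text \<open>Vertex \<open>u\<close> of the conflict graph assigns the value \<open>vals (u mod D)\<close> to the tableau cell of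
  number \<open>u div D\<close>.\<close>

definition cell_time :: "nat \<Rightarrow> nat \<Rightarrow> nat \<Rightarrow> nat" where
  "cell_time k T a = a div (2 * T + 1) div k"

definition cell_tape :: "nat \<Rightarrow> nat \<Rightarrow> nat \<Rightarrow> nat" where
  "cell_tape k T a = a div (2 * T + 1) mod k"

definition cell_pos :: "nat \<Rightarrow> nat \<Rightarrow> nat" where
  "cell_pos T a = a mod (2 * T + 1)"

definition cell_number :: "nat \<Rightarrow> nat \<Rightarrow> nat \<Rightarrow> nat \<Rightarrow> nat \<Rightarrow> nat" where
  "cell_number k T t j i = (t * k + j) * (2 * T + 1) + i"

lemma cell_number:
  assumes "i \<le> 2 * T" and "j < k"
  shows "cell_time k T (cell_number k T t j i) = t" and "cell_tape k T (cell_number k T t j i) = j"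
    and "cell_pos T (cell_number k T t j i) = i"
    and "t \<le> T \<Longrightarrow> cell_number k T t j i < (T + 1) * k * (2 * T + 1)"
proof -
  have i: "i < 2 * T + 1"
    using assms by simp
  show "cell_time k T (cell_number k T t j i) = t" "cell_tape k T (cell_number k T t j i) = j"
    "cell_pos T (cell_number k T t j i) = i"
    unfolding cell_time_def cell_tape_def cell_pos_def cell_number_def
    by (simp_all only: digits[OF i] digits[OF assms(2)])
  show "cell_number k T t j i < (T + 1) * k * (2 * T + 1)" if "t \<le> T"
    unfolding cell_number_def using that by (intro digits(3) i assms) simp
qed

lemma cell_bounds:
  assumes "a < (T + 1) * k * (2 * T + 1)"
  shows "cell_time k T a \<le> T" and "cell_tape k T a < k" and "cell_pos T a \<le> 2 * T"
    and "cell_number k T (cell_time k T a) (cell_tape k T a) (cell_pos T a) = a"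
proof -
  have "a div (2 * T + 1) < (T + 1) * k"
    using assms by (simp only: less_mult_imp_div_less)
  then have "a div (2 * T + 1) div k < T + 1" and "0 < k"
    by (simp only: less_mult_imp_div_less) (use assms in \<open>cases k; simp\<close>)
  then show "cell_time k T a \<le> T" "cell_tape k T a < k"
    by (simp_all add: cell_time_def cell_tape_def)
  have "a mod (2 * T + 1) < 2 * T + 1"
    by (rule mod_less_divisor) simp
  then show "cell_pos T a \<le> 2 * T"
    by (simp add: cell_pos_def)
  show "cell_number k T (cell_time k T a) (cell_tape k T a) (cell_pos T a) = a"
    unfolding cell_number_def cell_time_def cell_tape_def cell_pos_def div_mult_mod_eq ..
qed

text \<open>Testing \<open>bin\<close> both ways makes the relation symmetric. For
  \<open>u = v\<close> a violated constraint is a loop, which bars \<open>u\<close> from every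
  independent set.\<close>

definition conflict ::
  "turing_machine \<Rightarrow> (nat \<Rightarrow> cell) \<Rightarrow> nat \<Rightarrow> bool list \<Rightarrow> nat \<Rightarrow> nat \<Rightarrow> nat \<Rightarrow> nat \<Rightarrow> bool" where
  "conflict M vals D x B T u v \<longleftrightarrow>
     (let k = tape_count M; a = u div D; b = v div D;
          un = (\<lambda>u a. unary_ok M x B T (cell_time k T a) (cell_tape k T a) (cell_pos T a) (vals (u mod D)));
          bin = (\<lambda>u a v b. binary_ok M x T
             (cell_time k T a) (cell_tape k T a) (cell_pos T a) (vals (u mod D))
             (cell_time k T b) (cell_tape k T b) (cell_pos T b) (vals (v mod D)))
      in a = b \<and> u \<noteq> v \<or> \<not> un u a \<or> \<not> un v b \<or> \<not> bin u a v b \<or> \<not> bin v b u a)"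

lemma conflict_sym: "conflict M vals D x B T u v \<Longrightarrow> conflict M vals D x B T v u"
  unfolding conflict_def Let_def by auto

lemma conflict_same_cell: "u div D = v div D \<Longrightarrow> u \<noteq> v \<Longrightarrow> conflict M vals D x B T u v"
  unfolding conflict_def Let_def by auto

lemma tableau_iff_assignment:
  assumes vals: "bij_betw vals {..<D} (cells M)"
  shows "(\<exists>\<sigma>. tableau M x B T \<sigma>) \<longleftrightarrow>
    (\<exists>f. (\<forall>a < (T + 1) * tape_count M * (2 * T + 1). f a < D) \<and>
      (\<forall>a < (T + 1) * tape_count M * (2 * T + 1). \<forall>b < (T + 1) * tape_count M * (2 * T + 1).
        \<not> conflict M vals D x B T (a * D + f a) (b * D + f b)))"
    (is "_ \<longleftrightarrow> (\<exists>f. ?in f \<and> ?ok f)")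
proof
  let ?k = "tape_count M"
  let ?N = "(T + 1) * tape_count M * (2 * T + 1)"
  assume "\<exists>\<sigma>. tableau M x B T \<sigma>"
  then obtain \<sigma> where \<sigma>: "tableau M x B T \<sigma>"
    by blast
  let ?s = "\<lambda>a. \<sigma> (cell_time ?k T a) (cell_tape ?k T a) (cell_pos T a)"
  note \<sigma>' = \<sigma>[unfolded tableau_def, rule_format]
  have s: "?s a \<in> cells M"
    and un: "unary_ok M x B T (cell_time ?k T a) (cell_tape ?k T a) (cell_pos T a) (?s a)"
    if "a < ?N" for a
    using \<sigma>'[OF cell_bounds(1-3)[OF that]] by simp_all
  have bin: "binary_ok M x T (cell_time ?k T a) (cell_tape ?k T a) (cell_pos T a) (?s a)
      (cell_time ?k T b) (cell_tape ?k T b) (cell_pos T b) (?s b)" if "a < ?N" "b < ?N" for a b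
    using \<sigma>'[OF cell_bounds(1-3)[OF that(1)]] cell_bounds(1-3)[OF that(2)] by simp
  have "\<forall>a. \<exists>d. a < ?N \<longrightarrow> d < D \<and> vals d = ?s a"
    using s vals by (metis bij_betw_def imageE lessThan_iff)
  then obtain f where f: "\<And>a. a < ?N \<Longrightarrow> f a < D \<and> vals (f a) = ?s a"
    by metis
  have "\<not> conflict M vals D x B T (a * D + f a) (b * D + f b)" if "a < ?N" "b < ?N" for a b
    using f[OF that(1)] f[OF that(2)] un[OF that(1)] un[OF that(2)] bin[OF that] bin[OF that(2,1)]
    by (auto simp: conflict_def Let_def digits)
  then show "\<exists>f. ?in f \<and> ?ok f"
    using f by blast
next
  let ?k = "tape_count M"
  let ?N = "(T + 1) * tape_count M * (2 * T + 1)"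
  assume "\<exists>f. ?in f \<and> ?ok f"
  then obtain f where f: "?in f" and ok: "?ok f"
    by blast
  let ?n = "cell_number ?k T"
  have "tableau M x B T (\<lambda>t j i. vals (f (?n t j i)))"
    unfolding tableau_def
  proof (intro allI impI conjI)
    fix t j i
    assume t: "t \<le> T" "j < tape_count M" "i \<le> 2 * T"
    let ?a = "?n t j i"
    have a: "?a < ?N" "cell_time ?k T ?a = t" "cell_tape ?k T ?a = j" "cell_pos T ?a = i"
      using cell_number[of i T j ?k t] t by simp_all
    have fa: "f ?a < D"
      using f a(1) by blast
    show "vals (f ?a) \<in> cells M"
      using vals fa by (auto simp: bij_betw_def)
    have "\<not> conflict M vals D x B T (?a * D + f ?a) (?a * D + f ?a)"
      using ok a(1) by blast
    then show "unary_ok M x B T t j i (vals (f ?a))"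
      using a(2-4) by (simp add: conflict_def Let_def digits[OF fa] mod_less[OF fa])
    fix t' j' i'
    assume t': "t' \<le> T" "j' < tape_count M" "i' \<le> 2 * T"
    let ?b = "?n t' j' i'"
    have b: "?b < ?N" "cell_time ?k T ?b = t'" "cell_tape ?k T ?b = j'" "cell_pos T ?b = i'"
      using cell_number[of i' T j' ?k t'] t' by simp_all
    have fb: "f ?b < D"
      using f b(1) by blast
    have "\<not> conflict M vals D x B T (?a * D + f ?a) (?b * D + f ?b)"
      using ok a(1) b(1) by blast
    then show "binary_ok M x T t j i (vals (f ?a)) t' j' i' (vals (f ?b))"
      using a(2-4) b(2-4) by (simp add: conflict_def Let_def digits[OF fa] mod_less[OF fa] digits[OF fb] mod_less[OF fb])
  qed
  then show "\<exists>\<sigma>. tableau M x B T \<sigma>"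
    by blast
qed

section \<open>Computability of the conflict relation\<close>

context
  fixes M :: turing_machine and vals :: "nat \<Rightarrow> cell" and D :: nat
  assumes k: "0 < tape_count M" and D: "0 < D"
begin

text \<open>The machine is fixed, so whatever depends on the contents of cells alone is a finite
  table.\<close>

lemma computable_cell_tables:
  assumes f: "computable n f"
  shows "computable n (\<lambda>x e. fst (vals (f x e mod D)))"
    and "computable n (\<lambda>x e. of_bool (snd (vals (f x e mod D)) = None))"
    and "computable n (\<lambda>x e. of_bool (starting M (vals (f x e mod D))))"
  using computable_table[OF f D, of "\<lambda>d. fst (vals d)"]
    computable_table[OF f D, of "\<lambda>d. of_bool (snd (vals d) = None)"]
    computable_table[OF f D, of "\<lambda>d. of_bool (starting M (vals d))"]
  by simp_all

lemma computable_cell_tables2: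
  assumes f: "computable n f" and g: "computable n g"
  shows "computable n (\<lambda>x e. of_bool (agree (vals (f x e mod D)) (vals (g x e mod D))))"
    and "computable n (\<lambda>x e. of_bool (succeeds M (vals (f x e mod D)) (vals (g x e mod D))))"
    and "computable n (\<lambda>x e. of_bool (consistent (f x e mod tape_count M) (vals (g x e mod D))))"
    and "computable n (\<lambda>x e. written M (f x e mod tape_count M) (vals (g x e mod D)))"
    and "computable n (\<lambda>x e. head_offset M (f x e mod tape_count M) (vals (g x e mod D)))"
  using computable_table2[OF f D g D, of "\<lambda>d d'. of_bool (agree (vals d) (vals d'))"]
    computable_table2[OF f D g D, of "\<lambda>d d'. of_bool (succeeds M (vals d) (vals d'))"]
    computable_table2[OF f k g D, of "\<lambda>j d. of_bool (consistent j (vals d))"]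
    computable_table2[OF f k g D, of "\<lambda>j d. written M j (vals d)"]
    computable_table2[OF f k g D, of "\<lambda>j d. head_offset M j (vals d)"]
  by simp_all

lemma computable_conflict:
  assumes B: "\<And>n. computable n (\<lambda>x e. B x)" and T: "\<And>n. computable n (\<lambda>x e. T x)"
  shows "computable 2 (\<lambda>x e. of_bool (conflict M vals D x (B x) (T x) (e 0) (e 1)))"
  \<comment> \<open>Unfolding exposes the remainders modulo \<open>D\<close> and
    \<open>tape_count M\<close>, the shape in which tables are looked up.\<close>
  unfolding conflict_def Let_def unary_ok_def binary_ok_def input_ok_def
    cell_time_def cell_tape_def cell_pos_def
  by (intro computable_cell_tables computable_cell_tables2 computable_intros B T; simp)

end

lemma computable_path_vertex [computable_intros]:
  assumes "computable n m" and "computable n a" and "computable n b" and "computable n c"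
  shows "computable n (\<lambda>x e. path_vertex (m x e) L (a x e) (b x e) (c x e))"
  unfolding path_vertex_def by (intro computable_intros assms)

lemma edge_in_path_edges_iff:
  "{u, v} \<in> path_edges m L H \<longleftrightarrow> (\<exists>a<m. \<exists>b<m. \<exists>c<L. H a b \<and>
     (u = path_vertex m L a b c \<and> v = path_vertex m L a b (Suc c) \<or>
      u = path_vertex m L a b (Suc c) \<and> v = path_vertex m L a b c))"
  unfolding path_edges_def by (auto simp: doubleton_eq_iff)

theorem ECT_girth_hard: "NP_hard (ECT_girth p)"
  unfolding NP_hard_def
proof
  fix A
  assume "A \<in> NP"
  then obtain R bw where "polytime_decidable R"
    and A: "\<And>x. x \<in> A \<longleftrightarrow> (\<exists>w. length w \<le> poly bw (length x) \<and> pair_code x w \<in> R)"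
    unfolding NP_def by blast
  then obtain M bM where wf: "wf_tm M"
    and run: "\<And>z. \<exists>t \<le> poly bM (length z). halts_with M z [z \<in> R] t"
    unfolding polytime_decidable_def polytime_computable_def by blast
  define B where "B x = poly bw (length x)" for x :: "bool list"
  define l where "l x = 2 * length x + 2 + B x" for x
  \<comment> \<open>Large enough for the running time on all words of length at most
    \<open>l x\<close>, and for such a word to fit into the right half of the window.\<close>
  define T where "T x = l x + poly bM (l x)" for x
  define k where "k = tape_count M"
  define D where "D = card (cells M)"
  define N where "N x = (T x + 1) * k * (2 * T x + 1)" for x
  define m where "m x = N x * D" for x
  \<comment> \<open>Even, at least 4 and at least \<open>p\<close>.\<close>
  define L where "L = 2 * p + 4"
  obtain vals where vals: "bij_betw vals {..<D} (cells M)"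
    using ex_bij_betw_nat_finite[OF finite_cells[OF wf]] by (auto simp: D_def lessThan_atLeast0)
  define H where "H x = conflict M vals D x (B x) (T x)" for x
  define E where "E x = path_edges (m x) L (H x)" for x
  have L: "4 \<le> L" "even L" "p \<le> L"
    by (simp_all add: L_def)
  have k: "0 < k"
    using wf by (simp add: k_def wf_tm_def)
  have "(start M, None) \<in> symbols M \<times> {None} \<or> (0, None) \<in> cells M"
    using wf by (simp add: cells_def wf_tm_def)
  then have D: "0 < D"
    using finite_cells[OF wf] wf by (auto simp: D_def card_gt_0_iff cells_def wf_tm_def)
  have sym: "H x b a" if "H x a b" for x a b
    using that conflict_sym unfolding H_def by blast
  have accepts: "pair_code x w \<in> R \<longleftrightarrow> fst (last (snd (config_at M (pair_code x w) (T x)))) 0 = 2"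
    if w: "length w \<le> B x" for x w
  proof -
    let ?z = "pair_code x w"
    obtain t where t: "t \<le> poly bM (length ?z)" "halts_with M ?z [?z \<in> R] t"
      using run by blast
    have "poly bM (length ?z) \<le> T x"
      using poly_mono_nat[of "length ?z" "l x" bM] w by (simp add: T_def l_def)
    then have "halts_with M ?z [?z \<in> R] (T x)"
      using halts_with_mono[OF t(2)] t(1) by simp
    then show ?thesis
      by (auto simp: halts_with_def holds_word_def config_at_def bit_symbol_eq split: prod.splits)
  qed
  \<comment> \<open>An independent set with one vertex for each of the \<open>N x\<close> cells
    leaves \<open>m x - N x\<close> vertices, which is the budget.\<close>
  have "x \<in> A \<longleftrightarrow> encode_instance (path_graph_size (m x) L) (E x) (m x - N x) \<in> ECT_girth p" for x
  proof -
    have "2 * length x + 2 + B x \<le> T x"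
      by (simp add: T_def l_def)
    note tab = tableau_of_run[OF wf this] run_of_tableau[OF wf this]
    have "x \<in> A \<longleftrightarrow> (\<exists>w. length w \<le> B x \<and> pair_code x w \<in> R)"
      using A[of x] by (simp add: B_def)
    also have "\<dots> \<longleftrightarrow> (\<exists>w. length w \<le> B x \<and> fst (last (snd (config_at M (pair_code x w) (T x)))) 0 = 2)"
      using accepts by blast
    also have "\<dots> \<longleftrightarrow> (\<exists>\<sigma>. tableau M x (B x) (T x) \<sigma>)"
      using tab by blast
    also have "\<dots> \<longleftrightarrow> (\<exists>f. (\<forall>a<N x. f a < D) \<and> (\<forall>a<N x. \<forall>b<N x. \<not> H x (a * D + f a) (b * D + f b)))"
      unfolding tableau_iff_assignment[OF vals] N_def k_def H_def ..
    also have "\<dots> \<longleftrightarrow> (\<exists>I \<subseteq> {..<m x}. N x \<le> card I \<and> (\<forall>u\<in>I. \<forall>v\<in>I. \<not> H x u v))"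
      unfolding m_def
      by (rule independent_iff_assignment[symmetric]) (simp add: H_def conflict_same_cell)
    also have "\<dots> \<longleftrightarrow> (\<exists>S. even_cycle_transversal {0..<path_graph_size (m x) L} (E x) S \<and>
        card S \<le> m x - N x)"
      unfolding E_def using D
      by (intro transversal_iff_independent[OF L(1,2), symmetric]) (auto simp: m_def intro: sym)
    also have "\<dots> \<longleftrightarrow> encode_instance (path_graph_size (m x) L) (E x) (m x - N x) \<in> ECT_girth p"
    proof (rule encode_instance_in_ECT_girth_iff[symmetric])
      show "simple_graph {0..<path_graph_size (m x) L} (E x)"
        unfolding E_def by (rule simple_path_graph[OF L(1,2) sym])
      have "enat p \<le> enat L"
        using L(3) by simp
      also have "\<dots> \<le> girth (E x)"
        unfolding E_def by (rule girth_path_graph[OF L(1,2) sym])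
      finally show "enat p \<le> girth (E x)" .
    qed
    finally show ?thesis .
  qed
  moreover have "polytime_computable (\<lambda>x. encode_instance (path_graph_size (m x) L) (E x) (m x - N x))"
  proof (rule polytime_computable_encode_instance)
    have B: "computable n (\<lambda>x e. B x)" for n
      unfolding B_def by (intro computable_intros)
    have T: "computable n (\<lambda>x e. T x)" for n
      unfolding T_def l_def by (intro computable_intros B)
    have N: "computable n (\<lambda>x e. N x)" for n
      unfolding N_def by (intro computable_intros T)
    have m: "computable n (\<lambda>x e. m x)" for n
      unfolding m_def by (intro computable_intros N)
    show "computable 0 (\<lambda>x e. path_graph_size (m x) L)"
      unfolding path_graph_size_def by (intro computable_intros m)
    show "computable 0 (\<lambda>x e. m x - N x)"
      by (intro computable_intros m N)
    have "computable 2 (\<lambda>x e. of_bool (H x (e 0) (e 1)))"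
      unfolding H_def using computable_conflict[OF _ D B T] k by (simp add: k_def)
    then have H: "computable n (\<lambda>x e. of_bool (H x (f x e) (g x e)))"
      if "computable n f" "computable n g" for n f g
      using computable_subst2[of "\<lambda>x a b. of_bool (H x a b)"] that by blast
    show "computable 2 (\<lambda>x e. of_bool ({e 0, e 1} \<in> E x))"
      unfolding E_def edge_in_path_edges_iff by (intro H m computable_intros; simp)
  qed
  ultimately show "polytime_reducible A (ECT_girth p)"
    unfolding polytime_reducible_def by blast
qed

section \<open>Graphs without even cycles\<close>

definition avoiding :: "'a set set \<Rightarrow> 'a \<Rightarrow> ('a \<times> 'a) set" where
  "avoiding F u = {(a, b). {a, b} \<in> F \<and> a \<noteq> u \<and> b \<noteq> u}"

abbreviation chain :: "'a set set \<Rightarrow> 'a list \<Rightarrow> bool" where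
  "chain F \<equiv> successively (\<lambda>a b. {a, b} \<in> F)"

lemma chain_rev [simp]: "chain F (rev xs) = chain F xs"
  by (simp add: insert_commute)

text \<open>The path is kept simple while it grows: on meeting a vertex again, it is cut back to
  that vertex.\<close>

lemma simple_path_avoiding:
  assumes "(a, b) \<in> (avoiding F u)\<^sup>*" and "a \<noteq> u"
  shows "\<exists>xs. xs \<noteq> [] \<and> hd xs = a \<and> last xs = b \<and> chain F xs \<and> distinct xs \<and> u \<notin> set xs"
  using assms(1)
proof (induction rule: rtrancl_induct)
  case base
  then show ?case
    using assms(2) by (intro exI[of _ "[a]"]) simp
next
  case (step b c)
  then obtain xs where xs: "xs \<noteq> []" "hd xs = a" "last xs = b" "chain F xs" "distinct xs" "u \<notin> set xs"
    by blast
  have bc: "{b, c} \<in> F" "c \<noteq> u"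
    using step by (auto simp: avoiding_def)
  show ?case
  proof (cases "c \<in> set xs")
    case True
    then obtain ys zs where yz: "xs = ys @ c # zs"
      by (meson split_list)
    then have "hd (ys @ [c]) = a"
      using xs(2) by (cases ys) auto
    then show ?thesis
      using xs yz by (intro exI[of _ "ys @ [c]"]) (auto simp: successively_append_iff)
  next
    case False
    then show ?thesis
      using xs bc by (intro exI[of _ "xs @ [c]"]) (auto simp: successively_append_iff)
  qed
qed

lemma is_cycle_of_chain:
  assumes "chain F (u # xs)" and "{last xs, u} \<in> F" and "distinct (u # xs)" and "2 \<le> length xs"
  shows "is_cycle F (u # xs)"
  unfolding is_cycle_def
proof (intro conjI allI impI)
  fix i
  assume i: "i < length (u # xs)"
  show "{(u # xs) ! i, (u # xs) ! (Suc i mod length (u # xs))} \<in> F"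
  proof (cases "Suc i < length (u # xs)")
    case True
    then show ?thesis
      using successively_nth[OF assms(1), of i] by simp
  next
    case False
    then have "Suc i = length (u # xs)"
      using i by simp
    moreover have "(u # xs) ! i = last xs"
      using calculation assms(4) by (cases xs) (auto simp: last_conv_nth nth_Cons')
    ultimately show ?thesis
      using assms(2) by simp
  qed
qed (use assms in auto)

text \<open>The cycle has length \<open>length A + length B + 2\<close>. If both inner parts were
  empty, the two paths would be the same edge.\<close>

lemma even_cycle_of_two_paths:
  assumes "chain F (u # A @ [z])" and "chain F (u # B @ [z])" and "distinct (u # z # A @ B)"
    and "A \<noteq> [] \<or> B \<noteq> []" and "even (length A + length B)"
  shows "\<exists>c. is_cycle F c \<and> even (length c)"
proof -
  have B: "chain F (z # rev B @ [u])"
    using assms(2) chain_rev[of F "u # B @ [z]"] by simp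
  have "chain F (u # A @ z # rev B)"
  proof -
    have "chain F (u # A)" "{last (u # A), z} \<in> F"
      using assms(1) successively_append_iff[of "\<lambda>a b. {a, b} \<in> F" "u # A" "[z]"] by simp_all
    moreover have "chain F (z # rev B)"
      using B successively_append_iff[of "\<lambda>a b. {a, b} \<in> F" "z # rev B" "[u]"] by simp
    ultimately show ?thesis
      using successively_append_iff[of "\<lambda>a b. {a, b} \<in> F" "u # A" "z # rev B"] by simp
  qed
  moreover have "{last (A @ z # rev B), u} \<in> F"
    using B by (cases B) (auto simp: successively_append_iff successively_Cons)
  moreover have "2 \<le> length (A @ z # rev B)"
    using assms(4) by (cases A; cases B) auto
  ultimately have "is_cycle F (u # A @ z # rev B)"
    using assms(3) by (intro is_cycle_of_chain) auto
  then show ?thesis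
    using assms(5) by (intro exI[of _ "u # A @ z # rev B"]) simp
qed

text \<open>Two of three paths with common ends have lengths of the same parity.\<close>

lemma even_cycle_of_theta:
  assumes "chain F (u # A @ [z])" and "chain F (u # B @ [z])" and "chain F (u # C @ [z])"
    and "distinct (u # z # A @ B @ C)"
    and "A \<noteq> [] \<or> B \<noteq> []" and "A \<noteq> [] \<or> C \<noteq> []" and "B \<noteq> [] \<or> C \<noteq> []"
  shows "\<exists>c. is_cycle F c \<and> even (length c)"
proof -
  consider "even (length A + length B)" | "even (length A + length C)" | "even (length B + length C)"
    by auto
  then show ?thesis
  proof cases
    case 1
    then show ?thesis
      using assms by (intro even_cycle_of_two_paths[of F u A z B]) auto
  next
    case 2
    then show ?thesis
      using assms by (intro even_cycle_of_two_paths[of F u A z C]) auto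
  next
    case 3
    then show ?thesis
      using assms by (intro even_cycle_of_two_paths[of F u B z C]) auto
  qed
qed

text \<open>Take a path \<open>P\<close> from \<open>p\<close> to \<open>q\<close> and follow a path
  from \<open>r\<close> towards \<open>p\<close> until it first meets \<open>P\<close>, in
  \<open>z\<close>. Then \<open>z\<close> is joined to \<open>u\<close> by three internally disjoint
  paths, through \<open>p\<close>, \<open>q\<close> and \<open>r\<close>.\<close>

lemma even_cycle_of_three_neighbours:
  assumes u: "{u, p} \<in> F" "{u, q} \<in> F" "{u, r} \<in> F" and ne: "p \<noteq> q" "p \<noteq> r" "q \<noteq> r" "p \<noteq> u"
    and q: "(p, q) \<in> (avoiding F u)\<^sup>*" and r: "(p, r) \<in> (avoiding F u)\<^sup>*"
  shows "\<exists>c. is_cycle F c \<and> even (length c)"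
proof -
  obtain P where P: "P \<noteq> []" "hd P = p" "last P = q" "chain F P" "distinct P" "u \<notin> set P"
    using simple_path_avoiding[OF q ne(4)] by blast
  obtain Q where Q: "Q \<noteq> []" "hd Q = p" "last Q = r" "chain F Q" "distinct Q" "u \<notin> set Q"
    using simple_path_avoiding[OF r ne(4)] by blast
  have "\<exists>x \<in> set (rev Q). x \<in> set P"
    using P(1,2) Q(1,2) by (metis hd_in_set set_rev)
  from split_list_first_prop[OF this]
  obtain Q1 z Q2 where Q': "rev Q = Q1 @ z # Q2" "z \<in> set P" "\<forall>y \<in> set Q1. y \<notin> set P"
    by blast
  obtain P1 P2 where P': "P = P1 @ z # P2"
    using Q'(2) by (meson split_list)
  have chainP: "chain F (P1 @ [z])" "chain F (z # P2)"
    using P(4) unfolding P' by (auto simp: successively_append_iff)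
  have chainQ: "chain F (Q1 @ [z])"
    using Q(4) chain_rev[of F Q] unfolding Q'(1) by (auto simp: successively_append_iff)
  have hdP1: "hd (P1 @ [z]) = p"
    using P(2) unfolding P' by (cases P1) auto
  have hdP2: "hd (rev P2 @ [z]) = q"
    using P(3) unfolding P' by (cases P2 rule: rev_cases) auto
  have "hd (rev Q) = r"
    using Q(1,3) by (simp add: hd_rev)
  then have hdQ1: "hd (Q1 @ [z]) = r"
    unfolding Q'(1) by (cases Q1) auto
  show ?thesis
  proof (rule even_cycle_of_theta)
    show "chain F (u # P1 @ [z])"
      using chainP(1) u(1) hdP1 by (simp add: successively_Cons)
    have "chain F (rev P2 @ [z])"
      using chainP(2) chain_rev[of F "z # P2"] by simp
    then show "chain F (u # rev P2 @ [z])"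
      using u(2) hdP2 by (simp add: successively_Cons)
    show "chain F (u # Q1 @ [z])"
      using chainQ u(3) hdQ1 by (simp add: successively_Cons)
    have "distinct (rev Q)" "u \<notin> set (rev Q)"
      using Q by simp_all
    then show "distinct (u # z # P1 @ rev P2 @ Q1)"
      using P(5,6) Q'(3) unfolding P' Q'(1) by auto
    \<comment> \<open>An empty inner part means that \<open>z\<close> is the neighbour of
      \<open>u\<close> in question, which is possible for only one of three distinct
      neighbours.\<close>
    show "P1 \<noteq> [] \<or> rev P2 \<noteq> []" "P1 \<noteq> [] \<or> Q1 \<noteq> []" "rev P2 \<noteq> [] \<or> Q1 \<noteq> []"
      using hdP1 hdP2 hdQ1 ne by auto
  qed
qed

subsection \<open>A certificate for the absence of even cycles\<close>

text \<open>Let \<open>C u\<close> contain the reachability relation of the graph without \<open>u\<close>. If each neighbour \<open>p\<close> of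
  \<open>u\<close> is related to at most one further neighbour, then a cycle coming from \<open>p\<close> has only one way to
  leave \<open>u\<close>. Thus all cycles are found by walking on from their arcs, and it remains to check the
  parity of the first return.\<close>

definition first_index :: "nat \<Rightarrow> (nat \<Rightarrow> bool) \<Rightarrow> nat" where
  "first_index n P = (\<Sum>i<n. of_bool (\<forall>j\<le>i. \<not> P j))"

text \<open>The summands equal to 1 are those before the first hit. The search is written as a
  bounded sum because sums are computable.\<close>

lemma first_index_eq:
  assumes "P q" and "q < n" and "\<And>i. i < q \<Longrightarrow> \<not> P i"
  shows "first_index n P = q"
proof -
  have "(\<forall>j\<le>i. \<not> P j) = (i < q)" for i
    using assms(1,3) by (meson le_less_trans not_less)
  then show ?thesis
    using assms(2) by (simp only: first_index_def sum_of_bool_less)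
qed

lemma first_index_none: "(\<And>i. i < n \<Longrightarrow> \<not> P i) \<Longrightarrow> first_index n P = n"
  by (simp add: first_index_def)

lemma first_index_le: "first_index n P \<le> n"
proof -
  have "first_index n P \<le> (\<Sum>i<n. 1)"
    unfolding first_index_def by (intro sum_mono) simp
  then show ?thesis
    by simp
qed

text \<open>The value \<open>n\<close>, obtained when there is no turn, is not a vertex: no edge
  contains it, so the walk stays there for good.\<close>

definition next_vertex :: "nat \<Rightarrow> nat set set \<Rightarrow> (nat \<Rightarrow> nat \<Rightarrow> nat \<Rightarrow> bool) \<Rightarrow> nat \<Rightarrow> nat \<Rightarrow> nat" where
  "next_vertex n F C p u = first_index n (\<lambda>q. {u, q} \<in> F \<and> q \<noteq> p \<and> C u p q)"

definition walk_step ::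
  "nat \<Rightarrow> nat set set \<Rightarrow> (nat \<Rightarrow> nat \<Rightarrow> nat \<Rightarrow> bool) \<Rightarrow> nat \<times> nat \<Rightarrow> nat \<times> nat" where
  "walk_step n F C = (\<lambda>(p, u). (u, next_vertex n F C p u))"

text \<open>Closure makes \<open>C u\<close> contain reachability without \<open>u\<close>, and
  soundness asks for no more than this.\<close>

definition reach_closed :: "nat \<Rightarrow> nat set set \<Rightarrow> (nat \<Rightarrow> nat \<Rightarrow> nat \<Rightarrow> bool) \<Rightarrow> bool" where
  "reach_closed n F C \<longleftrightarrow>
     (\<forall>u<n. \<forall>a<n. C u a a \<and>
        (\<forall>b<n. \<forall>c<n. C u a b \<and> {b, c} \<in> F \<and> b \<noteq> u \<and> c \<noteq> u \<longrightarrow> C u a c))"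

definition unique_turns :: "nat \<Rightarrow> nat set set \<Rightarrow> (nat \<Rightarrow> nat \<Rightarrow> nat \<Rightarrow> bool) \<Rightarrow> bool" where
  "unique_turns n F C \<longleftrightarrow>
     (\<forall>u<n. \<forall>p<n. \<forall>q<n. \<forall>r<n. {u, p} \<in> F \<and> {u, q} \<in> F \<and> {u, r} \<in> F \<and> q \<noteq> p \<and> r \<noteq> p \<and>
        C u p q \<and> C u p r \<longrightarrow> q = r)"

text \<open>In other words, the first return to an arc is not at an even time up to
  \<open>n\<close>. Since a cycle has at most \<open>n\<close> vertices, its length is among the
  times considered.\<close>

definition odd_returns :: "nat \<Rightarrow> nat set set \<Rightarrow> (nat \<Rightarrow> nat \<Rightarrow> nat \<Rightarrow> bool) \<Rightarrow> bool" where
  "odd_returns n F C \<longleftrightarrow>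
     (\<forall>p<n. \<forall>u<n. \<forall>t\<le>n. {p, u} \<in> F \<and> even t \<and> 0 < t \<and> (walk_step n F C ^^ t) (p, u) = (p, u) \<longrightarrow>
        (\<exists>s<t. 0 < s \<and> (walk_step n F C ^^ s) (p, u) = (p, u)))"

context
  fixes n :: nat and F :: "nat set set"
  assumes F: "simple_graph {0..<n} F"
begin

lemma edge_less: "{a, b} \<in> F \<Longrightarrow> a < n \<and> b < n \<and> a \<noteq> b"
  using F unfolding simple_graph_def by (metis atLeastLessThan_iff doubleton_eq_iff)

lemma cyc_less: "is_cycle F c \<Longrightarrow> cyc c i < n"
  using cyc_edge edge_less by blast

lemma cyc_add_length: "cyc c (i + length c) = cyc c i"
  by (simp add: cyc_def)

text \<open>The rest of the cycle leads from the predecessor of \<open>?u\<close> to its successor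
  without meeting \<open>?u\<close>, so closure relates the two and uniqueness of turns leaves no
  other choice.\<close>

lemma next_vertex_cyc:
  assumes C: "reach_closed n F C" "unique_turns n F C" and c: "is_cycle F c"
  shows "next_vertex n F C (cyc c i) (cyc c (Suc i)) = cyc c (Suc (Suc i))"
proof -
  let ?l = "length c"
  let ?p = "cyc c i" and ?u = "cyc c (Suc i)" and ?q = "cyc c (Suc (Suc i))"
  have l: "3 \<le> ?l"
    using c by (rule is_cycle_length)
  have less: "cyc c j < n" for j
    using cyc_less[OF c] .
  have period: "cyc c (i + ?l) = ?p"
    by (simp add: cyc_def)
  \<comment> \<open>The cycle is followed backwards from \<open>?p\<close>, with indices raised by
    one period; after \<open>?l - 2\<close> steps this arrives at \<open>?q\<close>.\<close>
  have behind: "C ?u ?p (cyc c (i + ?l - s))" if "s \<le> ?l - 2" for s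
    using that
  proof (induction s)
    case 0
    then show ?case
      using C(1) less by (simp add: reach_closed_def period)
  next
    case (Suc s)
    let ?b = "cyc c (i + ?l - s)" and ?c = "cyc c (i + ?l - Suc s)"
    have "Suc (i + ?l - Suc s) = i + ?l - s"
      using Suc.prems l by simp
    then have "{?b, ?c} \<in> F"
      using cyc_edge[OF c, of "i + ?l - Suc s"] by (simp add: insert_commute)
    moreover have "?u \<noteq> ?b" "?u \<noteq> ?c"
      using Suc.prems l by (intro cyc_neq[OF c]; simp)+
    moreover have "C ?u ?p ?b"
      using Suc by simp
    ultimately show ?case
      using C(1) less unfolding reach_closed_def by (metis (no_types, lifting))
  qed
  have "i + ?l - (?l - 2) = Suc (Suc i)"
    using l by simp
  then have turn: "C ?u ?p ?q"
    using behind[of "?l - 2"] by simp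
  have pu: "{?u, ?p} \<in> F"
    using cyc_edge[OF c, of i] by (simp add: insert_commute)
  have uq: "{?u, ?q} \<in> F"
    by (rule cyc_edge[OF c])
  have "?p \<noteq> ?q"
    using l by (intro cyc_neq[OF c]) auto
  moreover have "r = ?q" if "{?u, r} \<in> F \<and> r \<noteq> ?p \<and> C ?u ?p r" for r
    using C(2) turn pu uq that less edge_less \<open>?p \<noteq> ?q\<close> unfolding unique_turns_def by metis
  ultimately show ?thesis
    unfolding next_vertex_def
    using turn uq less by (intro first_index_eq) auto
qed

lemma walk_cyc:
  assumes "reach_closed n F C" and "unique_turns n F C" and "is_cycle F c"
  shows "(walk_step n F C ^^ t) (cyc c i, cyc c (Suc i)) = (cyc c (i + t), cyc c (Suc (i + t)))"
  by (induction t) (simp_all add: walk_step_def next_vertex_cyc[OF assms])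

text \<open>The walk along an even cycle would return at the time \<open>length c\<close>, so
  \<open>odd_returns\<close> would give an earlier return, and the cycle would repeat a
  vertex.\<close>

lemma certificate_sound:
  assumes C: "reach_closed n F C" "unique_turns n F C" "odd_returns n F C" and c: "is_cycle F c"
  shows "odd (length c)"
proof
  let ?l = "length c"
  assume even: "even ?l"
  have l: "3 \<le> ?l"
    using c by (rule is_cycle_length)
  have "set c \<subseteq> {0..<n}"
  proof
    fix v
    assume "v \<in> set c"
    then obtain i where "i < ?l" "v = c ! i"
      by (auto simp: in_set_conv_nth)
    then show "v \<in> {0..<n}"
      using cyc_less[OF c, of i] by (simp add: cyc_def)
  qed
  then have "card (set c) \<le> n"
    using card_mono[of "{0..<n}" "set c"] by simp
  then have "?l \<le> n"
    using c by (simp add: is_cycle_def distinct_card)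
  moreover have "(walk_step n F C ^^ ?l) (cyc c 0, cyc c (Suc 0)) = (cyc c 0, cyc c (Suc 0))"
    unfolding walk_cyc[OF C(1,2) c] using cyc_add_length[of c 0] cyc_add_length[of c "Suc 0"] by simp
  ultimately obtain s where s: "s < ?l" "0 < s"
    "(walk_step n F C ^^ s) (cyc c 0, cyc c (Suc 0)) = (cyc c 0, cyc c (Suc 0))"
    using C(3) cyc_less[OF c] cyc_edge[OF c, of 0] even l unfolding odd_returns_def
    by (metis (no_types, lifting) gr0I list.size(3) not_numeral_le_zero)
  then have "cyc c 0 = cyc c s"
    unfolding walk_cyc[OF C(1,2) c] by simp
  then show False
    using cyc_neq[OF c, of 0 s] s by simp
qed

text \<open>A walk that returns to an arc runs around a cycle through this arc, so its return times
  are multiples of the length of the cycle. That length is odd, hence an even return time is not the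
  first one.\<close>

lemma certificate_complete:
  assumes odd: "\<And>c. is_cycle F c \<Longrightarrow> odd (length c)"
    and C: "\<And>u a b. u < n \<Longrightarrow> a < n \<Longrightarrow> b < n \<Longrightarrow> C u a b \<longleftrightarrow> (a, b) \<in> (avoiding F u)\<^sup>*"
  shows "reach_closed n F C" and "unique_turns n F C" and "odd_returns n F C"
proof -
  show closed: "reach_closed n F C"
    unfolding reach_closed_def by (auto simp: C avoiding_def intro: rtrancl_into_rtrancl)
  show unique: "unique_turns n F C"
    unfolding unique_turns_def
  proof (intro allI impI, rule ccontr)
    fix u p q r
    assume a: "{u, p} \<in> F \<and> {u, q} \<in> F \<and> {u, r} \<in> F \<and> q \<noteq> p \<and> r \<noteq> p \<and> C u p q \<and> C u p r"
      and ne: "q \<noteq> r"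
    have "p \<noteq> u"
      using a edge_less by blast
    then have "\<exists>c. is_cycle F c \<and> even (length c)"
      using a ne by (intro even_cycle_of_three_neighbours[of u p F q r]) (auto simp: C edge_less)
    then show False
      using odd by blast
  qed
  show "odd_returns n F C"
    unfolding odd_returns_def
  proof (intro allI impI; elim conjE)
    fix p u t
    assume p: "p < n" and u: "u < n" and pu: "{p, u} \<in> F" and t: "even t" "0 < t"
      and ret: "(walk_step n F C ^^ t) (p, u) = (p, u)"
    let ?T = "\<lambda>q. {u, q} \<in> F \<and> q \<noteq> p \<and> C u p q"
    \<comment> \<open>Otherwise the walk would be caught at the non-vertex \<open>n\<close> and
      could not come back to \<open>u\<close>.\<close>
    have "\<exists>q<n. ?T q"
    proof (rule ccontr)
      assume "\<not> (\<exists>q<n. ?T q)"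
      then have first: "next_vertex n F C p u = n"
        unfolding next_vertex_def by (intro first_index_none) blast
      have out: "next_vertex n F C v n = n" for v
        unfolding next_vertex_def using edge_less by (intro first_index_none) blast
      have "snd ((walk_step n F C ^^ Suc s) (p, u)) = n" for s
      proof (induction s)
        case 0
        then show ?case
          by (simp add: walk_step_def first)
      next
        case (Suc s)
        have "snd (walk_step n F C z) = next_vertex n F C (fst z) (snd z)" for z
          by (simp add: walk_step_def case_prod_beta)
        then show ?case
          unfolding funpow.simps(2)[of "Suc s"] o_apply by (simp only: Suc.IH out)
      qed
      from this[of "t - 1"] show False
        using ret t(2) u by simp
    qed
    then obtain q where q: "{u, q} \<in> F" "q \<noteq> p" "(p, q) \<in> (avoiding F u)\<^sup>*"
      using C p u by blast
    have "p \<noteq> u"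
      using edge_less[OF pu] by simp
    then obtain xs where xs: "xs \<noteq> []" "hd xs = p" "last xs = q" "chain F xs" "distinct xs" "u \<notin> set xs"
      using simple_path_avoiding[OF q(3)] by blast
    \<comment> \<open>Listed from \<open>u\<close> through \<open>q\<close> to \<open>p\<close>, so
      that the arc from \<open>p\<close> to \<open>u\<close> closes the cycle and has index
      \<open>?l - 1\<close>.\<close>
    let ?c = "u # rev xs"
    have len: "2 \<le> length xs"
      using xs(1-3) q(2) by (cases xs) (auto simp: Suc_le_eq split: if_splits)
    have c: "is_cycle F ?c"
    proof (rule is_cycle_of_chain)
      show "chain F ?c"
        using xs q(1) by (simp add: successively_Cons hd_rev del: successively_rev)
      show "{last (rev xs), u} \<in> F"
        using xs(1,2) pu by (simp add: last_rev)
    qed (use xs len in auto)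
    let ?l = "length ?c"
    have l: "odd ?l"
      using odd[OF c] .
    have "?c ! (?l - 1) = p"
      using xs(1,2) by (simp add: nth_Cons' rev_nth hd_conv_nth)
    then have arc: "cyc ?c (?l - 1) = p" "cyc ?c (Suc (?l - 1)) = u"
      by (simp_all add: cyc_def)
    have walk: "(walk_step n F C ^^ s) (p, u) = (cyc ?c (?l - 1 + s), cyc ?c (Suc (?l - 1 + s)))" for s
      using walk_cyc[OF closed unique c, of s "?l - 1"] arc by simp
    have "cyc ?c (?l + t) = cyc ?c ?l"
      using ret unfolding walk using arc by simp
    then have "?l dvd ?l + t"
      unfolding cyc_eq_iff[OF c] by (simp only: mod_self mod_eq_0_iff_dvd)
    then have "?l dvd t"
      by (simp only: dvd_add_right_iff[OF dvd_refl])
    moreover have "?l \<noteq> t"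
      using l t(1) by blast
    ultimately have "?l < t"
      using t(2) by (auto dest: dvd_imp_le)
    moreover have "(walk_step n F C ^^ ?l) (p, u) = (p, u)"
      unfolding walk by (simp only: add_Suc[symmetric] cyc_add_length arc)
    ultimately show "\<exists>s<t. 0 < s \<and> (walk_step n F C ^^ s) (p, u) = (p, u)"
      by (intro exI[of _ ?l]) simp
  qed
qed

end

section \<open>Membership in NP\<close>

lemma computable_first_index [computable_intros]:
  assumes "computable n f"
    and "computable (Suc n) (\<lambda>x e. of_bool (P x (\<lambda>i. e (Suc i)) (e 0)))"
  shows "computable n (\<lambda>x e. first_index (f x e) (P x e))"
  unfolding first_index_def
proof (intro computable_intros assms)
  show "computable (Suc (Suc n)) (\<lambda>x e. of_bool (P x (\<lambda>i. e (Suc (Suc i))) (e 0)))"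
    using computable_rename[OF assms(2), of "case_nat 0 (\<lambda>i. Suc (Suc i))" "Suc (Suc n)"]
    by (simp split: nat.split)
qed simp

lemma computable_even [computable_intros]:
  "computable n f \<Longrightarrow> computable n (\<lambda>x e. of_bool (even (f x e)))"
  by (rule computable_cong[of n "\<lambda>x e. of_bool (\<not> odd (f x e))"], intro computable_intros) auto

subsection \<open>The walk\<close>

text \<open>The pair \<open>(p, u)\<close> is coded by \<open>p * (n + 1) + u\<close>.\<close>

definition walk_code :: "nat \<Rightarrow> nat set set \<Rightarrow> (nat \<Rightarrow> nat \<Rightarrow> nat \<Rightarrow> bool) \<Rightarrow> nat \<Rightarrow> nat \<Rightarrow> nat" where
  "walk_code n F C t a = rec_nat a (\<lambda>_ a. (a mod (n + 1)) * (n + 1) +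
     next_vertex n F C (a div (n + 1)) (a mod (n + 1))) t"

lemma next_vertex_le: "next_vertex n F C p u \<le> n"
  unfolding next_vertex_def by (rule first_index_le)

lemma walk_code_eq:
  assumes "u \<le> n"
  shows "walk_code n F C t (p * (n + 1) + u) =
      (case (walk_step n F C ^^ t) (p, u) of (p', u') \<Rightarrow> p' * (n + 1) + u') \<and>
    snd ((walk_step n F C ^^ t) (p, u)) \<le> n"
proof (induction t)
  case 0
  then show ?case
    using assms by (simp add: walk_code_def)
next
  case (Suc t)
  obtain p' u' where w: "(walk_step n F C ^^ t) (p, u) = (p', u')"
    by fastforce
  then have "walk_code n F C t (p * (n + 1) + u) = p' * (n + 1) + u'" and u': "u' < n + 1"
    using Suc by simp_all
  then have "walk_code n F C (Suc t) (p * (n + 1) + u) = u' * (n + 1) + next_vertex n F C p' u'"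
    unfolding walk_code_def nat.rec by (simp only: digits[OF u'])
  moreover have "(walk_step n F C ^^ Suc t) (p, u) = (u', next_vertex n F C p' u')"
    unfolding funpow.simps o_apply w by (simp add: walk_step_def)
  ultimately show ?case
    by (simp only: prod.case snd_conv next_vertex_le simp_thms)
qed

lemma walk_return_iff:
  assumes "u < n"
  shows "(walk_step n F C ^^ t) (p, u) = (p, u) \<longleftrightarrow>
    walk_code n F C t (p * (n + 1) + u) = p * (n + 1) + u"
proof -
  obtain p' u' where w: "(walk_step n F C ^^ t) (p, u) = (p', u')"
    by fastforce
  have c: "walk_code n F C t (p * (n + 1) + u) = p' * (n + 1) + u'" and u': "u' < n + 1"
    using walk_code_eq[of u n F C t p] assms by (simp_all add: w)
  have u: "u < n + 1"
    using assms by simp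
  have "p' = p \<and> u' = u" if "p' * (n + 1) + u' = p * (n + 1) + u"
    using digits(1,2)[OF u', of p'] digits(1,2)[OF u, of p] that by metis
  then show ?thesis
    unfolding c w by auto
qed

text \<open>Both digits stay at most \<open>n\<close>; this supplies the bound that recursion
  requires.\<close>

lemma walk_code_less:
  assumes "a < (n + 1) * (n + 1)"
  shows "walk_code n F C t a < (n + 1) * (n + 1)"
proof (cases t)
  case (Suc t)
  then show ?thesis
    unfolding walk_code_def using next_vertex_le[of n F C]
    by (simp only: nat.rec) (rule digits(3), auto simp: less_Suc_eq_le)
qed (use assms in \<open>simp add: walk_code_def\<close>)

context
  fixes n :: "bool list \<Rightarrow> nat" and F :: "bool list \<Rightarrow> nat set set"
    and C :: "bool list \<Rightarrow> nat \<Rightarrow> nat \<Rightarrow> nat \<Rightarrow> bool"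
  assumes n: "\<And>m. computable m (\<lambda>x e. n x)"
    and F: "\<And>m f g. computable m f \<Longrightarrow> computable m g \<Longrightarrow> computable m (\<lambda>x e. of_bool ({f x e, g x e} \<in> F x))"
    and C: "\<And>m f g h. computable m f \<Longrightarrow> computable m g \<Longrightarrow> computable m h \<Longrightarrow>
      computable m (\<lambda>x e. of_bool (C x (f x e) (g x e) (h x e)))"
begin

lemma computable_reach_closed: "computable 0 (\<lambda>x e. of_bool (reach_closed (n x) (F x) (C x)))"
  unfolding reach_closed_def by (intro n F C computable_intros; simp)

lemma computable_unique_turns: "computable 0 (\<lambda>x e. of_bool (unique_turns (n x) (F x) (C x)))"
  unfolding unique_turns_def by (intro n F C computable_intros; simp)

lemma computable_next_vertex:
  assumes "computable m f" and "computable m g"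
  shows "computable m (\<lambda>x e. next_vertex (n x) (F x) (C x) (f x e) (g x e))"
proof (rule computable_subst2[OF _ assms])
  show "computable 2 (\<lambda>x e. next_vertex (n x) (F x) (C x) (e 0) (e 1))"
    unfolding next_vertex_def by (intro n F C computable_intros; simp)
qed

lemma computable_walk_return:
  assumes "computable m f" and "computable m g" and "computable m h"
  shows "computable m (\<lambda>x e. of_bool (f x e < n x \<and> g x e < n x \<and>
    (walk_step (n x) (F x) (C x) ^^ h x e) (f x e, g x e) = (f x e, g x e)))"
proof (rule computable_subst3[OF _ assms])
  let ?N = "\<lambda>x. (n x + 1) * (n x + 1)"
  \<comment> \<open>The default 0 keeps the start below \<open>?N x\<close> for all arguments, so
    that the bound on the recursion holds unconditionally.\<close>
  let ?a = "\<lambda>x e. if e 0 < n x \<and> e 1 < n x then e 0 * (n x + 1) + e 1 else 0"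
  have less: "?a x e < ?N x" for x e
  proof (cases "e 0 < n x \<and> e 1 < n x")
    case True
    then have "e 0 * (n x + 1) + e 1 < ?N x"
      by (intro digits(3)) auto
    with True show ?thesis
      by simp
  next
    case False
    show ?thesis
      unfolding if_not_P[OF False] by simp
  qed
  have code: "computable 3 (\<lambda>x e. walk_code (n x) (F x) (C x) (e 2) (?a x e))"
    unfolding walk_code_def
  proof (rule computable_rec[where H = "\<lambda>x e i a. (a mod (n x + 1)) * (n x + 1) +
      next_vertex (n x) (F x) (C x) (a div (n x + 1)) (a mod (n x + 1))"])
    show "poly_bounded 3 (\<lambda>x e. ?N x)"
      by (intro computableD computable_intros n)
    show "rec_nat (?a x e) (\<lambda>i a. (a mod (n x + 1)) * (n x + 1) +
        next_vertex (n x) (F x) (C x) (a div (n x + 1)) (a mod (n x + 1))) i \<le> ?N x" for x e i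
      using walk_code_less[OF less, of x "F x" "C x" i e] unfolding walk_code_def by (rule less_imp_le)
  qed (intro n computable_next_vertex computable_intros; simp)+
  have "(e 0 < n x \<and> e 1 < n x \<and>
      (walk_step (n x) (F x) (C x) ^^ e 2) (e 0, e 1) = (e 0, e 1)) =
    (e 0 < n x \<and> e 1 < n x \<and> walk_code (n x) (F x) (C x) (e 2) (?a x e) = e 0 * (n x + 1) + e 1)"
    for x and e :: "nat \<Rightarrow> nat"
    using walk_return_iff by auto
  then show "computable 3 (\<lambda>x e. of_bool (e 0 < n x \<and> e 1 < n x \<and>
      (walk_step (n x) (F x) (C x) ^^ e 2) (e 0, e 1) = (e 0, e 1)))"
    by (simp only:) (intro n code computable_intros; simp)
qed

lemma computable_odd_returns: "computable 0 (\<lambda>x e. of_bool (odd_returns (n x) (F x) (C x)))"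
proof (rule computable_cong)
  let ?w = "\<lambda>x p u t. p < n x \<and> u < n x \<and> (walk_step (n x) (F x) (C x) ^^ t) (p, u) = (p, u)"
  show "computable 0 (\<lambda>x e. of_bool (\<forall>p<n x. \<forall>u<n x. \<forall>t\<le>n x.
      {p, u} \<in> F x \<and> even t \<and> 0 < t \<and> ?w x p u t \<longrightarrow> (\<exists>s<t. 0 < s \<and> ?w x p u s)))"
    by (intro computable_walk_return n F computable_intros; simp)
qed (auto simp: odd_returns_def)

end

subsection \<open>The girth\<close>

lemma digits_exist:
  assumes "\<And>i. i < l \<Longrightarrow> d i < (n :: nat)"
  shows "\<exists>c<n ^ l. \<forall>i<l. c div n ^ i mod n = d i"
  using assms
proof (induction l arbitrary: d)
  case (Suc l)
  obtain c where c: "c < n ^ l" "\<And>i. i < l \<Longrightarrow> c div n ^ i mod n = d (Suc i)"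
    using Suc.IH[of "\<lambda>i. d (Suc i)"] Suc.prems by auto
  have d: "d 0 < n"
    using Suc.prems by simp
  have "(c * n + d 0) div n ^ i mod n = d i" if "i < Suc l" for i
    using that c(2) by (cases i) (simp_all add: div_mult2_eq digits[OF d] mod_less[OF d])
  moreover have "c * n + d 0 < n ^ Suc l"
    using digits(3)[OF d c(1)] by (simp add: mult.commute)
  ultimately show ?case
    by blast
qed simp

text \<open>A cycle of length below \<open>p\<close> is a sequence of digits to base
  \<open>n\<close>, hence a number below \<open>n ^ p\<close>. As \<open>p\<close> is constant,
  these are polynomially many candidates.\<close>

lemma le_girth_iff_codes:
  fixes n :: nat and F :: "nat set set"
  assumes F: "simple_graph {0..<n} F"
  shows "enat p \<le> girth F \<longleftrightarrow>
    (\<forall>c<n ^ p. \<forall>l<p. \<not> (3 \<le> l \<and> (\<forall>i<l. {c div n ^ i mod n, c div n ^ (Suc i mod l) mod n} \<in> F \<and>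
       (\<forall>j<i. c div n ^ i mod n \<noteq> c div n ^ j mod n))))"
    (is "_ \<longleftrightarrow> (\<forall>c<n ^ p. \<forall>l<p. \<not> ?cycle c l)")
proof
  assume girth: "enat p \<le> girth F"
  show "\<forall>c<n ^ p. \<forall>l<p. \<not> ?cycle c l"
  proof (intro allI impI notI)
    fix c l
    assume l: "l < p" and cycle: "?cycle c l"
    let ?d = "\<lambda>i. c div n ^ i mod n"
    have ne: "?d i \<noteq> ?d j" if "j < i" "i < l" for i j
      using cycle that by blast
    have "inj_on ?d {0..<l}"
    proof (rule inj_onI)
      fix i j
      assume "i \<in> {0..<l}" "j \<in> {0..<l}" "?d i = ?d j"
      then show "i = j"
        using ne[of i j] ne[of j i] by (metis atLeastLessThan_iff linorder_neqE_nat)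
    qed
    moreover have "Suc i mod l < l" if "i < l" for i
      using that by (intro mod_less_divisor) simp
    ultimately have "is_cycle F (map ?d [0..<l])"
      using cycle by (simp add: is_cycle_def distinct_map)
    then show False
      using girth l unfolding le_girth_iff by fastforce
  qed
next
  assume codes: "\<forall>c<n ^ p. \<forall>l<p. \<not> ?cycle c l"
  show "enat p \<le> girth F"
    unfolding le_girth_iff
  proof (intro allI impI, rule ccontr)
    fix c
    assume c: "is_cycle F c" and l: "\<not> p \<le> length c"
    have less: "c ! i < n" if "i < length c" for i
      using cyc_less[OF F c, of i] that by (simp add: cyc_def)
    then obtain d where d: "d < n ^ length c" "\<And>i. i < length c \<Longrightarrow> d div n ^ i mod n = c ! i"
      using digits_exist[of "length c" "\<lambda>i. c ! i" n] by blast
    have "0 < n"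
      using less[of 0] is_cycle_length[OF c] by (cases c) auto
    then have "d < n ^ p"
      using d(1) l power_increasing[of "length c" p n] by simp
    moreover have "?cycle d (length c)"
    proof (intro conjI allI impI)
      show "3 \<le> length c"
        using c by (rule is_cycle_length)
      fix i
      assume i: "i < length c"
      then have "Suc i mod length c < length c"
        by (intro mod_less_divisor) linarith
      then show "{d div n ^ i mod n, d div n ^ (Suc i mod length c) mod n} \<in> F"
        using c i by (simp add: d(2) is_cycle_def)
      show "d div n ^ i mod n \<noteq> d div n ^ j mod n" if "j < i" for j
        using c i that by (simp add: d(2) is_cycle_def nth_eq_iff_index_eq)
    qed
    ultimately show False
      using codes l by auto
  qed
qed

lemma computable_le_girth:
  assumes n: "\<And>m. computable m (\<lambda>x e. n x)"
    and F: "\<And>m f g. computable m f \<Longrightarrow> computable m g \<Longrightarrow> computable m (\<lambda>x e. of_bool ({f x e, g x e} \<in> F x))"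
  shows "computable 0 (\<lambda>x e. of_bool (\<forall>c<n x ^ p. \<forall>l<p. \<not> (3 \<le> l \<and>
    (\<forall>i<l. {c div n x ^ i mod n x, c div n x ^ (Suc i mod l) mod n x} \<in> F x \<and>
       (\<forall>j<i. c div n x ^ i mod n x \<noteq> c div n x ^ j mod n x)))))"
  by (intro n F computable_intros; simp)

subsection \<open>Comparison with the budget\<close>

text \<open>The budget \<open>k\<close> may be exponentially large; a Horner scheme cut off at \<open>s\<close> decides \<open>s \<le> k\<close>.\<close>

definition capped_value :: "nat \<Rightarrow> nat \<Rightarrow> (nat \<Rightarrow> bool) \<Rightarrow> nat" where
  "capped_value s l b = rec_nat 0 (\<lambda>j r. if s \<le> 2 * r + of_bool (b (l - Suc j)) then s
     else 2 * r + of_bool (b (l - Suc j))) l"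

text \<open>Cutting off early does no harm: a value that has reached \<open>s\<close> remains at
  least \<open>s\<close> under doubling.\<close>

lemma capped_value: "capped_value s (length bs) (\<lambda>i. bs ! i) = min s (bits_value bs)"
proof -
  let ?f = "\<lambda>j r. if s \<le> 2 * r + of_bool (bs ! (length bs - Suc j)) then s
     else 2 * r + of_bool (bs ! (length bs - Suc j))"
  have "rec_nat 0 ?f j = min s (bits_value (drop (length bs - j) bs))" if "j \<le> length bs" for j
    using that
  proof (induction j)
    case (Suc j)
    then have "drop (length bs - Suc j) bs = bs ! (length bs - Suc j) # drop (length bs - j) bs"
      using Cons_nth_drop_Suc[of "length bs - Suc j" bs] by (simp add: Suc_diff_Suc)
    then show ?case
      using Suc by (auto simp: min_def)
  qed simp
  then show ?thesis
    by (simp add: capped_value_def)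
qed

subsection \<open>Decoding\<close>

lemma first_index_spec:
  shows "i < first_index n P \<Longrightarrow> \<not> P i" and "first_index n P < n \<Longrightarrow> P (first_index n P)"
proof -
  have "(i < first_index n P \<longrightarrow> \<not> P i) \<and> (first_index n P < n \<longrightarrow> P (first_index n P))" for i
  proof (cases "\<exists>q<n. P q")
    case True
    then obtain q where q: "q < n" "P q"
      by blast
    then have least: "(LEAST q. P q) < n" "P (LEAST q. P q)"
      by (auto intro: LeastI Least_le le_less_trans)
    have "first_index n P = (LEAST q. P q)"
      by (rule first_index_eq) (use least in \<open>auto dest: not_less_Least\<close>)
    then show ?thesis
      using least not_less_Least by metis
  next
    case False
    then have "first_index n P = n"
      by (intro first_index_none) blast
    with False show ?thesis
      by simp
  qed
  then show "i < first_index n P \<Longrightarrow> \<not> P i" and "first_index n P < n \<Longrightarrow> P (first_index n P)"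
    by blast+
qed

text \<open>Decoding refers to a predicate \<open>X\<close> on \<open>l\<close> positions, because
  the verifier sees the instance only through positions of \<open>pair_code x w\<close>.\<close>

definition decoded_size :: "nat \<Rightarrow> (nat \<Rightarrow> bool) \<Rightarrow> nat" where
  "decoded_size l X = first_index l (\<lambda>i. \<not> X i)"

definition decoded_edges :: "nat \<Rightarrow> (nat \<Rightarrow> bool) \<Rightarrow> nat set set" where
  "decoded_edges n X = {{u, v} | u v. u < n \<and> v < n \<and> X (Suc (n + (u * n + v)))}"

text \<open>The last conjunct excludes leading zeros of the budget, which lie outside the range of
  \<open>binary\<close>.\<close>

definition valid_code :: "nat \<Rightarrow> (nat \<Rightarrow> bool) \<Rightarrow> nat \<Rightarrow> bool" where
  "valid_code l X n \<longleftrightarrow> n + 1 + n * n \<le> l \<and>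
     (\<forall>u<n. \<not> X (Suc (n + (u * n + u))) \<and>
        (\<forall>v<n. X (Suc (n + (u * n + v))) \<longleftrightarrow> X (Suc (n + (v * n + u))))) \<and>
     (n + 1 + n * n < l \<longrightarrow> X (l - 1))"

lemma decoded_edges_iff:
  "{u, v} \<in> decoded_edges n X \<longleftrightarrow>
    u < n \<and> v < n \<and> (X (Suc (n + (u * n + v))) \<or> X (Suc (n + (v * n + u))))"
  unfolding decoded_edges_def by (auto simp: doubleton_eq_iff)

lemma simple_decoded:
  assumes "\<And>u. u < n \<Longrightarrow> \<not> X (Suc (n + (u * n + u)))"
  shows "simple_graph {0..<n} (decoded_edges n X)"
  unfolding simple_graph_def
proof (intro conjI ballI)
  fix e
  assume "e \<in> decoded_edges n X"
  then obtain u v where uv: "e = {u, v}" "u < n" "v < n" "X (Suc (n + (u * n + v)))"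
    unfolding decoded_edges_def by blast
  then have "u \<noteq> v"
    using assms by blast
  with uv(1-3) show "\<exists>u\<in>{0..<n}. \<exists>v\<in>{0..<n}. u \<noteq> v \<and> e = {u, v}"
    by (intro bexI[of _ u] bexI[of _ v] conjI) simp_all
qed simp

lemma bit_at_nth: "i < length x \<Longrightarrow> bit_at x i = x ! i"
  by (simp add: bit_at_def)

lemma valid_code_imp_encoded:
  assumes valid: "valid_code (length x) (bit_at x) n" and n: "n = decoded_size (length x) (bit_at x)"
  defines "E \<equiv> decoded_edges n (bit_at x)" and "k \<equiv> bits_value (drop (n + 1 + n * n) x)"
  shows "simple_graph {0..<n} E" and "x = encode_instance n E k"
proof -
  let ?o = "n + 1 + n * n"
  have len: "?o \<le> length x"
    and diag: "\<And>u. u < n \<Longrightarrow> \<not> bit_at x (Suc (n + (u * n + u)))"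
    and sym: "\<And>u v. u < n \<Longrightarrow> v < n \<Longrightarrow> bit_at x (Suc (n + (u * n + v))) = bit_at x (Suc (n + (v * n + u)))"
    and last: "?o < length x \<Longrightarrow> bit_at x (length x - 1)"
    using valid unfolding valid_code_def by blast+
  show "simple_graph {0..<n} E"
    unfolding E_def using diag by (rule simple_decoded)
  have tail: "binary k = drop ?o x"
    unfolding k_def
  proof (rule binary_bits_value)
    show "drop ?o x = [] \<or> last (drop ?o x)"
    proof (cases "?o < length x")
      case True
      then have "x \<noteq> []"
        by auto
      then have "last (drop ?o x) = x ! (length x - 1)"
        by (rule trans[OF last_drop[OF True] last_conv_nth])
      moreover have "x ! (length x - 1)"
        using last[OF True] unfolding bit_at_def by blast
      ultimately show ?thesis
        by simp
    qed simp
  qed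
  show "x = encode_instance n E k"
  proof (rule nth_equalityI)
    show "length x = length (encode_instance n E k)"
      using len by (simp add: length_encode_instance tail)
    fix i
    assume i: "i < length x"
    then have "i < n + 1 + n * n + length (binary k)"
      using len by (simp add: tail)
    then show "x ! i = encode_instance n E k ! i"
    proof (cases rule: four_part_index)
      case 1
      then show ?thesis
        using first_index_spec(1)[of i "length x" "\<lambda>i. \<not> bit_at x i"] i n
        by (simp add: nth_encode_instance decoded_size_def bit_at_def)
    next
      case 2
      then show ?thesis
        using first_index_spec(2)[of "length x" "\<lambda>i. \<not> bit_at x i"] i n
        by (simp add: nth_encode_instance decoded_size_def bit_at_def)
    next
      case (3 j)
      have "0 < n"
        using 3(2) by (cases n) auto
      then have "j div n < n" "j mod n < n"
        using 3(2) by (simp_all add: less_mult_imp_div_less)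
      then have "{j div n, j mod n} \<in> E \<longleftrightarrow> bit_at x (Suc (n + (j div n * n + j mod n)))"
        unfolding E_def decoded_edges_iff using sym by blast
      then show ?thesis
        using 3 i by (simp add: nth_encode_instance bit_at_nth)
    next
      case (4 j)
      then show ?thesis
        using len by (simp add: nth_encode_instance tail)
    qed
  qed
qed

lemma decode_encoded:
  fixes n k :: nat and E :: "nat set set"
  assumes E: "simple_graph {0..<n} E"
  defines "x \<equiv> encode_instance n E k"
  shows "decoded_size (length x) (bit_at x) = n" and "decoded_edges n (bit_at x) = E"
    and "valid_code (length x) (bit_at x) n" and "drop (n + 1 + n * n) x = binary k"
proof -
  have len: "length x = n + 1 + n * n + length (binary k)"
    by (simp add: x_def length_encode_instance)
  show "decoded_size (length x) (bit_at x) = n"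
    unfolding decoded_size_def
  proof (rule first_index_eq)
    show "\<not> bit_at x n"
      by (simp add: bit_at_def x_def nth_encode_instance)
    show "\<not> \<not> bit_at x i" if "i < n" for i
      using that len nth_encode_instance(1)[of i n E k] by (simp add: bit_at_def x_def[symmetric])
  qed (simp add: len)
  have mat: "bit_at x (Suc (n + (u * n + v))) \<longleftrightarrow> {u, v} \<in> E" if "u < n" "v < n" for u v
    using digits(1,2)[OF that(2), of u] digits(3)[OF that(2,1)]
      nth_encode_instance(3)[of "u * n + v" n E k]
    by (simp add: bit_at_def len x_def[symmetric])
  have "{u, v} \<in> decoded_edges n (bit_at x) \<longleftrightarrow> {u, v} \<in> E" if "u < n" "v < n" for u v
    using mat[OF that] mat[OF that(2,1)] that unfolding decoded_edges_iff by (simp add: insert_commute)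
  moreover have noloop: "{u} \<notin> E" for u
    using E unfolding simple_graph_def by (metis doubleton_eq_iff insert_absorb2)
  moreover have "simple_graph {0..<n} (decoded_edges n (bit_at x))"
    using mat noloop by (intro simple_decoded) simp
  ultimately show "decoded_edges n (bit_at x) = E"
    using simple_graph_eqI[OF _ E] by blast
  show drop: "drop (n + 1 + n * n) x = binary k"
    unfolding x_def encode_instance_eq by simp
  have "x ! (length x - 1)" if "n + 1 + n * n < length x"
  proof -
    have ne: "binary k \<noteq> []"
      using that len by auto
    have "x \<noteq> []"
      using that by auto
    then have "x ! (length x - 1) = last x"
      by (simp add: last_conv_nth)
    also have "last x = last (binary k)"
      using last_drop[OF that] by (simp only: drop)
    finally show ?thesis
      using last_binary[OF ne] by simp
  qed
  then show "valid_code (length x) (bit_at x) n"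
    unfolding valid_code_def using mat noloop len by (auto simp: insert_commute bit_at_def)
qed

subsection \<open>The verifier\<close>

definition remaining_edges :: "nat \<Rightarrow> (nat \<Rightarrow> bool) \<Rightarrow> (nat \<Rightarrow> bool) \<Rightarrow> nat set set" where
  "remaining_edges n X W = {e \<in> decoded_edges n X. \<forall>v\<in>e. \<not> W v}"

text \<open>The first \<open>n\<close> bits of the certificate mark the transversal; the
  \<open>n ^ 3\<close> bits after them are the table of the relations.\<close>

definition related :: "nat \<Rightarrow> (nat \<Rightarrow> bool) \<Rightarrow> nat \<Rightarrow> nat \<Rightarrow> nat \<Rightarrow> bool" where
  "related n W u a b = W (n + ((u * n + a) * n + b))"

definition verifies :: "nat \<Rightarrow> nat \<Rightarrow> (nat \<Rightarrow> bool) \<Rightarrow> (nat \<Rightarrow> bool) \<Rightarrow> bool" where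
  "verifies p l X W \<longleftrightarrow>
     (let n = decoded_size l X; s = (\<Sum>v<n. of_bool (W v)) in
       valid_code l X n \<and> enat p \<le> girth (decoded_edges n X) \<and>
       s \<le> capped_value s (l - (n + 1 + n * n)) (\<lambda>i. X (n + 1 + n * n + i)) \<and>
       reach_closed n (remaining_edges n X W) (related n W) \<and>
       unique_turns n (remaining_edges n X W) (related n W) \<and>
       odd_returns n (remaining_edges n X W) (related n W))"

lemma cycle_remaining_iff:
  assumes "simple_graph {0..<n} (decoded_edges n X)"
  shows "is_cycle (remaining_edges n X W) c \<longleftrightarrow>
    is_cycle (decoded_edges n X) c \<and> set c \<inter> {v. v < n \<and> W v} = {}" (is "?l \<longleftrightarrow> ?r")
proof
  assume c: ?l
  have "v \<notin> {v. v < n \<and> W v}" if "v \<in> set c" for v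
    using cycle_neighbours[OF c that] unfolding remaining_edges_def by blast
  with c show ?r
    unfolding is_cycle_def remaining_edges_def by blast
next
  assume r: ?r
  then have c: "is_cycle (decoded_edges n X) c"
    by blast
  have "{c ! i, c ! (Suc i mod length c)} \<in> remaining_edges n X W" if i: "i < length c" for i
  proof -
    let ?j = "Suc i mod length c"
    have e: "{c ! i, c ! ?j} \<in> decoded_edges n X"
      using c i unfolding is_cycle_def by blast
    have "?j < length c"
      using i by (intro mod_less_divisor) linarith
    then have "c ! i \<in> set c" "c ! ?j \<in> set c"
      using i by simp_all
    moreover have "c ! i < n" "c ! ?j < n"
      using e unfolding decoded_edges_iff by blast+
    ultimately show ?thesis
      using r e unfolding remaining_edges_def by blast
  qed
  then show ?l
    using c unfolding is_cycle_def by blast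
qed

lemma simple_remaining:
  "simple_graph {0..<n} (decoded_edges n X) \<Longrightarrow> simple_graph {0..<n} (remaining_edges n X W)"
  unfolding simple_graph_def remaining_edges_def by blast

lemma capped_value_cong:
  assumes "\<And>i. i < l \<Longrightarrow> b i = c i"
  shows "capped_value s l b = capped_value s l c"
proof -
  let ?f = "\<lambda>b j r. if s \<le> 2 * r + of_bool (b (l - Suc j)) then s
     else 2 * r + of_bool (b (l - Suc j))"
  have "rec_nat 0 (?f b) m = rec_nat 0 (?f c) m" if "m \<le> l" for m
    using that
  proof (induction m)
    case (Suc m)
    then have "b (l - Suc m) = c (l - Suc m)"
      by (intro assms) simp
    with Suc show ?case
      by simp
  qed simp
  then show ?thesis
    by (simp add: capped_value_def)
qed

lemma capped_value_tail:
  assumes "m \<le> length x"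
  shows "capped_value s (length x - m) (\<lambda>i. bit_at x (m + i)) = min s (bits_value (drop m x))"
proof -
  have "capped_value s (length x - m) (\<lambda>i. bit_at x (m + i)) =
      capped_value s (length x - m) (\<lambda>i. drop m x ! i)"
    using assms by (intro capped_value_cong) (auto simp: bit_at_def)
  then show ?thesis
    using capped_value[of s "drop m x"] by simp
qed

lemma card_eq_sum: "card {v. v < n \<and> W v} = (\<Sum>v<n. of_bool (W v))" for n :: nat
proof -
  have "{v. v < n \<and> W v} = {..<n} \<inter> {v. W v}"
    by auto
  then show ?thesis
    by simp
qed

lemma verifies_sound:
  assumes "verifies p (length x) (bit_at x) W"
  shows "x \<in> ECT_girth p"
proof -
  define n where "n = decoded_size (length x) (bit_at x)"
  let ?E = "decoded_edges n (bit_at x)" and ?F = "remaining_edges n (bit_at x) W"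
  let ?C = "related n W" and ?S = "{v. v < n \<and> W v}" and ?k = "bits_value (drop (n + 1 + n * n) x)"
  have valid: "valid_code (length x) (bit_at x) n" and girth: "enat p \<le> girth ?E"
    and budget: "card ?S \<le> capped_value (card ?S) (length x - (n + 1 + n * n))
      (\<lambda>i. bit_at x (n + 1 + n * n + i))"
    and cert: "reach_closed n ?F ?C" "unique_turns n ?F ?C" "odd_returns n ?F ?C"
    using assms unfolding verifies_def Let_def n_def[symmetric] card_eq_sum by blast+
  note code = valid_code_imp_encoded[OF valid n_def]
  have "even_cycle_transversal {0..<n} ?E ?S"
    unfolding even_cycle_transversal_def
  proof (intro conjI allI impI notI)
    fix c
    assume "is_cycle ?E c \<and> even (length c)" "set c \<inter> ?S = {}"
    then show False
      using certificate_sound[OF simple_remaining[OF code(1)] cert] cycle_remaining_iff[OF code(1)]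
      by blast
  qed auto
  moreover have "card ?S \<le> ?k"
    using budget capped_value_tail[of "n + 1 + n * n" x "card ?S"] valid
    by (simp add: valid_code_def)
  ultimately have "encode_instance n ?E ?k \<in> ECT_girth p"
    using encode_instance_in_ECT_girth_iff[OF code(1) girth] by blast
  then show ?thesis
    using code(2) by simp
qed

lemma verifies_complete:
  assumes "x \<in> ECT_girth p"
  obtains w where "length w \<le> length x + length x ^ 3" and "verifies p (length x) (bit_at x) (bit_at w)"
proof -
  obtain n E k S where x: "x = encode_instance n E k" and E: "simple_graph {0..<n} E"
    and girth: "enat p \<le> girth E" and S: "even_cycle_transversal {0..<n} E S" "card S \<le> k"
    using assms unfolding ECT_girth_def by blast
  note dec = decode_encoded[OF E, of k, folded x]
  define F where "F = {e \<in> E. \<forall>v\<in>e. v \<notin> S}"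
  \<comment> \<open>The layout of \<open>related\<close>, read backwards: bit numbers are split into
    the three digits \<open>u\<close>, \<open>a\<close> and \<open>b\<close>.\<close>
  define W where "W i \<longleftrightarrow> (if i < n then i \<in> S else
    ((i - n) div n mod n, (i - n) mod n) \<in> (avoiding F ((i - n) div n div n))\<^sup>*)" for i
  define w where "w = map W [0..<n + n * n * n]"
  have bit: "bit_at w i \<longleftrightarrow> i < n + n * n * n \<and> W i" for i
    by (auto simp: bit_at_def w_def)
  have n: "n \<le> length x"
    by (simp add: x length_encode_instance)
  then have "n * n * n \<le> length x * length x * length x"
    by (intro mult_le_mono)
  then have "length w \<le> length x + length x ^ 3"
    using n by (simp add: w_def power3_eq_cube)
  moreover have "verifies p (length x) (bit_at x) (bit_at w)"
  proof -
    have sub: "S \<subseteq> {0..<n}"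
      using S(1) by (simp add: even_cycle_transversal_def)
    have inS: "bit_at w v \<longleftrightarrow> v \<in> S" if "v < n" for v
      using that by (simp add: bit W_def)
    have set: "{v. v < n \<and> bit_at w v} = S"
      using inS sub by auto
    have less: "v < n" if "e \<in> E" "v \<in> e" for e v
      using E that unfolding simple_graph_def by fastforce
    have rem: "remaining_edges n (bit_at x) (bit_at w) = F"
      unfolding remaining_edges_def dec(2) F_def using less inS by blast
    have rel: "related n (bit_at w) u a b \<longleftrightarrow> (a, b) \<in> (avoiding F u)\<^sup>*"
      if "u < n" "a < n" "b < n" for u a b
    proof -
      have "(u * n + a) * n + b < n * n * n"
        using that by (intro digits(3))
      then show ?thesis
        using digits(1,2)[OF that(3), of "u * n + a"] digits(1,2)[OF that(2), of u]
        by (simp add: related_def bit W_def)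
    qed
    have "odd (length c)" if "is_cycle F c" for c
    proof -
      have "is_cycle E c \<and> set c \<inter> S = {}"
        using that cycle_remaining_iff[of n "bit_at x" "bit_at w" c] E unfolding rem dec(2) set by blast
      then show ?thesis
        using S(1) unfolding even_cycle_transversal_def by blast
    qed
    note cert = certificate_complete[OF _ this rel]
    have F: "simple_graph {0..<n} F"
      using simple_remaining[of n "bit_at x" "bit_at w"] E unfolding rem dec(2) by blast
    have "card S \<le> bits_value (drop (n + 1 + n * n) x)"
      using S(2) unfolding dec(4) bits_value_binary .
    then have "card S \<le> capped_value (card S) (length x - (n + 1 + n * n))
        (\<lambda>i. bit_at x (n + 1 + n * n + i))"
      using capped_value_tail[of "n + 1 + n * n" x "card S"] dec(3) by (simp add: valid_code_def)
    then show ?thesis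
      unfolding verifies_def Let_def dec(1,2) card_eq_sum[symmetric] set rem
      using dec(3) girth cert[OF F] by blast
  qed
  ultimately show thesis
    by (rule that)
qed

subsection \<open>The verifier runs in polynomial time\<close>

definition word_length :: "bool list \<Rightarrow> nat" where
  "word_length z = first_index (length z) (\<lambda>i. bit_at z (2 * i) \<noteq> bit_at z (2 * i + 1))"

definition word_bit :: "bool list \<Rightarrow> nat \<Rightarrow> bool" where
  "word_bit z i \<longleftrightarrow> i < word_length z \<and> bit_at z (2 * i)"

definition cert_bit :: "bool list \<Rightarrow> nat \<Rightarrow> bool" where
  "cert_bit z i = bit_at z (2 * word_length z + 2 + i)"

lemma word_length_pair_code: "word_length (pair_code x w) = length x"
  unfolding word_length_def
proof (rule first_index_eq)
  have bit: "bit_at (pair_code x w) p \<longleftrightarrow> bit_at x (p div 2) \<or> p = 2 * length x + 1"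
    if "p < 2 * length x + 2" for p
    using pair_code_nth[OF that] that unfolding bit_at_def length_pair_code by simp
  show "bit_at (pair_code x w) (2 * length x) \<noteq> bit_at (pair_code x w) (2 * length x + 1)"
    by (simp add: bit bit_at_def[of x])
  show "\<not> bit_at (pair_code x w) (2 * i) \<noteq> bit_at (pair_code x w) (2 * i + 1)" if "i < length x" for i
    using that bit[of "2 * i"] bit[of "2 * i + 1"] by auto
qed simp

lemma word_bit_pair_code: "word_bit (pair_code x w) = bit_at x"
proof
  fix i
  show "word_bit (pair_code x w) i = bit_at x i"
    using pair_code_nth[of "2 * i" x w]
    by (auto simp: word_bit_def word_length_pair_code bit_at_def)
qed

lemma cert_bit_pair_code: "cert_bit (pair_code x w) = bit_at w"
proof
  fix i
  show "cert_bit (pair_code x w) i = bit_at w i"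
    using pair_code_nth_right[of x w i]
    by (auto simp: cert_bit_def word_length_pair_code bit_at_def)
qed

lemma remaining_edges_iff:
  "{u, v} \<in> remaining_edges n X W \<longleftrightarrow> u < n \<and> v < n \<and>
    (X (Suc (n + (u * n + v))) \<or> X (Suc (n + (v * n + u)))) \<and> \<not> W u \<and> \<not> W v"
  unfolding remaining_edges_def mem_Collect_eq decoded_edges_iff by auto

lemma computable_verifies:
  "computable 0 (\<lambda>z e. of_bool (verifies p (word_length z) (word_bit z) (cert_bit z)))"
proof -
  define n where "n z = decoded_size (word_length z) (word_bit z)" for z
  define s where "s z = (\<Sum>v<n z. of_bool (cert_bit z v) :: nat)" for z
  have l: "computable m (\<lambda>z e. word_length z)" for m
    unfolding word_length_def by (intro computable_intros; simp)
  have X: "computable m (\<lambda>z e. of_bool (word_bit z (f z e)))" if "computable m f" for m f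
    unfolding word_bit_def by (intro computable_intros l that)
  have W: "computable m (\<lambda>z e. of_bool (cert_bit z (f z e)))" if "computable m f" for m f
    unfolding cert_bit_def by (intro computable_intros l that)
  have n: "computable m (\<lambda>z e. n z)" for m
    unfolding n_def decoded_size_def by (intro computable_intros l X; simp)
  have s: "computable m (\<lambda>z e. s z)" for m
    unfolding s_def by (intro computable_intros n W; simp)
  have E: "computable m (\<lambda>z e. of_bool ({f z e, g z e} \<in> decoded_edges (n z) (word_bit z)))"
    if "computable m f" "computable m g" for m f g
    unfolding decoded_edges_iff by (intro computable_intros n X that)
  have F: "computable m (\<lambda>z e. of_bool ({f z e, g z e} \<in> remaining_edges (n z) (word_bit z) (cert_bit z)))"
    if "computable m f" "computable m g" for m f g
    unfolding remaining_edges_iff by (intro computable_intros n X W that)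
  have C: "computable m (\<lambda>z e. of_bool (related (n z) (cert_bit z) (f z e) (g z e) (h z e)))"
    if "computable m f" "computable m g" "computable m h" for m f g h
    unfolding related_def by (intro computable_intros n W that)
  have valid: "computable 0 (\<lambda>z e. of_bool (valid_code (word_length z) (word_bit z) (n z)))"
    unfolding valid_code_def by (intro computable_intros n X l; simp)
  define G where "G z \<longleftrightarrow> (\<forall>c<n z ^ p. \<forall>l<p. \<not> (3 \<le> l \<and>
    (\<forall>i<l. {c div n z ^ i mod n z, c div n z ^ (Suc i mod l) mod n z} \<in> decoded_edges (n z) (word_bit z) \<and>
       (\<forall>j<i. c div n z ^ i mod n z \<noteq> c div n z ^ j mod n z))))" for z
  have G: "computable 0 (\<lambda>z e. of_bool (G z))"
    unfolding G_def by (rule computable_le_girth[OF n E])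
  let ?o = "\<lambda>z. n z + 1 + n z * n z"
  let ?b = "\<lambda>z i. word_bit z (?o z + i)"
  let ?h = "\<lambda>z e j r. if s z \<le> 2 * r + of_bool (?b z (word_length z - ?o z - Suc j)) then s z
     else 2 * r + of_bool (?b z (word_length z - ?o z - Suc j))"
  have capped: "computable 0 (\<lambda>z e. capped_value (s z) (word_length z - ?o z) (?b z))"
    unfolding capped_value_def
  proof (rule computable_rec[where H = ?h])
    show "poly_bounded 0 (\<lambda>z e. s z)"
      by (rule computableD) (rule s)
    show "rec_nat 0 (?h z e) i \<le> s z" for z e i
      by (cases i) auto
  qed (intro computable_intros n s l X; simp)+
  \<comment> \<open>Enumerating codes decides the girth of simple graphs. Validity ensures
    simplicity, and it is a conjunct of \<open>verifies\<close>, so the equivalence may be used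
    under it.\<close>
  have G_iff: "G z \<longleftrightarrow> enat p \<le> girth (decoded_edges (n z) (word_bit z))"
    if "valid_code (word_length z) (word_bit z) (n z)" for z
  proof -
    have "simple_graph {0..<n z} (decoded_edges (n z) (word_bit z))"
      using that unfolding valid_code_def by (intro simple_decoded) blast
    then show ?thesis
      unfolding G_def by (rule le_girth_iff_codes[symmetric])
  qed
  note cert = computable_reach_closed[OF n F C] computable_unique_turns[OF n F C]
    computable_odd_returns[OF n F C]
  have "verifies p (word_length z) (word_bit z) (cert_bit z) \<longleftrightarrow>
      valid_code (word_length z) (word_bit z) (n z) \<and> G z \<and>
      s z \<le> capped_value (s z) (word_length z - ?o z) (?b z) \<and>
      reach_closed (n z) (remaining_edges (n z) (word_bit z) (cert_bit z)) (related (n z) (cert_bit z)) \<and>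
      unique_turns (n z) (remaining_edges (n z) (word_bit z) (cert_bit z)) (related (n z) (cert_bit z)) \<and>
      odd_returns (n z) (remaining_edges (n z) (word_bit z) (cert_bit z)) (related (n z) (cert_bit z))" for z
    unfolding verifies_def Let_def n_def[symmetric] s_def[symmetric] using G_iff by blast
  then show ?thesis
    by (simp only:) (intro computable_conj computable_le valid G s capped cert)
qed

theorem ECT_girth_in_NP: "ECT_girth p \<in> NP"
proof -
  let ?R = "{z. verifies p (word_length z) (word_bit z) (cert_bit z)}"
  let ?b = "[:0, 1:] + [:0, 1:] ^ 3 :: nat poly"
  have "x \<in> ECT_girth p \<longleftrightarrow> (\<exists>w. length w \<le> poly ?b (length x) \<and> pair_code x w \<in> ?R)" for x
  proof -
    have "pair_code x w \<in> ?R \<longleftrightarrow> verifies p (length x) (bit_at x) (bit_at w)" for w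
      by (simp add: word_length_pair_code word_bit_pair_code cert_bit_pair_code)
    moreover have "poly ?b (length x) = length x + length x ^ 3"
      by simp
    ultimately show ?thesis
      using verifies_sound verifies_complete by metis
  qed
  moreover have "polytime_decidable ?R"
    by (rule polytime_decidableI) (rule computable_verifies)
  ultimately show ?thesis
    unfolding NP_def by blast
qed

theorem theorem9:
  fixes p :: nat
  assumes "p \<ge> 3"
  shows "NP_complete (ECT_girth p)"
  unfolding NP_complete_def using ECT_girth_in_NP ECT_girth_hard by blast

end
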